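(* (a) Nearest-neighbor model. For $d\ge 1$ let $p_c^{(2)}(d)$ be the threshold $p_c^{(2)}$ of the oriented percolation model on $\mathbb{N}\times\mathbb{Z}^d$ with $f(z)=\frac{1}{2d}\mathbf{1}_{\{|z|_1=1\}}$. Then, as $d\to\infty$, $$p_c^{(2)}(d)\ \ge\ 1+\frac{\log 2}{2d^2}+o(d^{-2}).$$ (b) Generalized spread-out model. Let $d\ge 3$ and let $F:\mathbb{R}^d\to[0,\infty)$ be a continuous compactly supported function with $\int_{\mathbb{R}^d}F(x)\,dx=1$, invariant under each reflection $(x_1,\dots,x_i,\dots,x_d)\mapsto(x_1,\dots,-x_i,\dots,x_d)$, $1\le i\le d$. For $L\in\mathbb{N}$ large set $f_L(x)=F(x/L)\big/\sum_{y\in\mathbb{Z}^d}F(y/L)$ for $x\in\mathbb{Z}^d$, and let $p_c^{(2)}(d,L)$ be the threshold $p_c^{(2)}$ of the oriented percolation model on $\mathbb{N}\times\mathbb{Z}^d$ with $f=f_L$. Then, as $L\to\infty$, $$p_c^{(2)}(d,L)\ \ge\ 1+\log 2\sum_{k=2}^{\infty}f_L^{*2k}(0)+O(L^{-3d/2}),$$ where $f_L^{*m}$ denotes the $m$-fold discrete convolution of $f_L$ with itself on $\mathbb{Z}^d$.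
   Context: Model. $\mathbb{N}=\{0,1,2,\dots\}$. Let $f:\mathbb{Z}^d\to[0,\infty)$ have finite support with $\sum_z f(z)=1$; put $p_{\max}:=\inf_{z}1/f(z)$ (with $1/0=\infty$) and let $p\in(0,p_{\max}]$. Under $\mathbb{P}_p$ (expectation $\mathbb{E}_p$), $(X_{(n,x),(n+1,y)})_{n\in\mathbb{N},\,x,y\in\mathbb{Z}^d}$ are independent Bernoulli variables with parameter $p f(y-x)$. The edge $((n,x),(n+1,y))$ is open if $X_{(n,x),(n+1,y)}=1$. A sequence $(S_n)$ in $\mathbb{Z}^d$ indexed by an interval of $\mathbb{N}$ is an open oriented path if all the edges $((n,S_n),(n+1,S_{n+1}))$ are open. Let $\mathcal{P}$ be the event that there is an infinite open path $(S_n)_{n\ge0}$ with $S_0=0$. Let $Z_N$ be the number of open paths $S:\{0,\dots,N\}\to\mathbb{Z}^d$ with $S_0=0$, so that $\mathbb{E}_p[Z_N]=p^N$. Growth rate. Let $\mathcal{X}:=\limsup_{N\to\infty}\frac1N\log Z_N$ (with $\log 0=-\infty$). On $\mathcal{P}$, $\mathcal{X}$ is almost surely constant. Let $\mathrm{f}(p)$ be this constant (i.e. $\mathcal{X}=\mathrm{f}(p)$, $\mathbb{P}_p(\cdot\mid\mathcal{P})$-a.s.) if $\mathbb{P}_p(\mathcal{P})>0$, and $\mathrm{f}(p):=-\infty$ if $\mathbb{P}_p(\mathcal{P})=0$. The function $p\mapsto \mathrm{f}(p)-\log p$ is non-decreasing and $\le 0$. Threshold. $p_c^{(2)}:=\inf\{p\in(0,p_{\max}]:\mathrm{f}(p)=\log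 p\}$, with the convention $p_c^{(2)}:=p_{\max}$ if this set is empty. Notation. $|z|_1=\sum_i|z_i|$. The constant in $O(\cdot)$ may depend on $d$ and $F$; an inequality $A\ge B+O(g)$ means $A\ge B-Cg$ for some constant $C$ and all large enough values of the parameter, and similarly for $o(\cdot)$. *)

theory Defs
  imports
    "HOL-Probability.Probability"
    "HOL-Library.Function_Algebras"
begin

(* The oriented percolation model lives on nat x V, where V is (the carrier of) a countable
   subgroup of an additive abelian group: V = UNIV :: (int ^ 'n) set gives Z^d with d = CARD('n),
   and V = Zd d gives Z^d for a numeral d that can be quantified over. *)

(* A configuration maps (n, x, y) to the state X of the edge ((n, x), (n + 1, y)). *)

type_synonym 'a config = "nat \<times> 'a \<times> 'a \<Rightarrow> bool"

(* The law P_p. For p in (0, p_max] the parameters p * f (y - x) lie in [0, 1], so the truncation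
   built into bernoulli_pmf is inactive. The product measure is completed because edges of
   parameter 0 are only almost surely closed: existence of an infinite open path is an event of the
   product sigma-algebra only up to a null set. *)

definition perc_measure :: "'a::ab_group_add set \<Rightarrow> ('a \<Rightarrow> real) \<Rightarrow> real \<Rightarrow> 'a config measure" where
  "perc_measure V f p =
     completion (PiM (UNIV \<times> V \<times> V) (\<lambda>(n, x, y). measure_pmf (bernoulli_pmf (p * f (y - x)))))"

definition open_path :: "'a config \<Rightarrow> nat set \<Rightarrow> (nat \<Rightarrow> 'a) \<Rightarrow> bool" where
  "open_path \<omega> I S \<longleftrightarrow> (\<forall>n. n \<in> I \<and> Suc n \<in> I \<longrightarrow> \<omega> (n, S n, S (Suc n)))"

definition percolates :: "'a::ab_group_add set \<Rightarrow> 'a config \<Rightarrow> bool" where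
  "percolates V \<omega> \<longleftrightarrow> (\<exists>S \<in> UNIV \<rightarrow> V. S 0 = 0 \<and> open_path \<omega> UNIV S)"

(* If f has finite support, the set of paths counted here is almost surely finite. *)

definition num_paths :: "'a::ab_group_add set \<Rightarrow> 'a config \<Rightarrow> nat \<Rightarrow> nat" where
  "num_paths V \<omega> N = card {S \<in> {..N} \<rightarrow>\<^sub>E V. S 0 = 0 \<and> open_path \<omega> {..N} S}"

definition log_ext :: "nat \<Rightarrow> ereal" where
  "log_ext m = (if m = 0 then -\<infinity> else ereal (ln (real m)))"

definition path_growth :: "'a::ab_group_add set \<Rightarrow> 'a config \<Rightarrow> ereal" where
  "path_growth V \<omega> = limsup (\<lambda>N. log_ext (num_paths V \<omega> N) / ereal (real N))"

definition percolation_event :: "'a::ab_group_add set \<Rightarrow> ('a \<Rightarrow> real) \<Rightarrow> real \<Rightarrow> 'a config set" where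
  "percolation_event V f p = {\<omega> \<in> space (perc_measure V f p). percolates V \<omega>}"

definition growth_rate :: "'a::ab_group_add set \<Rightarrow> ('a \<Rightarrow> real) \<Rightarrow> real \<Rightarrow> ereal" where
  "growth_rate V f p =
     (if measure (perc_measure V f p) (percolation_event V f p) > 0
      then (THE c. AE \<omega> in perc_measure V f p.
              \<omega> \<in> percolation_event V f p \<longrightarrow> path_growth V \<omega> = c)
      else -\<infinity>)"

(* In ereal, 1 / 0 = \<infinity>. *)

definition p_max :: "'a set \<Rightarrow> ('a \<Rightarrow> real) \<Rightarrow> ereal" where
  "p_max V f = (INF z\<in>V. 1 / ereal (f z))"

definition pc2 :: "'a::ab_group_add set \<Rightarrow> ('a \<Rightarrow> real) \<Rightarrow> ereal" where
  "pc2 V f =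
     (let A = {p::real. 0 < p \<and> ereal p \<le> p_max V f \<and> growth_rate V f p = ereal (ln p)}
      in if A = {} then p_max V f else (INF p\<in>A. ereal p))"

definition Zd :: "nat \<Rightarrow> (nat \<Rightarrow> int) set" where
  "Zd d = {z. \<forall>i\<ge>d. z i = 0}"

definition nn_kernel :: "nat \<Rightarrow> (nat \<Rightarrow> int) \<Rightarrow> real" where
  "nn_kernel d z = (if (\<Sum>i<d. \<bar>z i\<bar>) = 1 then 1 / (2 * real d) else 0)"

definition scale_pt :: "nat \<Rightarrow> int ^ 'n \<Rightarrow> real ^ 'n" where
  "scale_pt L x = (\<chi> i. real_of_int (x $ i) / real L)"

(* For compactly supported F and L > 0 the normalising sum has finitely many nonzero terms. *)

definition spread_kernel :: "(real ^ 'n \<Rightarrow> real) \<Rightarrow> nat \<Rightarrow> int ^ 'n \<Rightarrow> real" where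
  "spread_kernel F L x = F (scale_pt L x) / (\<Sum>\<^sub>\<infinity>y. F (scale_pt L y))"

fun conv_power :: "('a::ab_group_add \<Rightarrow> real) \<Rightarrow> nat \<Rightarrow> 'a \<Rightarrow> real" where
  "conv_power f 0 = (\<lambda>x. if x = 0 then 1 else 0)"
| "conv_power f (Suc m) = (\<lambda>x. \<Sum>\<^sub>\<infinity>y. f y * conv_power f m (x - y))"

end

(*
For p below the bound, the number Z_N of open paths grows strictly slower than p^N. By the
subadditivity of x^t for t < 1, it suffices that the sum over x of E[Z_T(x)^t] is less than p^(tT)
for some T and some t < 1 close to 1, where Z_T(x) counts the open paths from the origin to (T, x).
Taking the derivative at t = 1, this holds if the sum over x of E[Z_T(x) log Z_T(x)] exceeds
p^T T log p. This entropy is, up to the factor p^T, the mean of log Z_T(S_T) for a random walk path S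
whose edges are forced to be open.

A detour is an open path which leaves S and returns to it later without meeting it in between. The
expected number of detours of length l from a given time on is at least f^{*2l}(0) minus the sum of
f^{*2m}(0) f^{*2(l-m)}(0) over 0 < m < l, which accounts for the paths that meet S in between. A detour is good if there is no open path that uses none of the edges of S and of the detour,
but connects two of their vertices at overlapping times. Good detours do not overlap in time, so k
good detours give 2^k open paths, whence the factor log 2. Detours which are not good only contribute
to second order, because the interfering path uses fresh edges. In the nearest-neighbour model,
detours of length 2 suffice. In the spread-out model, all lengths up to L^d are used, together with
the bound f_L^{*n}(x) <= A L^{-d} n^{-3/2}.

A zero-one argument shows that the growth rate is almost surely constant on percolation.
*)

theory Submission
  imports Defs "HOL-Real_Asymp.Real_Asymp"
begin

section \<open>Step lists and convolution powers\<close>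

text \<open>The mean of log of the path count is bounded below configuration by configuration. The
  indicator that a detour is good is replaced by the indicator that it is open minus a sum over
  single interferences; each term is then a probability that disjoint edge sets are open. This is
  why interferences must avoid the edges of S and of the detour. The obstacle is the factor p^n for
  interfering paths of length n when p > 1. It calls for a cutoff K on all lengths: only p up to 1 +
  const * L^(-d) matter, so p^n stays bounded for n <= K = L^d. The same K balances the errors:
  returns beyond K contribute L^(-d) times the tail of n^(-3/2), interferences contribute L^(-2d) *
  sqrt K, and both are of order L^(-3d/2), while paths that meet S in between cost only L^(-2d). In
  the nearest-neighbour model K = 2, and the constant is f^{*4}(0) = 3/(4 d^2) + O(d^(-3)) minus the
  square of f^{*2}(0) = 1/(2d), that is 1/(2 d^2) to leading order. Values p < 1 are settled by the
  first moment.\<close>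

declare conv_power.simps(2) [simp del]

text \<open>The operator form over a finite set containing the support can be iterated and commuted,
  which the infinite sum in \<open>conv_power\<close> does not directly allow.\<close>

definition conv_on :: "'a::ab_group_add set \<Rightarrow> ('a \<Rightarrow> real) \<Rightarrow> ('a \<Rightarrow> real) \<Rightarrow> 'a \<Rightarrow> real" where
  "conv_on S f h x = (\<Sum>y\<in>S. f y * h (x - y))"

lemma conv_power_Suc_on:
  assumes "finite S" "{z. f z \<noteq> 0} \<subseteq> S"
  shows "conv_power f (Suc m) = conv_on S f (conv_power f m)"
proof
  fix x
  have "(\<Sum>\<^sub>\<infinity>y. f y * conv_power f m (x - y)) = (\<Sum>\<^sub>\<infinity>y\<in>S. f y * conv_power f m (x - y))"
    by (rule infsum_cong_neutral) (use assms(2) in auto)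
  then show "conv_power f (Suc m) x = conv_on S f (conv_power f m) x"
    using assms by (simp add: conv_power.simps(2) conv_on_def)
qed

lemma conv_power_1_on:
  assumes "finite S" "{z. f z \<noteq> 0} \<subseteq> S"
  shows "conv_power f 1 x = f x"
proof -
  have "conv_power f (Suc 0) x = (\<Sum>y\<in>S. if x = y then f y else 0)"
    unfolding conv_power_Suc_on[OF assms] conv_on_def by (intro sum.cong) auto
  then show ?thesis using assms by auto
qed

text \<open>A path is encoded by its increments rather than its positions: the paths of a given
  length form a finite set that does not depend on the starting point, and weights multiply under
  \<open>@\<close>.\<close>

definition steps :: "'a set \<Rightarrow> nat \<Rightarrow> 'a list set" where
  "steps D n = {s. set s \<subseteq> D \<and> length s = n}"

definition wt :: "('a \<Rightarrow> real) \<Rightarrow> 'a list \<Rightarrow> real" where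
  "wt f s = prod_list (map f s)"

lemma wt_simps [simp]: "wt f [] = 1" "wt f (z # s) = f z * wt f s" "wt f (s @ t) = wt f s * wt f t"
  by (simp_all add: wt_def)

lemma finite_steps [simp]: "finite D \<Longrightarrow> finite (steps D n)"
  unfolding steps_def by (rule finite_lists_length_eq)

lemma steps_0 [simp]: "steps D 0 = {[]}"
  by (auto simp: steps_def)

lemma length_steps: "s \<in> steps D n \<Longrightarrow> length s = n"
  by (simp add: steps_def)

lemma append_in_steps: "s \<in> steps D n \<Longrightarrow> t \<in> steps D m \<Longrightarrow> s @ t \<in> steps D (n + m)"
  by (auto simp: steps_def)

text \<open>Cutting a list after \<open>n\<close> entries is a bijection. Together with the product
  form of \<open>wt\<close> this serves as the Markov property in all later factorisations.\<close>

lemma sum_steps_append: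
  fixes g :: "'a list \<Rightarrow> 'b::comm_monoid_add"
  assumes "finite D"
  shows "(\<Sum>s\<in>steps D (n + m). g s) = (\<Sum>s\<in>steps D n. \<Sum>t\<in>steps D m. g (s @ t))"
proof -
  have "bij_betw (\<lambda>(s, t). s @ t) (steps D n \<times> steps D m) (steps D (n + m))"
    by (rule bij_betw_byWitness[where f' = "\<lambda>s. (take n s, drop n s)"])
       (auto simp: steps_def dest: in_set_takeD in_set_dropD)
  then show ?thesis
    by (simp add: sum.reindex_bij_betw[symmetric] sum.cartesian_product case_prod_unfold)
qed

lemma sum_steps_1:
  fixes g :: "'a list \<Rightarrow> 'b::comm_monoid_add"
  shows "(\<Sum>s\<in>steps D 1. g s) = (\<Sum>z\<in>D. g [z])"
proof -
  have "bij_betw (\<lambda>z. [z]) D (steps D 1)"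
    by (rule bij_betw_byWitness[where f' = hd]) (auto simp: steps_def length_Suc_conv)
  then show ?thesis
    by (simp add: sum.reindex_bij_betw[symmetric])
qed

lemma sum_steps_Suc:
  fixes g :: "'a list \<Rightarrow> 'b::comm_monoid_add"
  assumes "finite D"
  shows "(\<Sum>s\<in>steps D (Suc n). g s) = (\<Sum>z\<in>D. \<Sum>s\<in>steps D n. g (z # s))"
  using sum_steps_append[OF assms, of g 1 n] by (simp only: sum_steps_1) simp

text \<open>Symmetry turns the chance that two independent walks coincide after \<open>n\<close>
  steps into a return probability after \<open>2 * n\<close> steps; see
  \<open>conv_power_double\<close>.\<close>

locale kernel =
  fixes f :: "'a::ab_group_add \<Rightarrow> real"
  assumes nonneg: "f z \<ge> 0"
    and finite_supp: "finite {z. f z \<noteq> 0}"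
    and sum_supp: "(\<Sum>z | f z \<noteq> 0. f z) = 1"
    and symm: "f (- z) = f z"
begin

definition D :: "'a set" where "D = {z. f z \<noteq> 0}"

lemma finite_D [simp]: "finite D" and sum_D: "sum f D = 1"
  using finite_supp sum_supp by (simp_all add: D_def)

lemma uminus_D: "- z \<in> D \<longleftrightarrow> z \<in> D"
  by (simp add: D_def symm)

lemma wt_nonneg: "wt f s \<ge> 0"
  by (induction s) (auto intro!: mult_nonneg_nonneg nonneg)

lemma conv_power_Suc: "conv_power f (Suc m) x = (\<Sum>y\<in>D. f y * conv_power f m (x - y))"
  by (subst conv_power_Suc_on[OF finite_D]) (simp_all add: D_def conv_on_def)

lemma conv_power_steps:
  "conv_power f n x = (\<Sum>s\<in>steps D n. if sum_list s = x then wt f s else 0)"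
proof (induction n arbitrary: x)
  case 0
  then show ?case by auto
next
  case (Suc n)
  have "conv_power f (Suc n) x = (\<Sum>y\<in>D. f y * (\<Sum>s\<in>steps D n. if sum_list s = x - y then wt f s else 0))"
    by (simp add: conv_power_Suc Suc)
  also have "\<dots> = (\<Sum>y\<in>D. \<Sum>s\<in>steps D n. if sum_list (y # s) = x then wt f (y # s) else 0)"
    by (intro sum.cong refl) (auto simp: sum_distrib_left algebra_simps intro!: sum.cong)
  finally show ?case by (simp add: sum_steps_Suc)
qed

lemma conv_power_nonneg: "conv_power f n x \<ge> 0"
  by (simp add: conv_power_steps sum_nonneg wt_nonneg)

lemma sum_wt_steps: "(\<Sum>s\<in>steps D n. wt f s) = 1"
proof (induction n)
  case (Suc n)
  have "(\<Sum>s\<in>steps D (Suc n). wt f s) = (\<Sum>z\<in>D. f z * (\<Sum>s\<in>steps D n. wt f s))"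
    by (simp add: sum_steps_Suc sum_distrib_left)
  then show ?case by (simp add: Suc sum_D)
qed simp

lemma conv_power_add:
  "conv_power f (n + m) x = (\<Sum>s\<in>steps D n. wt f s * conv_power f m (x - sum_list s))"
proof -
  have "conv_power f (n + m) x =
      (\<Sum>s\<in>steps D n. \<Sum>t\<in>steps D m. if sum_list (s @ t) = x then wt f (s @ t) else 0)"
    by (simp only: conv_power_steps sum_steps_append[OF finite_D])
  also have "\<dots> = (\<Sum>s\<in>steps D n. wt f s * conv_power f m (x - sum_list s))"
    by (intro sum.cong refl) (auto simp: conv_power_steps sum_distrib_left algebra_simps intro!: sum.cong)
  finally show ?thesis .
qed

lemma conv_power_minus: "conv_power f n (- x) = conv_power f n x"
proof (induction n arbitrary: x)
  case (Suc n)
  have "bij_betw uminus D D"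
    by (rule bij_betw_byWitness[where f' = uminus]) (auto simp: uminus_D)
  then have "(\<Sum>y\<in>D. f y * conv_power f n (- x - y)) = (\<Sum>y\<in>D. f (- y) * conv_power f n (- x - - y))"
    by (rule sum.reindex_bij_betw[symmetric])
  also have "\<dots> = (\<Sum>y\<in>D. f y * conv_power f n (- (x - y)))"
    by (simp add: symm algebra_simps)
  also have "\<dots> = (\<Sum>y\<in>D. f y * conv_power f n (x - y))"
    by (simp only: Suc)
  finally show ?case by (simp add: conv_power_Suc)
qed simp

lemma conv_power_double:
  "(\<Sum>s\<in>steps D n. wt f s * conv_power f n (sum_list s)) = conv_power f (2 * n) 0"
  by (simp add: mult_2 conv_power_add conv_power_minus)

text \<open>Convolution with a probability kernel averages translates, so a uniform bound
  persists.\<close>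

lemma conv_power_le:
  assumes "\<And>x. conv_power f n x \<le> M"
  shows "conv_power f (n + m) x \<le> M"
proof -
  have "conv_power f (m + n) x \<le> (\<Sum>s\<in>steps D m. wt f s * M)"
    unfolding conv_power_add by (intro sum_mono mult_left_mono assms wt_nonneg)
  then show ?thesis by (simp add: sum_distrib_right[symmetric] sum_wt_steps add.commute)
qed

end

section \<open>Open paths and detours\<close>

abbreviation pos :: "'a::ab_group_add list \<Rightarrow> nat \<Rightarrow> 'a" where
  "pos s k \<equiv> sum_list (take k s)"

lemma pos_Suc: "k < length s \<Longrightarrow> pos s (Suc k) = pos s k + s ! k"
  by (simp add: take_Suc_conv_app_nth)

lemma list_eq_pos:
  assumes "length s = length t" "\<And>k. k \<le> length s \<Longrightarrow> pos s k = pos t k"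
  shows "s = t"
proof (rule nth_equalityI)
  fix k assume k: "k < length s"
  have "pos s k + s ! k = pos t k + t ! k"
    using assms(2)[of "Suc k"] pos_Suc[of k s] pos_Suc[of k t] k assms(1) by simp
  then show "s ! k = t ! k" using assms(2)[of k] k by simp
qed (rule assms)

lemma pos_slice:
  assumes "k \<le> n"
  shows "pos s a + pos (take n (drop a s)) k = pos s (a + k)"
proof -
  have "pos s (a + k) = sum_list (take a s @ take k (drop a s))"
    by (simp only: take_add)
  then show ?thesis using assms by (simp add: min_def)
qed

fun edges :: "nat \<Rightarrow> 'a::ab_group_add \<Rightarrow> 'a list \<Rightarrow> (nat \<times> 'a \<times> 'a) set" where
  "edges n x [] = {}"
| "edges n x (z # s) = insert (n, x, x + z) (edges (Suc n) (x + z) s)"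

lemma finite_edges [simp]: "finite (edges n x s)"
  by (induction s arbitrary: n x) auto

lemma edges_append: "edges n x (s @ t) = edges n x s \<union> edges (n + length s) (x + sum_list s) t"
  by (induction s arbitrary: n x) (auto simp: add.assoc)

lemma edges_iff:
  "(m, u, v) \<in> edges n x s \<longleftrightarrow>
     n \<le> m \<and> m < n + length s \<and> u = x + pos s (m - n) \<and> v = x + pos s (Suc m - n)"
proof (induction s arbitrary: n x m)
  case (Cons z s)
  show ?case
  proof (cases "m = n")
    case False
    then show ?thesis
      by (cases "n < m") (auto simp: Cons.IH add.assoc Suc_diff_Suc take_Cons' Suc_diff_le)
  qed (auto simp: Cons.IH)
qed auto

text \<open>Only step lists over \<open>D\<close> are counted, so for finite \<open>D\<close> the
  counts are finite on every configuration, including the null set where edges of parameter 0 are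
  open.\<close>

definition cnt :: "'a::ab_group_add set \<Rightarrow> (nat \<times> 'a \<times> 'a \<Rightarrow> bool) \<Rightarrow> nat \<Rightarrow> 'a \<Rightarrow> nat \<Rightarrow> 'a \<Rightarrow> nat" where
  "cnt D \<omega> n x N y = card {s \<in> steps D N. x + sum_list s = y \<and> edges n x s \<subseteq> Collect \<omega>}"

definition tot :: "'a::ab_group_add set \<Rightarrow> (nat \<times> 'a \<times> 'a \<Rightarrow> bool) \<Rightarrow> nat \<Rightarrow> 'a \<Rightarrow> nat \<Rightarrow> nat" where
  "tot D \<omega> n x N = card {s \<in> steps D N. edges n x s \<subseteq> Collect \<omega>}"

lemma cnt_pos:
  assumes "finite D" "s \<in> steps D N" "x + sum_list s = y" "edges n x s \<subseteq> Collect \<omega>"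
  shows "cnt D \<omega> n x N y \<ge> 1"
  using assms by (auto simp: cnt_def Suc_le_eq card_gt_0_iff)

lemma cnt_ge_2:
  assumes "finite D" "s \<in> steps D N" "x + sum_list s = y" "edges n x s \<subseteq> Collect \<omega>"
    and "t \<in> steps D N" "x + sum_list t = y" "edges n x t \<subseteq> Collect \<omega>" and "s \<noteq> t"
  shows "cnt D \<omega> n x N y \<ge> 2"
proof -
  have "card {s, t} \<le> cnt D \<omega> n x N y"
    unfolding cnt_def using assms by (intro card_mono) auto
  with \<open>s \<noteq> t\<close> show ?thesis by simp
qed

lemma cnt_append_le:
  assumes "finite D"
  shows "cnt D \<omega> n x N v * cnt D \<omega> (n + N) v M y \<le> cnt D \<omega> n x (N + M) y"
proof -
  let ?A = "{s \<in> steps D N. x + sum_list s = v \<and> edges n x s \<subseteq> Collect \<omega>}"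
  let ?B = "{s \<in> steps D M. v + sum_list s = y \<and> edges (n + N) v s \<subseteq> Collect \<omega>}"
  have "inj_on (\<lambda>(s, t). s @ t) (?A \<times> ?B)"
    by (auto simp: inj_on_def steps_def)
  moreover have "(\<lambda>(s, t). s @ t) ` (?A \<times> ?B)
      \<subseteq> {s \<in> steps D (N + M). x + sum_list s = y \<and> edges n x s \<subseteq> Collect \<omega>}"
    by (auto simp: append_in_steps edges_append length_steps add.assoc)
  ultimately have "card (?A \<times> ?B) \<le> cnt D \<omega> n x (N + M) y"
    unfolding cnt_def using assms by (intro card_inj_on_le) auto
  then show ?thesis by (simp add: cnt_def card_cartesian_product)
qed

lemma cnt_append:
  assumes "finite D"
  shows "cnt D \<omega> n x (N + M) y =
    (\<Sum>v\<in>(\<lambda>s. x + sum_list s) ` steps D N. cnt D \<omega> n x N v * cnt D \<omega> (n + N) v M y)"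
proof -
  let ?V = "(\<lambda>s. x + sum_list s) ` steps D N"
  let ?A = "\<lambda>v. {s \<in> steps D N. x + sum_list s = v \<and> edges n x s \<subseteq> Collect \<omega>}"
  let ?B = "\<lambda>v. {s \<in> steps D M. v + sum_list s = y \<and> edges (n + N) v s \<subseteq> Collect \<omega>}"
  let ?C = "{s \<in> steps D (N + M). x + sum_list s = y \<and> edges n x s \<subseteq> Collect \<omega>}"
  have "bij_betw (\<lambda>(v, s, t). s @ t) (SIGMA v:?V. ?A v \<times> ?B v) ?C"
  proof (rule bij_betw_byWitness[where f' = "\<lambda>s. (x + sum_list (take N s), take N s, drop N s)"])
    show "(\<lambda>s. (x + sum_list (take N s), take N s, drop N s)) ` ?C \<subseteq> (SIGMA v:?V. ?A v \<times> ?B v)"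
    proof safe
      fix s assume s: "s \<in> steps D (N + M)" "edges n x s \<subseteq> Collect \<omega>" "y = x + sum_list s"
      have t: "take N s \<in> steps D N" "drop N s \<in> steps D M"
        using s(1) by (auto simp: steps_def dest: in_set_takeD in_set_dropD)
      have e: "edges n x s = edges n x (take N s) \<union> edges (n + N) (x + sum_list (take N s)) (drop N s)"
        using edges_append[of n x "take N s" "drop N s"] length_steps[OF t(1)] by simp
      show "x + sum_list (take N s) \<in> ?V" "take N s \<in> steps D N" "drop N s \<in> steps D M"
        using t by auto
      show "x + sum_list (take N s) + sum_list (drop N s) = x + sum_list s"
        by (simp add: add.assoc flip: sum_list_append)
      show "\<omega> z" if "z \<in> edges n x (take N s)" for z using that e s(2) by auto
      show "\<omega> z" if "z \<in> edges (n + N) (x + sum_list (take N s)) (drop N s)" for z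
        using that e s(2) by auto
    qed
  next
    show "(\<lambda>(v, s, t). s @ t) ` (SIGMA v:?V. ?A v \<times> ?B v) \<subseteq> ?C"
    proof
      fix w assume "w \<in> (\<lambda>(v, s, t). s @ t) ` (SIGMA v:?V. ?A v \<times> ?B v)"
      then obtain v s t where w: "w = s @ t" and s: "s \<in> ?A v" and t: "t \<in> ?B v" by auto
      then show "w \<in> ?C"
        using append_in_steps[of s D N t M] by (auto simp: edges_append length_steps add.assoc)
    qed
  next
    show "\<forall>w\<in>SIGMA v:?V. ?A v \<times> ?B v. (\<lambda>s. (x + sum_list (take N s), take N s, drop N s))
        ((\<lambda>(v, s, t). s @ t) w) = w"
    proof
      fix w assume "w \<in> (SIGMA v:?V. ?A v \<times> ?B v)"
      then obtain v s t where w: "w = (v, s, t)" and s: "s \<in> ?A v" by auto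
      then have "length s = N" "x + sum_list s = v" by (auto dest: length_steps)
      then show "(\<lambda>s. (x + sum_list (take N s), take N s, drop N s)) ((\<lambda>(v, s, t). s @ t) w) = w"
        by (simp add: w)
    qed
  qed simp
  then have "card ?C = card (SIGMA v:?V. ?A v \<times> ?B v)"
    by (rule bij_betw_same_card[symmetric])
  also have "\<dots> = (\<Sum>v\<in>?V. card (?A v \<times> ?B v))"
    using assms by (subst card_SigmaI) auto
  finally show ?thesis by (simp add: cnt_def card_cartesian_product)
qed

lemma tot_append_ge:
  assumes "finite D" "cnt D \<omega> n x N v \<ge> 1"
  shows "tot D \<omega> (n + N) v M \<le> tot D \<omega> n x (N + M)"
proof -
  have "{s \<in> steps D N. x + sum_list s = v \<and> edges n x s \<subseteq> Collect \<omega>} \<noteq> {}"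
    using assms(2) unfolding cnt_def by (intro notI) simp
  then obtain s where s: "s \<in> steps D N" "x + sum_list s = v" "edges n x s \<subseteq> Collect \<omega>"
    by auto
  show ?thesis
    unfolding tot_def
    by (rule card_inj_on_le[where f = "\<lambda>t. s @ t"])
       (use s assms(1) in \<open>auto simp: inj_on_def append_in_steps edges_append length_steps\<close>)
qed

lemma tot_eq_sum_cnt:
  assumes "finite D"
  shows "tot D \<omega> n x N = (\<Sum>y\<in>(\<lambda>s. x + sum_list s) ` steps D N. cnt D \<omega> n x N y)"
proof -
  have "tot D \<omega> n x N = card (\<Union>y\<in>(\<lambda>s. x + sum_list s) ` steps D N.
      {s \<in> steps D N. x + sum_list s = y \<and> edges n x s \<subseteq> Collect \<omega>})"
    unfolding tot_def by (rule arg_cong[where f = card]) auto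
  also have "\<dots> = (\<Sum>y\<in>(\<lambda>s. x + sum_list s) ` steps D N. cnt D \<omega> n x N y)"
    unfolding cnt_def using assms by (subst card_UN_disjoint) auto
  finally show ?thesis .
qed

section \<open>Detours, interferences and good detours\<close>

definition detour :: "'a::ab_group_add set \<Rightarrow> nat \<Rightarrow> 'a list \<Rightarrow> nat \<times> nat \<times> 'a list \<Rightarrow> bool" where
  "detour D K S = (\<lambda>(i, l, g). 2 \<le> l \<and> l \<le> K \<and> i + l \<le> length S \<and> g \<in> steps D l \<and>
     pos S i + sum_list g = pos S (i + l) \<and>
     (\<forall>m. 0 < m \<and> m < l \<longrightarrow> pos S i + pos g m \<noteq> pos S (i + m)))"

text \<open>Outside its time interval the detour is continued by \<open>S\<close>, so
  \<open>pos S a\<close> and \<open>dpos S d a\<close> are all the vertices of the two paths at time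
  \<open>a\<close>.\<close>

definition dpos :: "'a::ab_group_add list \<Rightarrow> nat \<times> nat \<times> 'a list \<Rightarrow> nat \<Rightarrow> 'a" where
  "dpos S = (\<lambda>(i, l, g) k. if i \<le> k \<and> k \<le> i + l then pos S i + pos g (k - i) else pos S k)"

definition dedges :: "'a::ab_group_add list \<Rightarrow> nat \<times> nat \<times> 'a list \<Rightarrow> (nat \<times> 'a \<times> 'a) set" where
  "dedges S = (\<lambda>(i, l, g). edges i (pos S i) g)"

text \<open>
  A detour is encoded as its start time, its length and its list of steps. An interference is encoded
  as its length, its start time, its start point and its list of steps; it leaves from and returns
  to the union of \<open>S\<close> and the detour without using their edges, so that its openness is
  independent of theirs.
\<close>

definition interf :: "'a::ab_group_add set \<Rightarrow> nat \<Rightarrow> 'a list \<Rightarrow> nat \<times> nat \<times> 'a list \<Rightarrow>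
    (nat \<times> nat \<times> 'a \<times> 'a list) set" where
  "interf D K S d = {(n, a, x, e). 1 \<le> n \<and> n \<le> K \<and> a < fst d + fst (snd d) \<and> fst d < a + n \<and>
     x \<in> {pos S a, dpos S d a} \<and> e \<in> steps D n \<and> x + sum_list e \<in> {pos S (a + n), dpos S d (a + n)} \<and>
     edges a x e \<inter> (edges 0 0 S \<union> dedges S d) = {}}"

text \<open>Excluding interferences up to length \<open>K\<close> is enough, since a piece of a
  competing detour is no longer than \<open>K\<close>.\<close>

definition good :: "'a::ab_group_add set \<Rightarrow> nat \<Rightarrow> 'a list \<Rightarrow> (nat \<times> 'a \<times> 'a \<Rightarrow> bool) \<Rightarrow>
    nat \<times> nat \<times> 'a list \<Rightarrow> bool" where
  "good D K S \<omega> d \<longleftrightarrow> dedges S d \<subseteq> Collect \<omega> \<and>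
     (\<forall>(n, a, x, e) \<in> interf D K S d. \<not> edges a x e \<subseteq> Collect \<omega>)"

text \<open>As \<open>2 \<le> l\<close>, every edge of the detour has an endpoint at an interior
  time, where the detour avoids \<open>S\<close>. A detour of length one would be the step of
  \<open>S\<close> itself.\<close>

lemma detour_edges_disjoint:
  assumes "detour D K S d"
  shows "dedges S d \<inter> edges 0 0 S = {}"
proof (rule ccontr)
  obtain i l g where d: "d = (i, l, g)" by (metis prod_cases3)
  note dt = assms[unfolded d detour_def, simplified]
  have lg: "length g = l" using dt by (auto dest: length_steps)
  assume "\<not> ?thesis"
  then obtain k u v where "(k, u, v) \<in> edges i (pos S i) g" "(k, u, v) \<in> edges 0 0 S"
    by (auto simp: d dedges_def)
  then have k: "i \<le> k" "k < i + l" "pos S i + pos g (k - i) = pos S k"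
      "pos S i + pos g (Suc k - i) = pos S (Suc k)"
    by (auto simp: edges_iff lg)
  have avoid: "pos S i + pos g m \<noteq> pos S (i + m)" if "0 < m" "m < l" for m
    using dt that by blast
  have "(0 < k - i \<and> k - i < l) \<or> (0 < Suc k - i \<and> Suc k - i < l)"
    using k dt by linarith
  then show False
    using avoid[of "k - i"] avoid[of "Suc k - i"] k by (auto simp: add.commute)
qed

text \<open>
  If two overlapping detours differ at some time, the piece of the second one around this time,
  between its last previous and its first next visit to \<open>S\<close> and the first one, is an open
  interference of the first one.
\<close>

lemma good_no_overlap:
  assumes d: "detour D K S d" "good D K S \<omega> d"
    and d': "detour D K S d'" "dedges S d' \<subseteq> Collect \<omega>"
    and ov: "fst d < fst d' + fst (snd d')" "fst d' < fst d + fst (snd d)"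
  shows "d = d'"
proof -
  obtain i l g where de: "d = (i, l, g)" by (metis prod_cases3)
  obtain i' l' g' where de': "d' = (i', l', g')" by (metis prod_cases3)
  note dt = d(1)[unfolded de detour_def, simplified]
  note dt' = d'(1)[unfolded de' detour_def, simplified]
  have lg: "length g = l" "length g' = l'" using dt dt' by (auto dest: length_steps)
  have ov: "i < i' + l'" "i' < i + l" using ov by (simp_all add: de de')
  define Q where "Q = dpos S d"
  define Q' where "Q' = (\<lambda>k. pos S i' + pos g' (k - i'))"
  have Q: "Q k = pos S i + pos g (k - i)" if "i \<le> k" "k \<le> i + l" for k
    using that by (simp add: Q_def dpos_def de)
  have int: "pos S k \<noteq> Q k" if "i < k" "k < i + l" for k
  proof -
    have "pos S i + pos g m \<noteq> pos S (i + m)" if "0 < m" "m < l" for m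
      using dt that by blast
    from this[of "k - i"] show ?thesis using Q[of k] that less_diff_conv2[of i k l] by (auto simp: add.commute)
  qed
  have int': "pos S k \<noteq> Q' k" if "i' < k" "k < i' + l'" for k
  proof -
    have "pos S i' + pos g' m \<noteq> pos S (i' + m)" if "0 < m" "m < l'" for m
      using dt' that by blast
    from this[of "k - i'"] show ?thesis using that less_diff_conv2[of i' k l'] by (auto simp: Q'_def add.commute)
  qed
  have Qi: "Q i = pos S i" "Q (i + l) = pos S (i + l)" using Q dt lg by auto
  have Qi': "Q' i' = pos S i'" "Q' (i' + l') = pos S (i' + l')" using dt' lg by (auto simp: Q'_def)
  have eq: "Q' t = Q t \<and> Q' (Suc t) = Q (Suc t)"
    if t: "i \<le> t" "t < i + l" "i' \<le> t" "t < i' + l'" for t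
  proof (rule ccontr)
    assume neq: "\<not> ?thesis"
    define A where "A = {k. i' \<le> k \<and> k \<le> i' + l' \<and> Q' k \<in> {pos S k, Q k}}"
    have iA: "i' \<in> A" "i' + l' \<in> A" using Qi' by (auto simp: A_def)
    have finA: "finite A" by (rule finite_subset[of _ "{..i' + l'}"]) (auto simp: A_def)
    define a where "a = Max (A \<inter> {..t})"
    define b where "b = Min (A \<inter> {Suc t..})"
    have a: "a \<in> A" "a \<le> t" "\<And>k. k \<in> A \<Longrightarrow> k \<le> t \<Longrightarrow> k \<le> a"
    proof -
      have "a \<in> A \<inter> {..t}" unfolding a_def by (rule Max_in) (use iA finA t in auto)
      then show "a \<in> A" "a \<le> t" by auto
      fix k assume "k \<in> A" "k \<le> t"
      then show "k \<le> a" unfolding a_def using finA by (intro Max_ge) auto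
    qed
    have b: "b \<in> A" "t < b" "\<And>k. k \<in> A \<Longrightarrow> t < k \<Longrightarrow> b \<le> k"
    proof -
      have "b \<in> A \<inter> {Suc t..}" unfolding b_def by (rule Min_in) (use iA finA t in auto)
      then show "b \<in> A" "t < b" by auto
      fix k assume "k \<in> A" "t < k"
      then show "b \<le> k" unfolding b_def using finA by (intro Min_le) auto
    qed
    define n where "n = b - a"
    define e where "e = take n (drop (a - i') g')"
    have bn: "b = a + n" using a b by (simp add: n_def)
    have ab: "i' \<le> a" "b \<le> i' + l'" using a b by (auto simp: A_def)
    have le: "length e = n" using ab bn lg by (simp add: e_def)
    have pe: "Q' a + pos e k = Q' (a + k)" if "k \<le> n" for k
      using pos_slice[OF that, of "a - i'" g'] ab by (simp add: Q'_def e_def add.assoc)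
    have es: "e \<in> steps D n"
      using le dt' by (auto simp: steps_def e_def dest!: in_set_takeD in_set_dropD)
    have ee: "edges a (Q' a) e \<subseteq> dedges S d'"
    proof
      fix w assume w: "w \<in> edges a (Q' a) e"
      obtain k u v where w3: "w = (k, u, v)" by (metis prod_cases3)
      have k: "a \<le> k" "k < a + n" "u = Q' a + pos e (k - a)" "v = Q' a + pos e (Suc k - a)"
        using w le by (auto simp: w3 edges_iff)
      have "u = Q' k" "v = Q' (Suc k)" using pe[of "k - a"] pe[of "Suc k - a"] k by auto
      then show "w \<in> dedges S d'"
        using k ab bn lg by (auto simp: w3 de' dedges_def edges_iff Q'_def)
    qed
    have "(n, a, Q' a, e) \<in> interf D K S d"
    proof -
      have "1 \<le> n" "n \<le> K" using a b ab bn dt' by linarith+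
      moreover have "a < i + l" "i < a + n" using a b t bn by linarith+
      moreover have "Q' a \<in> {pos S a, Q a}" "Q' b \<in> {pos S b, Q b}" using a b by (auto simp: A_def)
      moreover have "Q' a + sum_list e = Q' b" using pe[of n] le bn by simp
      \<comment> \<open>Edges of \<open>S\<close> are excluded since \<open>d'\<close> shares none
        with \<open>S\<close>. An edge of \<open>d\<close> at time \<open>k\<close> makes both
        \<open>k\<close> and \<open>Suc k\<close> visits; as \<open>a\<close> is the last visit up
        to \<open>t\<close> and \<open>b\<close> the first one after it, \<open>k = t\<close>, where
        the two detours differ.\<close>
      moreover have "edges a (Q' a) e \<inter> (edges 0 0 S \<union> dedges S d) = {}"
      proof (rule ccontr)
        assume "\<not> ?thesis"
        then obtain k u v where w: "(k, u, v) \<in> edges a (Q' a) e"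
          and w': "(k, u, v) \<in> edges 0 0 S \<or> (k, u, v) \<in> dedges S d" by auto
        have k: "a \<le> k" "k < a + n" "u = Q' a + pos e (k - a)" "v = Q' a + pos e (Suc k - a)"
          using w le by (auto simp: edges_iff)
        have uv: "u = Q' k" "v = Q' (Suc k)" using pe[of "k - a"] pe[of "Suc k - a"] k by auto
        have "(k, u, v) \<notin> edges 0 0 S"
          using detour_edges_disjoint[OF d'(1)] ee w by auto
        with w' have kg: "(k, u, v) \<in> dedges S d" by auto
        then have k2: "i \<le> k" "k < i + l" "u = Q k" "v = Q (Suc k)"
          using Q[of k] Q[of "Suc k"] lg by (auto simp: dedges_def de edges_iff)
        have kA: "k \<in> A" "Suc k \<in> A"
          using k2 uv k ab bn by (auto simp: A_def)
        have "k \<le> t" using b(3)[OF kA(1)] k bn by linarith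
        moreover have "t < Suc k" using a(3)[OF kA(2)] k by linarith
        ultimately have "k = t" by simp
        then show False using neq k2 uv by auto
      qed
      ultimately show ?thesis
        using es by (simp add: interf_def de bn Q_def)
    qed
    moreover have "edges a (Q' a) e \<subseteq> Collect \<omega>" using ee d'(2) by auto
    ultimately show False using d(2) by (auto simp: good_def)
  qed
  \<comment> \<open>The later start lies strictly inside the other detour, which is off
    \<open>S\<close> there; but the two detours agree at this time and the later one starts on
    \<open>S\<close>. The ends are compared in the same way, through the last edge.\<close>
  have ii: "i = i'"
  proof (rule ccontr)
    assume "i \<noteq> i'"
    then consider "i < i'" | "i' < i" by linarith
    then show False
    proof cases
      case 1 then show False using eq[of i'] int[of i'] Qi' ov dt dt' by auto
    next
      case 2 then show False using eq[of i] int'[of i] Qi ov dt dt' by auto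
    qed
  qed
  have ll: "l = l'"
  proof (rule ccontr)
    assume "l \<noteq> l'"
    then consider "l < l'" | "l' < l" by linarith
    then show False
    proof cases
      case 1
      have "i \<le> i + l - 1" "i + l - 1 < i + l" "Suc (i + l - 1) = i + l" using dt by linarith+
      then show False
        using 1 eq[of "i + l - 1"] int'[of "i + l"] Qi ii dt by auto
    next
      case 2
      have "i \<le> i + l' - 1" "i + l' - 1 < i + l'" "Suc (i + l' - 1) = i + l'" using dt' by linarith+
      then show False
        using 2 eq[of "i + l' - 1"] int[of "i + l'"] Qi' ii dt' by auto
    qed
  qed
  have "g = g'"
  proof (rule list_eq_pos)
    fix k assume k: "k \<le> length g"
    have "Q (i + k) = Q' (i + k)"
    proof (cases "k = 0")
      case False
      then have "i \<le> i + k - 1" "i + k - 1 < i + l" "Suc (i + k - 1) = i + k" using k lg by linarith+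
      then show ?thesis using eq[of "i + k - 1"] ii ll k lg by auto
    qed (use eq[of i] ii ll dt in auto)
    then show "pos g k = pos g' k" using Q[of "i + k"] k lg ii by (simp add: Q'_def)
  qed (use lg ll in auto)
  with ii ll show ?thesis by (simp add: de de')
qed

text \<open>Induction on the time \<open>m\<close>, counting open paths to \<open>pos S m\<close>.
  If a good detour ends at \<open>m\<close>, then by \<open>good_no_overlap\<close> it is the only
  one, and all others completed by then end no later than it starts. The induction restarts from its
  starting point, with a factor 2 for the choice between the detour and \<open>S\<close>.\<close>

lemma two_power_good_le_cnt:
  assumes D: "finite D" and S: "S \<in> steps D T" "edges 0 0 S \<subseteq> Collect \<omega>" and fin: "finite G"
    and G: "\<And>d. d \<in> G \<Longrightarrow> detour D K S d" "\<And>d. d \<in> G \<Longrightarrow> good D K S \<omega> d"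
  shows "2 ^ card G \<le> cnt D \<omega> 0 0 T (sum_list S)"
proof -
  define E where "E m = {d \<in> G. fst d + fst (snd d) \<le> m}" for m
  have lS: "length S = T" using S by (simp add: length_steps)
  have sl: "edges a (pos S a) (take n (drop a S)) \<subseteq> Collect \<omega>" if "a + n \<le> T" for a n
  proof -
    have "S = take a S @ take n (drop a S) @ drop (a + n) S"
      using append_take_drop_id[of n "drop a S"] by (simp add: add.commute)
    then have "edges 0 0 S = edges 0 0 (take a S @ take n (drop a S) @ drop (a + n) S)" by simp
    also have "\<dots> \<supseteq> edges a (pos S a) (take n (drop a S))"
      using that lS by (simp add: edges_append min_absorb2 le_supI1 le_supI2)
    finally show ?thesis using S(2) by simp
  qed
  have sls: "take n (drop a S) \<in> steps D n" if "a + n \<le> T" for a n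
    using that S by (auto simp: steps_def dest!: in_set_takeD in_set_dropD)
  have slp: "pos S a + sum_list (take n (drop a S)) = pos S (a + n)" for a n
    using pos_slice[of n n a S] by simp
  have "2 ^ card (E m) \<le> cnt D \<omega> 0 0 m (pos S m)" if "m \<le> T" for m
    using that
  proof (induction m rule: less_induct)
    case (less m)
    have l2: "2 \<le> fst (snd d)" if "d \<in> G" for d
      using G(1)[OF that] by (auto simp: detour_def)
    show ?case
    proof (cases "\<exists>d\<in>G. fst d + fst (snd d) = m")
      case True
      then obtain i l g where d: "(i, l, g) \<in> G" "i + l = m" by auto
      note dt = G(1)[OF d(1), unfolded detour_def, simplified]
      have "E m = insert (i, l, g) (E i)"
      proof (intro equalityI subsetI)
        fix d' assume d': "d' \<in> E m"
        show "d' \<in> insert (i, l, g) (E i)"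
        proof (rule ccontr)
          assume n: "d' \<notin> insert (i, l, g) (E i)"
          then have "fst d' < i + l" "i < fst d' + fst (snd d')"
            using d' d l2[of d'] by (auto simp: E_def)
          then have "(i, l, g) = d'"
            using good_no_overlap[of D K S "(i, l, g)" \<omega> d'] G d' d by (auto simp: E_def good_def)
          with n show False by simp
        qed
      qed (use d in \<open>auto simp: E_def\<close>)
      moreover have "(i, l, g) \<notin> E i" using dt by (auto simp: E_def)
      moreover have "finite (E i)" using fin by (simp add: E_def)
      ultimately have "2 ^ card (E m) = 2 * 2 ^ card (E i)" by simp
      also have "\<dots> \<le> 2 * cnt D \<omega> 0 0 i (pos S i)"
        using less.IH[of i] less.prems d dt by simp
      also have "2 \<le> cnt D \<omega> i (pos S i) l (pos S m)"
      proof (rule cnt_ge_2[OF D, of "take l (drop i S)" _ _ _ _ _ g])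
        show "take l (drop i S) \<noteq> g"
        proof
          assume "take l (drop i S) = g"
          then have "pos S i + pos g 1 = pos S (i + 1)"
            using pos_slice[of 1 l i S] dt by simp
          then show False using dt by auto
        qed
        show "edges i (pos S i) g \<subseteq> Collect \<omega>"
          using G(2)[OF d(1)] by (simp add: good_def dedges_def)
      qed (use sl sls slp d dt less.prems in auto)
      then have "2 * cnt D \<omega> 0 0 i (pos S i) \<le> cnt D \<omega> 0 0 i (pos S i) * cnt D \<omega> i (pos S i) l (pos S m)"
        by (simp add: mult.commute)
      also have "\<dots> \<le> cnt D \<omega> 0 0 m (pos S m)"
        using cnt_append_le[OF D, of \<omega> 0 0 i "pos S i" l "pos S m"] d by simp
      finally show ?thesis .
    next
      case False
      show ?thesis
      proof (cases m)
        case 0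
        have "E 0 = {}" using l2 by (fastforce simp: E_def)
        moreover have "cnt D \<omega> 0 0 0 0 \<ge> 1" by (rule cnt_pos[OF D, of "[]"]) auto
        ultimately show ?thesis using 0 by simp
      next
        case (Suc m')
        have "E m = E m'" using False Suc by (auto simp: E_def le_Suc_eq)
        then have "2 ^ card (E m) \<le> cnt D \<omega> 0 0 m' (pos S m') * 1"
          using less.IH[of m'] less.prems Suc by simp
        also have "1 \<le> cnt D \<omega> m' (pos S m') 1 (pos S m)"
          by (rule cnt_pos[OF D, of "take 1 (drop m' S)"])
             (use sl[of m' 1] sls[of m' 1] slp[of m' 1] less.prems Suc in auto)
        then have "cnt D \<omega> 0 0 m' (pos S m') * 1
            \<le> cnt D \<omega> 0 0 m' (pos S m') * cnt D \<omega> m' (pos S m') 1 (pos S m)"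
          by (rule mult_left_mono) simp
        also have "\<dots> \<le> cnt D \<omega> 0 0 m (pos S m)"
          using cnt_append_le[OF D, of \<omega> 0 0 m' "pos S m'" 1 "pos S m"] Suc by simp
        finally show ?thesis .
      qed
    qed
  qed
  from this[of T] have "2 ^ card (E T) \<le> cnt D \<omega> 0 0 T (sum_list S)" by (simp add: lS)
  moreover have "E T = G" using G(1) lS by (fastforce simp: E_def detour_def)
  ultimately show ?thesis by simp
qed

section \<open>The percolation measure\<close>

text \<open>Coordinates of a product measure are independent. To apply this to functions on the
  whole space, missing coordinates are filled from a fixed point \<open>\<omega>0\<close>, which
  makes \<open>X\<close> and \<open>Y\<close> functions of the restrictions to \<open>J\<close> and
  \<open>J'\<close>.\<close>

lemma integral_mult_PiM_disjoint:
  fixes X Y :: "('i \<Rightarrow> 'b) \<Rightarrow> real"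
  assumes M: "\<And>i. i \<in> I \<Longrightarrow> prob_space (M i)"
    and J: "J \<subseteq> I" "J' \<subseteq> I" "J \<inter> J' = {}"
    and X: "integrable (PiM I M) X" "\<And>\<omega> \<omega>'. \<omega> \<in> space (PiM I M) \<Longrightarrow> \<omega>' \<in> space (PiM I M) \<Longrightarrow>
      (\<And>i. i \<in> J \<Longrightarrow> \<omega> i = \<omega>' i) \<Longrightarrow> X \<omega> = X \<omega>'"
    and Y: "integrable (PiM I M) Y" "\<And>\<omega> \<omega>'. \<omega> \<in> space (PiM I M) \<Longrightarrow> \<omega>' \<in> space (PiM I M) \<Longrightarrow>
      (\<And>i. i \<in> J' \<Longrightarrow> \<omega> i = \<omega>' i) \<Longrightarrow> Y \<omega> = Y \<omega>'"
  shows "(\<integral>\<omega>. X \<omega> * Y \<omega> \<partial>PiM I M) = (\<integral>\<omega>. X \<omega> \<partial>PiM I M) * (\<integral>\<omega>. Y \<omega> \<partial>PiM I M)"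
    and "integrable (PiM I M) (\<lambda>\<omega>. X \<omega> * Y \<omega>)"
proof -
  let ?P = "PiM I M"
  interpret P: prob_space ?P by (rule prob_space_PiM) (rule M)
  obtain \<omega>0 where \<omega>0: "\<omega>0 \<in> space ?P" using P.not_empty by blast
  define m where "m L \<eta> = (\<lambda>i\<in>I. if i \<in> L then \<eta> i else \<omega>0 i)" for L :: "'i set" and \<eta> :: "'i \<Rightarrow> 'b"
  have m: "m L \<in> measurable (PiM L M) ?P" if "L \<subseteq> I" for L
    unfolding m_def
  proof (rule measurable_restrict)
    fix i assume i: "i \<in> I"
    show "(\<lambda>\<eta>. if i \<in> L then \<eta> i else \<omega>0 i) \<in> measurable (PiM L M) (M i)"
      using i PiE_mem[OF \<omega>0[unfolded space_PiM] i] by (cases "i \<in> L") auto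
  qed
  have mr: "m L (restrict \<omega> L) \<in> space ?P" if "\<omega> \<in> space ?P" for L \<omega>
    using that \<omega>0 by (auto simp: m_def space_PiM PiE_def Pi_def)
  have Xm: "X (m J (restrict \<omega> J)) = X \<omega>" if "\<omega> \<in> space ?P" for \<omega>
    by (rule X(2)) (use mr that J in \<open>auto simp: m_def\<close>)
  have Ym: "Y (m J' (restrict \<omega> J')) = Y \<omega>" if "\<omega> \<in> space ?P" for \<omega>
    by (rule Y(2)) (use mr that J in \<open>auto simp: m_def\<close>)
  have int: "integrable ?P (\<lambda>\<omega>. X (m J (restrict \<omega> J)))" "integrable ?P (\<lambda>\<omega>. Y (m J' (restrict \<omega> J')))"
    using X(1) Y(1) Xm Ym by (simp_all cong: Bochner_Integration.integrable_cong)
  have "P.indep_var borel ((X \<circ> m J) \<circ> (\<lambda>\<omega>. restrict \<omega> J)) borel ((Y \<circ> m J') \<circ> (\<lambda>\<omega>. restrict \<omega> J'))"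
  proof (cases "I = {}")
    case False
    have "P.indep_vars M (\<lambda>i \<omega>. \<omega> i) I"
    proof (subst P.indep_vars_iff_distr_eq_PiM'[OF False])
      have "distr ?P ?P (\<lambda>x. \<lambda>i\<in>I. x i) = distr ?P ?P (\<lambda>x. x)"
        by (rule distr_cong) (auto simp: space_PiM extensional_restrict PiE_def)
      moreover have "PiM I (\<lambda>i. distr ?P (M i) (\<lambda>x. x i)) = ?P"
        by (rule PiM_cong) (auto intro!: distr_PiM_component[of I M, OF M])
      ultimately show "distr ?P ?P (\<lambda>x. \<lambda>i\<in>I. x i) = PiM I (\<lambda>i. distr ?P (M i) (\<lambda>x. x i))"
        by simp
    qed auto
    then have "P.indep_var (PiM J M) (\<lambda>\<omega>. restrict (\<lambda>i. \<omega> i) J) (PiM J' M) (\<lambda>\<omega>. restrict (\<lambda>i. \<omega> i) J')"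
      by (rule P.indep_var_restrict) (use J in auto)
    then show ?thesis
      by (rule P.indep_var_compose)
         (use m J X(1) Y(1) in \<open>auto intro!: measurable_comp[OF m]\<close>)
  next
    case True
    then have J: "J = {}" "J' = {}" using J by auto
    have "P.indep_var (PiM J M) (\<lambda>\<omega>. restrict \<omega> J) (PiM J' M) (\<lambda>\<omega>. restrict \<omega> J')"
    proof -
      have "P.indep_vars M (\<lambda>i \<omega>. \<omega> i) {}" by (simp add: P.indep_vars_def P.indep_sets_def)
      then have "P.indep_var (PiM J M) (\<lambda>\<omega>. restrict (\<lambda>i. \<omega> i) J) (PiM J' M) (\<lambda>\<omega>. restrict (\<lambda>i. \<omega> i) J')"
        by (rule P.indep_var_restrict) (use J in auto)
      then show ?thesis by simp
    qed
    then show ?thesis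
      by (rule P.indep_var_compose)
         (use m[of J] m[of J'] J X(1) Y(1) in \<open>auto intro!: measurable_comp[OF m]\<close>)
  qed
  then have iv: "P.indep_var borel (\<lambda>\<omega>. X (m J (restrict \<omega> J))) borel (\<lambda>\<omega>. Y (m J' (restrict \<omega> J')))"
    by (simp add: comp_def)
  have "(\<integral>\<omega>. X (m J (restrict \<omega> J)) * Y (m J' (restrict \<omega> J')) \<partial>?P)
      = (\<integral>\<omega>. X (m J (restrict \<omega> J)) \<partial>?P) * (\<integral>\<omega>. Y (m J' (restrict \<omega> J')) \<partial>?P)"
    by (rule P.indep_var_lebesgue_integral[OF iv int])
  then show "(\<integral>\<omega>. X \<omega> * Y \<omega> \<partial>?P) = (\<integral>\<omega>. X \<omega> \<partial>?P) * (\<integral>\<omega>. Y \<omega> \<partial>?P)"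
    by (simp add: Xm Ym cong: Bochner_Integration.integral_cong)
  have "integrable ?P (\<lambda>\<omega>. X (m J (restrict \<omega> J)) * Y (m J' (restrict \<omega> J')))"
    by (rule P.indep_var_integrable[OF iv int])
  then show "integrable ?P (\<lambda>\<omega>. X \<omega> * Y \<omega>)"
    by (simp add: Xm Ym cong: Bochner_Integration.integrable_cong)
qed

locale perc = kernel f for f :: "'a::ab_group_add \<Rightarrow> real" +
  fixes V :: "'a set" and p :: real
  assumes countable_V: "countable V"
    and supp_subset: "{z. f z \<noteq> 0} \<subseteq> V"
    and zero_V: "0 \<in> V"
    and add_V: "x \<in> V \<Longrightarrow> y \<in> V \<Longrightarrow> x + y \<in> V"
    and p_pos: "0 < p"
    and p_le: "p * f z \<le> 1"
begin

definition I :: "(nat \<times> 'a \<times> 'a) set" where "I = UNIV \<times> V \<times> V"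

definition Me :: "nat \<times> 'a \<times> 'a \<Rightarrow> bool measure" where
  "Me = (\<lambda>(n, x, y). measure_pmf (bernoulli_pmf (p * f (y - x))))"

definition P :: "'a config measure" where "P = PiM I Me"

lemma perc_measure_eq: "perc_measure V f p = completion P"
  by (simp add: perc_measure_def P_def I_def Me_def)

lemma prob_space_Me: "prob_space (Me e)"
  by (cases e) (simp add: Me_def measure_pmf.prob_space_axioms)

lemma sets_Me [measurable_cong]: "sets (Me e) = sets (count_space UNIV)"
  by (cases e) (simp add: Me_def)

lemma space_Me: "space (Me e) = UNIV"
  by (cases e) (simp add: Me_def)

sublocale P: prob_space P
  unfolding P_def by (rule prob_space_PiM) (rule prob_space_Me)

lemma space_P: "space P = PiE I (\<lambda>_. UNIV)"
  by (simp add: P_def space_PiM space_Me)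

lemma D_subset: "D \<subseteq> V"
  using supp_subset by (simp add: D_def)

lemma sum_list_V: "set s \<subseteq> V \<Longrightarrow> sum_list s \<in> V"
  by (induction s) (auto simp: zero_V add_V)

lemma steps_V: "s \<in> steps D n \<Longrightarrow> set s \<subseteq> V"
  using D_subset by (auto simp: steps_def)

lemma edges_I: "x \<in> V \<Longrightarrow> set s \<subseteq> V \<Longrightarrow> edges n x s \<subseteq> I"
  by (induction s arbitrary: n x) (auto simp: I_def add_V)

lemma edges_I': "x \<in> V \<Longrightarrow> s \<in> steps D N \<Longrightarrow> edges n x s \<subseteq> I"
  using edges_I steps_V by blast

lemma measurable_open:
  assumes "finite E" "E \<subseteq> I"
  shows "{\<omega> \<in> space P. E \<subseteq> Collect \<omega>} \<in> sets P"
proof -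
  have "{\<omega> \<in> space P. \<omega> e} \<in> sets P" if "e \<in> I" for e
  proof -
    have "(\<lambda>\<omega>. \<omega> e) \<in> measurable P (Me e)"
      unfolding P_def using that by (rule measurable_component_singleton)
    then have "(\<lambda>\<omega>. \<omega> e) -` {True} \<inter> space P \<in> sets P"
      by (rule measurable_sets) (simp add: sets_Me)
    then show ?thesis by (simp add: vimage_def Int_def conj_commute)
  qed
  then have "{\<omega> \<in> space P. \<forall>e\<in>E. \<omega> e} \<in> sets P"
    using assms by (intro sets.sets_Collect_finite_All) auto
  moreover have "{\<omega> \<in> space P. \<forall>e\<in>E. \<omega> e} = {\<omega> \<in> space P. E \<subseteq> Collect \<omega>}" by auto
  ultimately show ?thesis by simp
qed

definition opn :: "(nat \<times> 'a \<times> 'a) set \<Rightarrow> 'a config \<Rightarrow> real" where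
  "opn E \<omega> = of_bool (E \<subseteq> Collect \<omega>)"

lemma opn_Un: "opn (E \<union> F) \<omega> = opn E \<omega> * opn F \<omega>"
  by (auto simp: opn_def)

lemma opn_nonneg: "opn E \<omega> \<ge> 0"
  by (simp add: opn_def)

lemma integrable_opn:
  assumes "finite E" "E \<subseteq> I"
  shows "integrable P (opn E)"
proof -
  have "integrable P (indicat_real {\<omega> \<in> space P. E \<subseteq> Collect \<omega>})"
    using measurable_open[OF assms] by (simp add: P.emeasure_eq_measure)
  then show ?thesis
    by (rule Bochner_Integration.integrable_cong[THEN iffD1, rotated -1]) (auto simp: opn_def)
qed

definition q :: "nat \<times> 'a \<times> 'a \<Rightarrow> real" where "q = (\<lambda>(n, x, y). p * f (y - x))"

lemma integral_opn:
  assumes "finite E" "E \<subseteq> I"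
  shows "(\<integral>\<omega>. opn E \<omega> \<partial>P) = prod q E"
proof -
  have me: "emeasure (Me e) {True} = ennreal (q e)" for e
    using p_le p_pos nonneg
    by (cases e) (auto simp: Me_def q_def emeasure_pmf_single)
  have "restrict \<omega> E \<in> PiE E (\<lambda>_. {True}) \<longleftrightarrow> E \<subseteq> Collect \<omega>" for \<omega> :: "'a config"
    by (subst restrict_PiE_iff) auto
  moreover have "prod_emb I Me E X = {\<omega> \<in> PiE I (\<lambda>_. UNIV). restrict \<omega> E \<in> X}" for X
    by (auto simp: prod_emb_def space_Me)
  ultimately have "{\<omega> \<in> space P. E \<subseteq> Collect \<omega>} = prod_emb I Me E (PiE E (\<lambda>_. {True}))"
    by (simp only: space_P)
  then have "emeasure P {\<omega> \<in> space P. E \<subseteq> Collect \<omega>} = (\<Prod>e\<in>E. emeasure (Me e) {True})"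
    unfolding P_def using assms
    by (simp only:) (rule emeasure_PiM_emb, auto simp: prob_space_Me sets_Me)
  also have "\<dots> = ennreal (prod q E)"
    unfolding me using p_pos nonneg by (intro prod_ennreal) (auto simp: q_def)
  finally have "measure P {\<omega> \<in> space P. E \<subseteq> Collect \<omega>} = prod q E"
    using p_pos nonneg by (intro measure_eq_emeasure_eq_ennreal) (auto intro!: prod_nonneg simp: q_def)
  moreover have "(\<integral>\<omega>. opn E \<omega> \<partial>P) = (\<integral>\<omega>. indicator {\<omega> \<in> space P. E \<subseteq> Collect \<omega>} \<omega> \<partial>P)"
    by (intro Bochner_Integration.integral_cong) (auto simp: opn_def)
  moreover have "{\<omega> \<in> space P. E \<subseteq> Collect \<omega>} \<inter> space P = {\<omega> \<in> space P. E \<subseteq> Collect \<omega>}" by auto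
  ultimately show ?thesis by simp
qed

text \<open>Time increases along a path, so no edge occurs twice.\<close>

lemma prod_q_edges: "prod q (edges n x s) = p ^ length s * wt f s"
proof (induction s arbitrary: n x)
  case (Cons z s)
  have "(n, x, x + z) \<notin> edges (Suc n) (x + z) s"
    by (simp add: edges_iff)
  then show ?case by (simp add: Cons.IH) (simp add: q_def)
qed simp

lemma cnt_eq_sum_opn:
  "real (cnt D \<omega> n x N y) = (\<Sum>s\<in>{s \<in> steps D N. x + sum_list s = y}. opn (edges n x s) \<omega>)"
proof -
  have "{s \<in> steps D N. x + sum_list s = y \<and> edges n x s \<subseteq> Collect \<omega>} =
      {s \<in> steps D N. x + sum_list s = y} \<inter> {s. edges n x s \<subseteq> Collect \<omega>}" by auto
  then show ?thesis
    by (simp add: cnt_def opn_def Int_def)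
qed

lemma tot_eq_sum_opn: "real (tot D \<omega> n x N) = (\<Sum>s\<in>steps D N. opn (edges n x s) \<omega>)"
  by (simp add: tot_def opn_def Int_def)

lemma borel_measurable_cnt:
  "x \<in> V \<Longrightarrow> (\<lambda>\<omega>. real (cnt D \<omega> n x N y)) \<in> borel_measurable P"
  unfolding cnt_eq_sum_opn
  by (intro borel_measurable_sum borel_measurable_integrable integrable_opn finite_edges edges_I'[of x _ N]) auto

lemma borel_measurable_tot:
  "x \<in> V \<Longrightarrow> (\<lambda>\<omega>. real (tot D \<omega> n x N)) \<in> borel_measurable P"
  unfolding tot_eq_sum_opn
  by (intro borel_measurable_sum borel_measurable_integrable integrable_opn finite_edges edges_I'[of x _ N]) auto

text \<open>The restriction to \<open>I\<close> keeps the shifted configuration extensional, hence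
  inside \<open>space P\<close>.\<close>

definition shift :: "nat \<Rightarrow> 'a \<Rightarrow> 'a config \<Rightarrow> 'a config" where
  "shift n x \<omega> = (\<lambda>(k, u, v)\<in>I. \<omega> (n + k, x + u, x + v))"

lemma distr_shift:
  assumes "x \<in> V"
  shows "distr P P (shift n x) = P"
proof -
  define g where "g = (\<lambda>(k, u, v). (n + k, x + u, x + v :: 'a))"
  have g: "inj_on g I" "g \<in> I \<rightarrow> I"
    using assms by (auto simp: g_def inj_on_def I_def add_V)
  have "distr (PiM I Me) (PiM I (\<lambda>i. Me (g i))) (\<lambda>\<omega>. \<lambda>i\<in>I. \<omega> (g i)) = PiM I (\<lambda>i. Me (g i))"
    by (rule distr_PiM_reindex) (use g prob_space_Me in auto)
  moreover have "(\<lambda>i. Me (g i)) = Me"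
    by (auto simp: Me_def g_def fun_eq_iff)
  moreover have "(\<lambda>\<omega>. \<lambda>i\<in>I. \<omega> (g i)) = shift n x"
    by (auto simp: shift_def g_def fun_eq_iff restrict_def split: prod.splits)
  ultimately show ?thesis by (simp add: P_def)
qed

lemma measurable_shift [measurable]:
  assumes "x \<in> V"
  shows "shift n x \<in> measurable P P"
  unfolding P_def shift_def case_prod_unfold
proof (rule measurable_restrict)
  fix i assume "i \<in> I"
  then have "(n + fst i, x + fst (snd i), x + snd (snd i)) \<in> I" "Me (n + fst i, x + fst (snd i), x + snd (snd i)) = Me i"
    using assms by (auto simp: I_def add_V Me_def)
  then show "(\<lambda>\<omega>. \<omega> (n + fst i, x + fst (snd i), x + snd (snd i))) \<in> measurable (PiM I Me) (Me i)"
    by (metis measurable_component_singleton)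
qed

lemma integral_shift:
  fixes F :: "'a config \<Rightarrow> real"
  assumes "x \<in> V" "F \<in> borel_measurable P"
  shows "(\<integral>\<omega>. F (shift n x \<omega>) \<partial>P) = (\<integral>\<omega>. F \<omega> \<partial>P)"
  using integral_distr[OF measurable_shift[OF assms(1)] assms(2), of n] distr_shift[OF assms(1), of n]
  by simp

lemma edges_shift: "edges (n + k) (x + u) s = (\<lambda>(k, u, v). (n + k, x + u, x + v)) ` edges k u s"
  by (induction s arbitrary: k u) (auto simp: add.assoc simp flip: add_Suc_right)

lemma edges_shift_open:
  assumes "u \<in> V" "s \<in> steps D N"
  shows "edges k u s \<subseteq> Collect (shift n x \<omega>) \<longleftrightarrow> edges (n + k) (x + u) s \<subseteq> Collect \<omega>"
proof -
  have "shift n x \<omega> e = \<omega> ((\<lambda>(k, u, v). (n + k, x + u, x + v)) e)" if "e \<in> edges k u s" for e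
    using edges_I'[OF assms, of k] that by (auto simp: shift_def)
  then show ?thesis
    unfolding edges_shift image_subset_iff by (auto simp: subset_eq)
qed

lemma cnt_shift: "x \<in> V \<Longrightarrow> cnt D \<omega> n x N y = cnt D (shift n x \<omega>) 0 0 N (y - x)"
  unfolding cnt_def using edges_shift_open[OF zero_V, of _ N 0 n x \<omega>]
  by (intro arg_cong[where f = card]) (auto simp: algebra_simps)

lemma tot_shift: "x \<in> V \<Longrightarrow> tot D \<omega> n x N = tot D (shift n x \<omega>) 0 0 N"
  unfolding tot_def using edges_shift_open[OF zero_V, of _ N 0 n x \<omega>]
  by (intro arg_cong[where f = card]) auto

lemma cnt_cong:
  assumes "\<And>e. n \<le> fst e \<Longrightarrow> fst e < n + N \<Longrightarrow> e \<in> I \<Longrightarrow> \<omega> e = \<omega>' e" "x \<in> V"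
  shows "cnt D \<omega> n x N y = cnt D \<omega>' n x N y"
proof -
  have "edges n x s \<subseteq> Collect \<omega> \<longleftrightarrow> edges n x s \<subseteq> Collect \<omega>'" if s: "s \<in> steps D N" for s
  proof -
    have "\<omega> e = \<omega>' e" if "e \<in> edges n x s" for e
      using that edges_I'[OF assms(2) s, of n] length_steps[OF s]
      by (intro assms(1)) (auto simp: edges_iff prod_eq_iff, (cases e, auto simp: edges_iff)+)
    then show ?thesis by auto
  qed
  then show ?thesis unfolding cnt_def by (intro arg_cong[where f = card]) auto
qed

end

section \<open>The growth rate is almost surely constant\<close>

context perc begin

text \<open>On this event of full measure the paths of the model, which may a priori jump between
  any two points of \<open>V\<close>, correspond exactly to step lists over
  \<open>D\<close>.\<close>

definition admissible :: "'a config \<Rightarrow> bool" where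
  "admissible \<omega> \<longleftrightarrow> (\<forall>n x y. x \<in> V \<and> y \<in> V \<and> \<omega> (n, x, y) \<longrightarrow> y - x \<in> D)"

lemma AE_admissible: "AE \<omega> in P. admissible \<omega>"
proof -
  have "AE \<omega> in P. \<omega> e \<longrightarrow> q e \<noteq> 0" if e: "e \<in> I" for e
  proof (cases "q e = 0")
    case True
    have Me0: "Me e = measure_pmf (bernoulli_pmf 0)"
      using True p_pos by (cases e) (auto simp: Me_def q_def)
    have "AE b in Me e. \<not> b"
    proof -
      have "True \<notin> set_pmf (bernoulli_pmf 0)" by (simp add: set_pmf_iff)
      then show ?thesis unfolding Me0 AE_measure_pmf_iff by (metis (full_types))
    qed
    then have "AE \<omega> in PiM I Me. \<not> \<omega> e"
      by (rule AE_PiM_component[OF prob_space_Me e])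
    then have "AE \<omega> in P. \<not> \<omega> e" by (simp only: P_def)
    then show ?thesis by eventually_elim auto
  qed simp
  moreover have "countable I"
    using countable_V by (simp add: I_def)
  ultimately have "AE \<omega> in P. \<forall>e\<in>I. \<omega> e \<longrightarrow> q e \<noteq> 0"
    by (simp add: AE_ball_countable)
  then show ?thesis
    by (rule AE_mp) (rule AE_I2, auto simp: admissible_def I_def q_def D_def)
qed

lemma bij_betw_paths:
  assumes "admissible \<omega>"
  shows "bij_betw (\<lambda>S. map (\<lambda>k. S (Suc k) - S k) [0..<N])
    {S \<in> {..N} \<rightarrow>\<^sub>E V. S 0 = 0 \<and> open_path \<omega> {..N} S}
    {s \<in> steps D N. edges 0 0 s \<subseteq> Collect \<omega>}" (is "bij_betw ?h ?A ?B")
proof -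
  have pos_h: "pos (?h S) k = S k" if "S 0 = 0" "k \<le> N" for S :: "nat \<Rightarrow> 'a" and k
    using that(2)
  proof (induction k)
    case (Suc k)
    then show ?case by (subst pos_Suc) auto
  qed (use that in simp)
  show ?thesis
  proof (rule bij_betw_byWitness[where f' = "\<lambda>s. \<lambda>k\<in>{..N}. pos s k"])
    show "\<forall>S\<in>?A. (\<lambda>k\<in>{..N}. pos (?h S) k) = S"
      using pos_h by (fastforce simp: fun_eq_iff PiE_def extensional_def)
    show "\<forall>s\<in>?B. ?h (\<lambda>k\<in>{..N}. pos s k) = s"
      by (auto intro!: nth_equalityI simp: length_steps pos_Suc)
    show "?h ` ?A \<subseteq> ?B"
    proof
      fix s assume "s \<in> ?h ` ?A"
      then obtain S where S: "S \<in> ?A" and s: "s = ?h S" by auto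
      have op: "\<omega> (k, S k, S (Suc k))" if "k < N" for k
        using S that by (auto simp: open_path_def)
      have SV: "S k \<in> V" if "k \<le> N" for k
        using S that by (auto simp: PiE_def Pi_def)
      have "s \<in> steps D N"
      proof -
        have "S (Suc k) - S k \<in> D" if "k < N" for k
          using assms op[OF that] SV[of k] SV[of "Suc k"] that by (auto simp: admissible_def)
        then show ?thesis by (auto simp: s steps_def)
      qed
      moreover have "edges 0 0 s \<subseteq> Collect \<omega>"
        using op S pos_h by (auto simp: edges_iff s simp del: take_Suc)
      ultimately show "s \<in> ?B" by simp
    qed
    show "(\<lambda>s. \<lambda>k\<in>{..N}. pos s k) ` ?B \<subseteq> ?A"
    proof
      fix S assume "S \<in> (\<lambda>s. \<lambda>k\<in>{..N}. pos s k) ` ?B"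
      then obtain s where s: "s \<in> steps D N" "edges 0 0 s \<subseteq> Collect \<omega>" and S: "S = (\<lambda>k\<in>{..N}. pos s k)"
        by auto
      have "pos s k \<in> V" for k
        using steps_V[OF s(1)] by (intro sum_list_V) (auto dest: in_set_takeD)
      moreover have "\<omega> (k, pos s k, pos s (Suc k))" if "k < N" for k
        using s that by (auto simp: edges_iff length_steps subset_iff)
      ultimately show "S \<in> ?A" by (auto simp: S open_path_def Suc_le_eq)
    qed
  qed
qed

lemma num_paths_eq: "admissible \<omega> \<Longrightarrow> num_paths V \<omega> N = tot D \<omega> 0 0 N"
  unfolding num_paths_def tot_def by (rule bij_betw_same_card[OF bij_betw_paths])

lemma percolates_tot_pos:
  assumes "admissible \<omega>" "percolates V \<omega>"
  shows "tot D \<omega> 0 0 N \<ge> 1"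
proof -
  obtain S where S: "S \<in> UNIV \<rightarrow> V" "S 0 = 0" "open_path \<omega> UNIV S"
    using assms(2) by (auto simp: percolates_def)
  then have "restrict S {..N} \<in> {S \<in> {..N} \<rightarrow>\<^sub>E V. S 0 = 0 \<and> open_path \<omega> {..N} S}"
    by (auto simp: open_path_def Suc_le_eq)
  then have "{s \<in> steps D N. edges 0 0 s \<subseteq> Collect \<omega>} \<noteq> {}"
    using bij_betw_imp_surj_on[OF bij_betw_paths[OF assms(1), of N]] by blast
  then show ?thesis by (simp add: tot_def Suc_le_eq card_gt_0_iff)
qed

definition growth :: "'a config \<Rightarrow> ereal" where
  "growth \<omega> = limsup (\<lambda>N. log_ext (tot D \<omega> 0 0 N) / ereal (real N))"

lemma path_growth_eq: "admissible \<omega> \<Longrightarrow> path_growth V \<omega> = growth \<omega>"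
  by (simp add: path_growth_def growth_def num_paths_eq)

lemma measurable_tot: "x \<in> V \<Longrightarrow> (\<lambda>\<omega>. tot D \<omega> n x N) \<in> measurable P (count_space UNIV)"
proof -
  assume x: "x \<in> V"
  have "(\<lambda>\<omega>. nat \<lfloor>real (tot D \<omega> n x N)\<rfloor>) \<in> measurable P (count_space UNIV)"
    using borel_measurable_tot[OF x, of n N] by measurable
  then show ?thesis by simp
qed

lemma measurable_cnt: "x \<in> V \<Longrightarrow> (\<lambda>\<omega>. cnt D \<omega> n x N y) \<in> measurable P (count_space UNIV)"
proof -
  assume x: "x \<in> V"
  have "(\<lambda>\<omega>. nat \<lfloor>real (cnt D \<omega> n x N y)\<rfloor>) \<in> measurable P (count_space UNIV)"
    using borel_measurable_cnt[OF x, of n N y] by measurable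
  then show ?thesis by simp
qed

lemma measurable_growth [measurable]: "growth \<in> borel_measurable P"
proof -
  have "(\<lambda>\<omega>. log_ext (tot D \<omega> 0 0 N) / ereal (real N)) \<in> borel_measurable P" for N
    by (intro borel_measurable_ereal_divide borel_measurable_const
        measurable_compose[OF measurable_tot[OF zero_V]]) simp
  then show ?thesis unfolding growth_def[abs_def] by measurable
qed

lemma log_ext_mono: "a \<le> b \<Longrightarrow> log_ext a \<le> log_ext b"
  by (auto simp: log_ext_def)

text \<open>Prepending a fixed open path to \<open>(n, x)\<close> injects the open paths from there
  into those from the origin. The delay is absorbed by the factor \<open>N / (N + n)\<close>, which
  tends to 1.\<close>

lemma growth_shift_le:
  assumes x: "x \<in> V" and c: "cnt D \<omega> 0 0 n x \<ge> 1"
  shows "growth (shift n x \<omega>) \<le> growth \<omega>"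
proof -
  let ?g = "\<lambda>N. log_ext (tot D \<omega> n x N) / ereal (real N)"
  have "growth (shift n x \<omega>) = limsup ?g"
    by (simp add: growth_def tot_shift[OF x])
  also have "\<dots> = 1 * limsup ?g" by simp
  also have "\<dots> = limsup (\<lambda>N. ereal (real N / real (N + n)) * ?g N)"
  proof (rule ereal_limsup_lim_mult[symmetric])
    have "(\<lambda>N. real N / real (N + n)) \<longlonglongrightarrow> 1"
      by real_asymp
    then show "(\<lambda>N. ereal (real N / real (N + n))) \<longlonglongrightarrow> 1"
      by (simp add: one_ereal_def)
  qed auto
  also have "\<dots> \<le> limsup (\<lambda>N. log_ext (tot D \<omega> 0 0 (N + n)) / ereal (real (N + n)))"
  proof (rule Limsup_mono, rule eventually_mono[OF eventually_gt_at_top[of 0]])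
    fix N :: nat assume N: "0 < N"
    have "log_ext (tot D \<omega> n x N) \<le> log_ext (tot D \<omega> 0 0 (N + n))"
      using tot_append_ge[OF finite_D c, of N] by (intro log_ext_mono) (simp add: add.commute)
    moreover have "ereal (real N / real (N + n)) * ?g N = log_ext (tot D \<omega> n x N) / ereal (real (N + n))"
      using N by (cases "log_ext (tot D \<omega> n x N)") (auto simp: divide_simps)
    ultimately show "ereal (real N / real (N + n)) * ?g N
        \<le> log_ext (tot D \<omega> 0 0 (N + n)) / ereal (real (N + n))"
      using N by (metis ereal_divide_right_mono add_gr_0 ereal_less(2) of_nat_0_less_iff)
  qed
  also have "\<dots> = growth \<omega>"
    unfolding growth_def by (rule limsup_shift_k)
  finally show ?thesis .
qed

section \<open>Events determined by finitely many time layers, and the zero-one argument\<close>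

definition determined :: "nat \<Rightarrow> 'a config set \<Rightarrow> bool" where
  "determined m A \<longleftrightarrow> A \<in> sets P \<and> (\<forall>\<omega>\<in>space P. \<forall>\<omega>'\<in>space P.
     (\<forall>e\<in>I. fst e < m \<longrightarrow> \<omega> e = \<omega>' e) \<longrightarrow> (\<omega> \<in> A \<longleftrightarrow> \<omega>' \<in> A))"

lemma determined_sets: "determined m A \<Longrightarrow> A \<in> sets P"
  by (simp add: determined_def)

lemma determinedD:
  "determined m A \<Longrightarrow> \<omega> \<in> space P \<Longrightarrow> \<omega>' \<in> space P \<Longrightarrow>
   (\<And>e. e \<in> I \<Longrightarrow> fst e < m \<Longrightarrow> \<omega> e = \<omega>' e) \<Longrightarrow> \<omega> \<in> A \<longleftrightarrow> \<omega>' \<in> A"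
  unfolding determined_def by blast

lemma determinedI:
  "A \<in> sets P \<Longrightarrow> (\<And>\<omega> \<omega>'. \<omega> \<in> space P \<Longrightarrow> \<omega>' \<in> space P \<Longrightarrow>
   (\<And>e. e \<in> I \<Longrightarrow> fst e < m \<Longrightarrow> \<omega> e = \<omega>' e) \<Longrightarrow> \<omega> \<in> A \<longleftrightarrow> \<omega>' \<in> A) \<Longrightarrow> determined m A"
  unfolding determined_def by blast

lemma determined_mono: "determined m A \<Longrightarrow> m \<le> n \<Longrightarrow> determined n A"
proof (rule determinedI)
  fix \<omega> \<omega>'
  assume "determined m A" "m \<le> n" "\<omega> \<in> space P" "\<omega>' \<in> space P" "\<And>e. e \<in> I \<Longrightarrow> fst e < n \<Longrightarrow> \<omega> e = \<omega>' e"
  then show "\<omega> \<in> A \<longleftrightarrow> \<omega>' \<in> A" by (intro determinedD[of m A]) auto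
qed (rule determined_sets)

lemma determined_Diff:
  assumes "determined m A" "determined m B"
  shows "determined m (A - B)"
proof (rule determinedI)
  fix \<omega> \<omega>' assume "\<omega> \<in> space P" "\<omega>' \<in> space P" "\<And>e. e \<in> I \<Longrightarrow> fst e < m \<Longrightarrow> \<omega> e = \<omega>' e"
  from determinedD[OF assms(1) this] determinedD[OF assms(2) this]
  show "\<omega> \<in> A - B \<longleftrightarrow> \<omega>' \<in> A - B" by simp
qed (use assms in \<open>auto intro: determined_sets\<close>)

lemma determined_Int:
  assumes "determined m A" "determined m B"
  shows "determined m (A \<inter> B)"
proof (rule determinedI)
  fix \<omega> \<omega>' assume "\<omega> \<in> space P" "\<omega>' \<in> space P" "\<And>e. e \<in> I \<Longrightarrow> fst e < m \<Longrightarrow> \<omega> e = \<omega>' e"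
  from determinedD[OF assms(1) this] determinedD[OF assms(2) this]
  show "\<omega> \<in> A \<inter> B \<longleftrightarrow> \<omega>' \<in> A \<inter> B" by simp
qed (use assms in \<open>auto intro: determined_sets\<close>)

lemma determined_UN:
  assumes "finite K" "\<And>k. k \<in> K \<Longrightarrow> determined m (B k)"
  shows "determined m (\<Union>k\<in>K. B k)"
proof (rule determinedI)
  fix \<omega> \<omega>' assume "\<omega> \<in> space P" "\<omega>' \<in> space P" "\<And>e. e \<in> I \<Longrightarrow> fst e < m \<Longrightarrow> \<omega> e = \<omega>' e"
  then have "\<omega> \<in> B k \<longleftrightarrow> \<omega>' \<in> B k" if "k \<in> K" for k
    using determinedD[OF assms(2)[OF that]] by blast
  then show "\<omega> \<in> (\<Union>k\<in>K. B k) \<longleftrightarrow> \<omega>' \<in> (\<Union>k\<in>K. B k)" by simp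
qed (use assms in \<open>auto intro: determined_sets\<close>)

lemma determined_space: "determined m (space P)"
  by (rule determinedI) auto

text \<open>The events that can be approximated in this way include the one-coordinate cylinders and
  are closed under complements and countable unions, hence exhaust the product
  sigma-algebra.\<close>

lemma approx_determined:
  assumes "A \<in> sets P" "0 < \<epsilon>"
  shows "\<exists>m B. determined m B \<and> measure P (sym_diff A B) < \<epsilon>"
proof -
  let ?G = "{{\<omega> \<in> space P. \<omega> i \<in> A} |i A. i \<in> I \<and> A \<in> sets (Me i)}"
  have sP: "sets P = sigma_sets (space P) ?G"
    unfolding P_def sets_PiM_single space_PiM ..
  from assms show ?thesis unfolding sP
  proof (induction arbitrary: \<epsilon>)
    case (Basic A)
    then obtain i A' where i: "i \<in> I" "A' \<in> sets (Me i)" "A = {\<omega> \<in> space P. \<omega> i \<in> A'}" by auto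
    have "determined (Suc (fst i)) A"
      using i Basic.hyps sigma_sets.Basic[of A ?G "space P"] by (auto simp: determined_def sP)
    then show ?case using Basic.prems by (intro exI[of _ "Suc (fst i)"] exI[of _ A]) auto
  next
    case Empty
    have "determined 0 {}" by (simp add: determined_def)
    then show ?case using Empty by (intro exI[of _ 0] exI[of _ "{}"]) auto
  next
    case (Compl A)
    from Compl.IH[OF Compl.prems] obtain m B where B: "determined m B" "measure P (sym_diff A B) < \<epsilon>"
      by auto
    have "A \<subseteq> space P" "B \<subseteq> space P"
      using Compl.hyps B(1) sP sets.sets_into_space by (auto simp: determined_def)
    then have "sym_diff (space P - A) (space P - B) = sym_diff A B" by auto
    then show ?case using B determined_Diff[OF determined_space B(1)] by metis
  next
    case (Union A)
    have A: "A i \<in> sets P" for i using Union.hyps by (simp add: sP)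
    have "(\<lambda>k. measure P (\<Union>i<k. A i)) \<longlonglongrightarrow> measure P (\<Union>k. \<Union>i<k. A i)"
      by (rule P.finite_Lim_measure_incseq) (use A in \<open>auto simp: incseq_Suc_iff less_Suc_eq\<close>)
    moreover have "(\<Union>k. \<Union>i<k. A i) = (\<Union>i. A i)" by auto
    ultimately have "(\<lambda>k. measure P (\<Union>i<k. A i)) \<longlonglongrightarrow> measure P (\<Union>i. A i)" by simp
    from LIMSEQ_D[OF this, of "\<epsilon> / 2"] Union.prems
    obtain k where k: "norm (measure P (\<Union>i<k. A i) - measure P (\<Union>i. A i)) < \<epsilon> / 2" by auto
    \<comment> \<open>Half of \<epsilon> pays for truncating the union at \<open>k\<close>, the
      other half is shared among the remaining \<open>k\<close> sets. \<open>Suc k\<close> avoids a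
      division by zero.\<close>
    have "0 < \<epsilon> / (2 * real (Suc k))" using Union.prems by simp
    from Union.IH[OF this] obtain m B where
      B: "\<And>i. determined (m i) (B i)" "\<And>i. measure P (sym_diff (A i) (B i)) < \<epsilon> / (2 * real (Suc k))"
      by metis
    have Bs: "B i \<in> sets P" for i using B(1)[of i] by (simp add: determined_def)
    \<comment> \<open>The sum is a crude common upper bound for the time horizons
      \<open>m i\<close>.\<close>
    have "determined (\<Sum>i<k. m i) (\<Union>i<k. B i)"
      by (intro determined_UN determined_mono[OF B(1)]) (auto intro: member_le_sum)
    moreover have "measure P (sym_diff (\<Union>i. A i) (\<Union>i<k. B i)) < \<epsilon>"
    proof -
      have "measure P (sym_diff (\<Union>i. A i) (\<Union>i<k. B i))
          \<le> measure P (((\<Union>i. A i) - (\<Union>i<k. A i)) \<union> (\<Union>i<k. sym_diff (A i) (B i)))"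
        using A Bs by (intro P.finite_measure_mono) auto
      also have "\<dots> \<le> measure P ((\<Union>i. A i) - (\<Union>i<k. A i)) + measure P (\<Union>i<k. sym_diff (A i) (B i))"
        using A Bs by (intro measure_Un_le) auto
      also have "measure P ((\<Union>i. A i) - (\<Union>i<k. A i)) = measure P (\<Union>i. A i) - measure P (\<Union>i<k. A i)"
        using A by (intro P.finite_measure_Diff) auto
      also have "\<dots> < \<epsilon> / 2" using k unfolding real_norm_def by linarith
      also have "measure P (\<Union>i<k. sym_diff (A i) (B i)) \<le> (\<Sum>i<k. measure P (sym_diff (A i) (B i)))"
        using A Bs by (intro measure_UNION_le) auto
      also have "\<dots> \<le> (\<Sum>i<k. \<epsilon> / (2 * real (Suc k)))"
        using B(2) by (intro sum_mono less_imp_le)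
      also have "\<dots> \<le> \<epsilon> / 2"
        using Union.prems by (simp add: field_simps)
      finally show ?thesis by simp
    qed
    ultimately show ?case by blast
  qed
qed

text \<open>\<open>A\<close> looks at the layers before \<open>n\<close> and the shifted
  configuration at those from \<open>n\<close> on, so the two are independent; the shift preserves
  the law.\<close>

lemma prob_determined_shift:
  assumes A: "determined n A" and x: "x \<in> V" and B: "B \<in> sets P"
  shows "measure P {\<omega> \<in> A. shift n x \<omega> \<in> B} = measure P A * measure P B"
proof -
  have As: "A \<in> sets P" and AP: "A \<subseteq> space P"
    using A sets.sets_into_space by (auto simp: determined_def)
  have Bs: "shift n x -` B \<inter> space P \<in> sets P"
    using measurable_shift[OF x] B by (rule measurable_sets)
  have "(\<integral>\<omega>. indicat_real A \<omega> * indicat_real B (shift n x \<omega>) \<partial>PiM I Me)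
      = (\<integral>\<omega>. indicat_real A \<omega> \<partial>PiM I Me) * (\<integral>\<omega>. indicat_real B (shift n x \<omega>) \<partial>PiM I Me)"
  proof (rule integral_mult_PiM_disjoint[OF prob_space_Me, where J = "{e \<in> I. fst e < n}" and J' = "{e \<in> I. n \<le> fst e}"])
    show "integrable (PiM I Me) (indicat_real A)"
      using As by (simp add: P_def[symmetric] P.emeasure_eq_measure)
    show "indicat_real A \<omega> = indicat_real A \<omega>'" if "\<omega> \<in> space (PiM I Me)" "\<omega>' \<in> space (PiM I Me)"
        "\<And>i. i \<in> {e \<in> I. fst e < n} \<Longrightarrow> \<omega> i = \<omega>' i" for \<omega> \<omega>'
    proof -
      have "\<omega> \<in> A \<longleftrightarrow> \<omega>' \<in> A"
        by (rule determinedD[OF A]) (use that in \<open>auto simp: P_def\<close>)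
      then show ?thesis by (simp add: indicator_def)
    qed
    have "integrable P (indicat_real (shift n x -` B \<inter> space P))"
      using Bs by (simp add: P.emeasure_eq_measure)
    then show "integrable (PiM I Me) (\<lambda>\<omega>. indicat_real B (shift n x \<omega>))"
      unfolding P_def[symmetric]
      by (rule Bochner_Integration.integrable_cong[THEN iffD1, rotated -1]) (auto simp: indicator_def)
    show "indicat_real B (shift n x \<omega>) = indicat_real B (shift n x \<omega>')" if "\<omega> \<in> space (PiM I Me)" "\<omega>' \<in> space (PiM I Me)"
        "\<And>i. i \<in> {e \<in> I. n \<le> fst e} \<Longrightarrow> \<omega> i = \<omega>' i" for \<omega> \<omega>'
    proof -
      have "shift n x \<omega> = shift n x \<omega>'"
        unfolding shift_def using that(3) x by (intro restrict_ext) (auto simp: I_def add_V)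
      then show ?thesis by simp
    qed
  qed auto
  moreover have "(\<integral>\<omega>. indicat_real B (shift n x \<omega>) \<partial>P) = measure P B"
    using integral_shift[OF x, of "indicat_real B" n] B sets.sets_into_space[OF B]
    by (simp add: Int_absorb2)
  moreover have "(\<integral>\<omega>. indicat_real A \<omega> * indicat_real B (shift n x \<omega>) \<partial>P) = measure P {\<omega> \<in> A. shift n x \<omega> \<in> B}"
  proof -
    have "(\<integral>\<omega>. indicat_real A \<omega> * indicat_real B (shift n x \<omega>) \<partial>P) = (\<integral>\<omega>. indicat_real {\<omega> \<in> A. shift n x \<omega> \<in> B} \<omega> \<partial>P)"
      by (intro Bochner_Integration.integral_cong) (auto simp: indicator_def)
    also have "{\<omega> \<in> A. shift n x \<omega> \<in> B} \<inter> space P = {\<omega> \<in> A. shift n x \<omega> \<in> B}" using AP by auto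
    ultimately show ?thesis by simp
  qed
  ultimately show ?thesis
    using AP by (simp add: P_def[symmetric] Int_absorb2)
qed

lemma determined_cnt: "determined n {\<omega> \<in> space P. cnt D \<omega> 0 0 n y \<ge> 1}"
proof -
  have "{\<omega> \<in> space P. cnt D \<omega> 0 0 n y \<ge> 1} \<in> sets P"
    using measurable_sets[OF measurable_cnt[OF zero_V, of 0 n y], of "{1..}"]
    by (simp add: vimage_def Int_def conj_commute)
  then show ?thesis
  proof (rule determinedI)
    fix \<omega> \<omega>' assume "\<omega> \<in> space P" "\<omega>' \<in> space P" "\<And>e. e \<in> I \<Longrightarrow> fst e < n \<Longrightarrow> \<omega> e = \<omega>' e"
    moreover from this(3) have "cnt D \<omega> 0 0 n y = cnt D \<omega>' 0 0 n y"
      by (intro cnt_cong) (auto simp: zero_V)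
    ultimately show "\<omega> \<in> {\<omega> \<in> space P. 1 \<le> cnt D \<omega> 0 0 n y} \<longleftrightarrow> \<omega>' \<in> {\<omega> \<in> space P. 1 \<le> cnt D \<omega> 0 0 n y}"
      by simp
  qed
qed

text \<open>The events of reaching different sites overlap. The induction over \<open>Y\<close>
  makes them disjoint by removing from \<open>A\<close> the event that \<open>y\<close> is reached,
  which is why \<open>A\<close> varies. Where \<open>y\<close> is reached, small growth from the
  origin forces small growth from \<open>(n, y)\<close>, an independent event.\<close>

lemma prob_growth_le_reach:
  assumes "finite Y" "Y \<subseteq> V" "determined n A"
  shows "measure P {\<omega> \<in> A. (\<exists>y\<in>Y. cnt D \<omega> 0 0 n y \<ge> 1) \<and> growth \<omega> \<le> a}
    \<le> measure P {\<omega> \<in> space P. growth \<omega> \<le> a} * measure P {\<omega> \<in> A. \<exists>y\<in>Y. cnt D \<omega> 0 0 n y \<ge> 1}"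
  using assms
proof (induction Y arbitrary: A rule: finite_induct)
  case (insert y Y)
  define R where "R = {\<omega> \<in> space P. cnt D \<omega> 0 0 n y \<ge> 1}"
  define U where "U = (\<Union>y\<in>Y. {\<omega> \<in> space P. cnt D \<omega> 0 0 n y \<ge> 1})"
  define B where "B = {\<omega> \<in> space P. growth \<omega> \<le> a}"
  have R: "determined n R" unfolding R_def by (rule determined_cnt)
  have U: "determined n U" unfolding U_def by (intro determined_UN determined_cnt insert)
  have B: "B \<in> sets P" unfolding B_def by measurable
  have A: "determined n A" by (rule insert)
  have sts: "R \<in> sets P" "U \<in> sets P" "A \<in> sets P" using R U A by (auto simp: determined_def)
  have sub: "A \<subseteq> space P" using sts sets.sets_into_space by auto
  have e1: "{\<omega> \<in> A. (\<exists>y\<in>insert y Y. cnt D \<omega> 0 0 n y \<ge> 1) \<and> growth \<omega> \<le> a} = A \<inter> (R \<union> U) \<inter> B"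
    and e2: "{\<omega> \<in> A. \<exists>y\<in>insert y Y. cnt D \<omega> 0 0 n y \<ge> 1} = A \<inter> (R \<union> U)"
    and e3: "{\<omega> \<in> A - R. (\<exists>y\<in>Y. cnt D \<omega> 0 0 n y \<ge> 1) \<and> growth \<omega> \<le> a} = (A - R) \<inter> U \<inter> B"
    and e4: "{\<omega> \<in> A - R. \<exists>y\<in>Y. cnt D \<omega> 0 0 n y \<ge> 1} = (A - R) \<inter> U"
    using sub by (auto simp: R_def U_def B_def)
  have ih: "measure P ((A - R) \<inter> U \<inter> B) \<le> measure P B * measure P ((A - R) \<inter> U)"
    using insert.IH[OF _ determined_Diff[OF A R]] insert.prems(1) by (simp only: e3 e4 B_def[symmetric]) simp
  have "measure P (A \<inter> R \<inter> B) \<le> measure P {\<omega> \<in> A \<inter> R. shift n y \<omega> \<in> B}"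
  proof (rule P.finite_measure_mono)
    show "A \<inter> R \<inter> B \<subseteq> {\<omega> \<in> A \<inter> R. shift n y \<omega> \<in> B}"
      using growth_shift_le[of y _ n] insert.prems(1) measurable_space[OF measurable_shift[of y n]]
      by (fastforce simp: R_def B_def intro: order.trans)
    have "shift n y -` B \<inter> space P \<in> sets P"
      using measurable_shift[of y n] insert.prems(1) B by (intro measurable_sets) auto
    then have "A \<inter> R \<inter> (shift n y -` B \<inter> space P) \<in> sets P" using sts by auto
    also have "A \<inter> R \<inter> (shift n y -` B \<inter> space P) = {\<omega> \<in> A \<inter> R. shift n y \<omega> \<in> B}" using sub by auto
    finally show "{\<omega> \<in> A \<inter> R. shift n y \<omega> \<in> B} \<in> sets P" .
  qed
  also have "\<dots> = measure P (A \<inter> R) * measure P B"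
    using insert.prems(1) by (intro prob_determined_shift determined_Int A R B) auto
  finally have 1: "measure P (A \<inter> R \<inter> B) \<le> measure P B * measure P (A \<inter> R)" by (simp add: mult.commute)
  have "A \<inter> (R \<union> U) \<inter> B = (A \<inter> R \<inter> B) \<union> ((A - R) \<inter> U \<inter> B)" by auto
  then have "measure P (A \<inter> (R \<union> U) \<inter> B) = measure P (A \<inter> R \<inter> B) + measure P ((A - R) \<inter> U \<inter> B)"
    using sts B by (simp add: P.finite_measure_Union Int_assoc) (subst P.finite_measure_Union, auto)
  also have "\<dots> \<le> measure P B * (measure P (A \<inter> R) + measure P ((A - R) \<inter> U))"
    using ih 1 by (simp add: distrib_left)
  also have "measure P (A \<inter> R) + measure P ((A - R) \<inter> U) = measure P (A \<inter> (R \<union> U))"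
  proof -
    have "A \<inter> (R \<union> U) = (A \<inter> R) \<union> ((A - R) \<inter> U)" by auto
    then show ?thesis using sts by (simp, subst P.finite_measure_Union, auto)
  qed
  finally show ?case by (simp only: e1 e2 B_def)
qed simp

lemma tot_pos_iff:
  "tot D \<omega> 0 0 n \<ge> 1 \<longleftrightarrow> (\<exists>y\<in>sum_list ` steps D n. cnt D \<omega> 0 0 n y \<ge> 1)"
proof -
  have "tot D \<omega> 0 0 n = (\<Sum>y\<in>sum_list ` steps D n. cnt D \<omega> 0 0 n y)"
    using tot_eq_sum_cnt[OF finite_D, of \<omega> 0 0 n] by simp
  moreover have "finite (sum_list ` steps D n)" by simp
  ultimately have "tot D \<omega> 0 0 n = 0 \<longleftrightarrow> (\<forall>y\<in>sum_list ` steps D n. cnt D \<omega> 0 0 n y = 0)"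
    by (simp add: sum_eq_0_iff)
  then have "tot D \<omega> 0 0 n \<noteq> 0 \<longleftrightarrow> (\<exists>y\<in>sum_list ` steps D n. cnt D \<omega> 0 0 n y \<noteq> 0)" by simp
  then show ?thesis by (simp only: One_nat_def Suc_le_eq neq0_conv)
qed

text \<open>
  The growth rate from the origin is at least the growth rate from any site reached at time \<open>m\<close>.
  The latter is independent of the events determined up to time \<open>m\<close>, and these approximate every
  event.
\<close>

lemma growth_zero_one:
  assumes "measure P {\<omega> \<in> space P. growth \<omega> \<le> a} < 1"
  shows "AE \<omega> in P. (\<forall>N. tot D \<omega> 0 0 N \<ge> 1) \<longrightarrow> a < growth \<omega>"
proof -
  define \<theta> where "\<theta> = measure P {\<omega> \<in> space P. growth \<omega> \<le> a}"
  define S where "S = {\<omega> \<in> space P. (\<forall>N. tot D \<omega> 0 0 N \<ge> 1) \<and> growth \<omega> \<le> a}"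
  have [measurable]: "(\<lambda>\<omega>. tot D \<omega> 0 0 N) \<in> measurable P (count_space UNIV)" for N
    by (rule measurable_tot[OF zero_V])
  have S: "S \<in> sets P" unfolding S_def by measurable
  \<comment> \<open>\<open>S\<close> is replaced by a nearby event determined up to time
    \<open>m\<close>, on which small growth costs a factor \<theta>, and this event is then compared
    with \<open>S\<close> again. Letting \<epsilon> tend to 0 leaves
    \<open>measure P S \<le> \<theta> * measure P S\<close>, and \<open>\<theta> < 1\<close> forces
    measure 0.\<close>
  have "measure P S \<le> \<theta> * (measure P S + \<epsilon>) + \<epsilon>" if \<epsilon>: "\<epsilon> > 0" for \<epsilon>
  proof -
    obtain m A where A: "determined m A" "measure P (sym_diff S A) < \<epsilon>"
      using approx_determined[OF S \<epsilon>] by auto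
    have As: "A \<in> sets P" using A by (simp add: determined_def)
    have AS: "A \<subseteq> space P" using As sets.sets_into_space by auto
    have "measure P S \<le> measure P ((S \<inter> A) \<union> sym_diff S A)"
      using S As by (intro P.finite_measure_mono) auto
    also have "\<dots> \<le> measure P (S \<inter> A) + measure P (sym_diff S A)"
      using S As by (intro measure_Un_le) auto
    also have "measure P (S \<inter> A) \<le> measure P {\<omega> \<in> A. (\<exists>y\<in>sum_list ` steps D m. cnt D \<omega> 0 0 m y \<ge> 1) \<and> growth \<omega> \<le> a}"
    proof (rule P.finite_measure_mono)
      show "S \<inter> A \<subseteq> {\<omega> \<in> A. (\<exists>y\<in>sum_list ` steps D m. cnt D \<omega> 0 0 m y \<ge> 1) \<and> growth \<omega> \<le> a}"
        by (auto simp: S_def tot_pos_iff simp del: One_nat_def)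
      have "{\<omega> \<in> space P. tot D \<omega> 0 0 m \<ge> 1 \<and> growth \<omega> \<le> a} \<in> sets P" by measurable
      from sets.Int[OF As this]
      have "A \<inter> {\<omega> \<in> space P. tot D \<omega> 0 0 m \<ge> 1 \<and> growth \<omega> \<le> a} \<in> sets P" .
      also have "A \<inter> {\<omega> \<in> space P. tot D \<omega> 0 0 m \<ge> 1 \<and> growth \<omega> \<le> a} =
          {\<omega> \<in> A. (\<exists>y\<in>sum_list ` steps D m. cnt D \<omega> 0 0 m y \<ge> 1) \<and> growth \<omega> \<le> a}"
        using AS unfolding tot_pos_iff by auto
      finally show "\<dots> \<in> sets P" .
    qed
    also have "\<dots> \<le> \<theta> * measure P {\<omega> \<in> A. \<exists>y\<in>sum_list ` steps D m. cnt D \<omega> 0 0 m y \<ge> 1}"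
      unfolding \<theta>_def by (intro prob_growth_le_reach A) (auto simp: sum_list_V[OF steps_V])
    also have "\<dots> \<le> \<theta> * measure P A"
      using As by (intro mult_left_mono P.finite_measure_mono) (auto simp: \<theta>_def)
    also have "measure P A \<le> measure P (S \<union> sym_diff S A)"
      using S As by (intro P.finite_measure_mono) auto
    also have "\<dots> \<le> measure P S + measure P (sym_diff S A)"
      using S As by (intro measure_Un_le) auto
    also have "\<dots> \<le> measure P S + \<epsilon>" using A by simp
    finally show ?thesis using A by (simp add: \<theta>_def mult_left_mono)
  qed
  then have "measure P S \<le> \<theta> * measure P S + \<epsilon>" if "\<epsilon> > 0" for \<epsilon>
  proof -
    have \<theta>: "0 \<le> \<theta>" "\<theta> < 1" using assms by (auto simp: \<theta>_def)
    have "measure P S \<le> \<theta> * (measure P S + \<epsilon> / 2) + \<epsilon> / 2" using \<open>\<And>\<epsilon>. \<epsilon> > 0 \<Longrightarrow> _\<close>[of "\<epsilon> / 2"] that by simp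
    also have "\<dots> = \<theta> * measure P S + \<theta> * (\<epsilon> / 2) + \<epsilon> / 2" by (simp add: distrib_left)
    also have "\<theta> * (\<epsilon> / 2) \<le> 1 * (\<epsilon> / 2)" using \<theta> that by (intro mult_right_mono) auto
    finally show ?thesis by simp
  qed
  then have "measure P S \<le> \<theta> * measure P S" by (rule field_le_epsilon)
  then have "(1 - \<theta>) * measure P S \<le> 0" by (simp add: algebra_simps)
  then have "measure P S \<le> 0" using assms by (simp add: \<theta>_def mult_le_0_iff)
  then have "S \<in> null_sets P"
    using S by (simp add: P.emeasure_eq_measure null_sets_def measure_le_0_iff)
  then show ?thesis
    by (rule AE_I') (auto simp: S_def)
qed

text \<open>For \<open>a\<close> below the essential supremum, growth at most \<open>a\<close> has
  probability less than 1, so \<open>growth_zero_one\<close> excludes it on survival. A sequence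
  converging to the supremum from below gives equality.\<close>

lemma growth_AE_const:
  "AE \<omega> in P. (\<forall>N. tot D \<omega> 0 0 N \<ge> 1) \<longrightarrow> growth \<omega> = esssup P growth"
proof -
  define c where "c = esssup P growth"
  have lt: "AE \<omega> in P. (\<forall>N. tot D \<omega> 0 0 N \<ge> 1) \<longrightarrow> a < growth \<omega>" if "a < c" for a
  proof (rule growth_zero_one)
    show "measure P {\<omega> \<in> space P. growth \<omega> \<le> a} < 1"
    proof (rule ccontr)
      assume "\<not> ?thesis"
      with P.prob_le_1[of "{\<omega> \<in> space P. growth \<omega> \<le> a}"]
      have "measure P {\<omega> \<in> space P. growth \<omega> \<le> a} = 1" by linarith
      then have "AE \<omega> in P. growth \<omega> \<le> a"
        by (subst (asm) P.prob_Collect_eq_1) measurable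
      then have "c \<le> a" unfolding c_def by (intro esssup_I) auto
      with that show False by simp
    qed
  qed
  have ge: "AE \<omega> in P. (\<forall>N. tot D \<omega> 0 0 N \<ge> 1) \<longrightarrow> c \<le> growth \<omega>"
  proof (cases "c = -\<infinity>")
    case False
    then obtain u where u: "\<And>n::nat. u n < c" "u \<longlonglongrightarrow> c"
      using approx_from_below_dense_linorder[of "-\<infinity>" c] by auto
    have "AE \<omega> in P. \<forall>n. (\<forall>N. tot D \<omega> 0 0 N \<ge> 1) \<longrightarrow> u n < growth \<omega>"
      unfolding AE_all_countable using lt u(1) by blast
    then show ?thesis
    proof (rule AE_mp, intro AE_I2 impI)
      fix \<omega> assume "\<forall>n. (\<forall>N. tot D \<omega> 0 0 N \<ge> 1) \<longrightarrow> u n < growth \<omega>" "\<forall>N. tot D \<omega> 0 0 N \<ge> 1"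
      then show "c \<le> growth \<omega>" using u(2) by (intro LIMSEQ_le_const2[OF u(2)]) (auto intro: less_imp_le)
    qed
  qed simp
  have le: "AE \<omega> in P. growth \<omega> \<le> c" unfolding c_def by (rule esssup_AE)
  from ge le show ?thesis unfolding c_def[symmetric] by eventually_elim auto
qed

text \<open>
  The measurability of the percolation event need not be discussed: for a non-measurable event,
  \<open>measure\<close> is \<open>0\<close> and the growth rate is \<open>-\<infinity>\<close>.
\<close>

lemma growth_rate_neq:
  assumes "AE \<omega> in P. growth \<omega> \<le> b" "b < c"
  shows "growth_rate V f p \<noteq> c"
proof (cases "measure (perc_measure V f p) (percolation_event V f p) > 0")
  case True
  let ?M = "completion P" and ?E = "percolation_event V f p" and ?c = "esssup P growth"
  have AEc: "AE \<omega> in ?M. \<omega> \<in> ?E \<longrightarrow> path_growth V \<omega> = ?c"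
  proof (rule AE_completion)
    show "AE \<omega> in P. \<omega> \<in> ?E \<longrightarrow> path_growth V \<omega> = ?c"
      using AE_admissible growth_AE_const
      by eventually_elim (auto simp: percolation_event_def path_growth_eq percolates_tot_pos simp del: One_nat_def)
  qed
  have "growth_rate V f p = (THE c. AE \<omega> in ?M. \<omega> \<in> ?E \<longrightarrow> path_growth V \<omega> = c)"
    unfolding growth_rate_def perc_measure_eq by (rule if_P) (use True perc_measure_eq in simp)
  also have "\<dots> = ?c"
  \<comment> \<open>Two different constants would make the percolation event null, although its
    measure is positive.\<close>
  proof (rule the_equality)
    show "AE \<omega> in ?M. \<omega> \<in> ?E \<longrightarrow> path_growth V \<omega> = ?c" by (rule AEc)
  next
    fix c' :: ereal assume "AE \<omega> in ?M. \<omega> \<in> ?E \<longrightarrow> path_growth V \<omega> = c'"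
    with AEc have "AE \<omega> in ?M. \<omega> \<in> ?E \<longrightarrow> c' = ?c" by eventually_elim auto
    then have "AE \<omega> in ?M. \<omega> \<notin> ?E" if "c' \<noteq> ?c" using that by simp
    then have "measure ?M ?E = 0" if "c' \<noteq> ?c"
      using that by (cases "?E \<in> sets ?M") (auto simp: measure_eq_0_null_sets AE_iff_null_sets[symmetric] measure_notin_sets)
    then show "c' = ?c" using True by (auto simp: perc_measure_eq)
  qed
  also have "\<dots> \<le> b" by (rule esssup_I) (use assms in auto)
  finally show ?thesis using assms(2) by auto
qed (use assms in \<open>auto simp: growth_rate_def\<close>)

end

section \<open>Fractional moments\<close>

text \<open>After division by \<open>a + b\<close> both summands lie in [0, 1], where
  \<open>x \<le> x powr \<theta>\<close>.\<close>

lemma powr_add_le: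
  fixes a b \<theta> :: real
  assumes "0 \<le> a" "0 \<le> b" "0 < \<theta>" "\<theta> \<le> 1"
  shows "(a + b) powr \<theta> \<le> a powr \<theta> + b powr \<theta>"
proof (cases "a + b = 0")
  case False
  then have s: "a + b > 0" using assms by simp
  have le: "x / (a + b) \<le> (x / (a + b)) powr \<theta>" if "0 \<le> x" "x \<le> a + b" for x
  proof (cases "x = 0")
    case False
    then have "(x / (a + b)) powr 1 \<le> (x / (a + b)) powr \<theta>"
      using that s assms by (intro powr_mono') auto
    then show ?thesis using that s by simp
  qed simp
  have "1 = a / (a + b) + b / (a + b)" using s by (simp add: add_divide_distrib[symmetric])
  also have "\<dots> \<le> (a / (a + b)) powr \<theta> + (b / (a + b)) powr \<theta>"
    using assms by (intro add_mono le) auto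
  also have "\<dots> = (a powr \<theta> + b powr \<theta>) / (a + b) powr \<theta>"
    using assms s by (simp add: powr_divide add_divide_distrib)
  finally show ?thesis using s by (simp add: field_simps)
qed (use assms in auto)

lemma powr_sum_le:
  fixes a :: "'b \<Rightarrow> real"
  assumes "\<And>i. i \<in> A \<Longrightarrow> 0 \<le> a i" "0 < \<theta>" "\<theta> \<le> 1"
  shows "(\<Sum>i\<in>A. a i) powr \<theta> \<le> (\<Sum>i\<in>A. a i powr \<theta>)"
proof (cases "finite A")
  case True
  then show ?thesis using assms
  proof (induction A rule: finite_induct)
    case (insert x F)
    have "(\<Sum>i\<in>insert x F. a i) powr \<theta> \<le> a x powr \<theta> + (\<Sum>i\<in>F. a i) powr \<theta>"
      using insert by (simp, intro powr_add_le sum_nonneg) auto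
    also have "\<dots> \<le> a x powr \<theta> + (\<Sum>i\<in>F. a i powr \<theta>)" using insert by simp
    finally show ?case using insert by simp
  qed simp
qed (use assms in auto)

text \<open>
  This is the inequality \<open>exp (- x) \<le> 1 - x + x\<^sup>2\<close> for \<open>x = s * ln c\<close>.
\<close>

lemma powr_one_minus_le:
  fixes c :: nat and s :: real
  assumes "0 < s" "s < 1"
  shows "real c powr (1 - s) \<le> real c - s * (real c * ln (real c)) + s\<^sup>2 * (real c * (ln (real c))\<^sup>2)"
proof (cases "c = 0")
  case False
  define x where "x = s * ln (real c)"
  have x: "0 \<le> x" using False assms by (simp add: x_def)
  have "1 \<le> 1 + x ^ 3" using x by simp
  also have "\<dots> = (1 - x + x\<^sup>2) * (1 + x)" by (simp add: algebra_simps power2_eq_square power3_eq_cube)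
  also have "\<dots> \<le> (1 - x + x\<^sup>2) * exp x"
  proof (rule mult_left_mono)
    have "1 - x + x\<^sup>2 = (1 - x / 2)\<^sup>2 + 3 / 4 * x\<^sup>2" by (simp add: power2_eq_square field_simps)
    then show "0 \<le> 1 - x + x\<^sup>2" by simp
  qed (use exp_ge_add_one_self in auto)
  finally have "exp (- x) \<le> 1 - x + x\<^sup>2" by (simp add: exp_minus field_simps)
  then have "real c * exp (- x) \<le> real c * (1 - x + x\<^sup>2)" by (rule mult_left_mono) simp
  moreover have "real c powr (1 - s) = real c * exp (- x)"
    using False by (simp add: powr_def x_def algebra_simps exp_diff exp_minus field_simps)
  ultimately show ?thesis by (simp add: x_def algebra_simps power_mult_distrib)
qed simp

section \<open>Point-to-point fractional moments\<close>

context perc begin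

abbreviation ends :: "nat \<Rightarrow> 'a set" where "ends N \<equiv> sum_list ` steps D N"

lemma ends_V: "y \<in> ends N \<Longrightarrow> y \<in> V"
  using sum_list_V steps_V by auto

lemma cnt_le: "cnt D \<omega> n x N y \<le> card (steps D N)"
  unfolding cnt_def by (intro card_mono) auto

lemma cnt_eq_0: "y - x \<notin> ends N \<Longrightarrow> cnt D \<omega> n x N y = 0"
  by (auto simp: cnt_def)

lemma integrable_fun_cnt:
  fixes g :: "nat \<Rightarrow> real"
  assumes "x \<in> V"
  shows "integrable P (\<lambda>\<omega>. g (cnt D \<omega> n x N y))"
proof (rule P.integrable_const_bound)
  show "(\<lambda>\<omega>. g (cnt D \<omega> n x N y)) \<in> borel_measurable P"
    by (rule measurable_compose[OF measurable_cnt[OF assms]]) simp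
  show "AE \<omega> in P. norm (g (cnt D \<omega> n x N y)) \<le> Max ((\<lambda>k. norm (g k)) ` {..card (steps D N)})"
    by (intro AE_I2 Max_ge) (auto simp: cnt_le)
qed

text \<open>Each endpoint is hit by as many open paths as \<open>cnt\<close> counts. With a
  logarithm for \<open>h\<close>, the sum over open paths becomes the sum of Z log Z over
  endpoints.\<close>

lemma sum_opn_cnt:
  "(\<Sum>S\<in>steps D T. opn (edges 0 0 S) \<omega> * h (cnt D \<omega> 0 0 T (sum_list S)))
    = (\<Sum>y\<in>ends T. real (cnt D \<omega> 0 0 T y) * h (cnt D \<omega> 0 0 T y))"
proof -
  have "(\<Sum>S\<in>steps D T. opn (edges 0 0 S) \<omega> * h (cnt D \<omega> 0 0 T (sum_list S)))
      = (\<Sum>y\<in>ends T. \<Sum>S\<in>{S \<in> steps D T. sum_list S = y}.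
          opn (edges 0 0 S) \<omega> * h (cnt D \<omega> 0 0 T (sum_list S)))"
    by (rule sum.group[symmetric]) auto
  also have "\<dots> = (\<Sum>y\<in>ends T. real (cnt D \<omega> 0 0 T y) * h (cnt D \<omega> 0 0 T y))"
    by (intro sum.cong refl) (simp add: cnt_eq_sum_opn sum_distrib_right)
  finally show ?thesis .
qed

lemma expectation_opn_path:
  "x \<in> V \<Longrightarrow> s \<in> steps D N \<Longrightarrow> (\<integral>\<omega>. opn (edges n x s) \<omega> \<partial>P) = p ^ N * wt f s"
  using integral_opn[OF finite_edges edges_I'[of x s N n]] by (simp add: prod_q_edges length_steps)

lemma expectation_tot: "(\<integral>\<omega>. real (tot D \<omega> 0 0 N) \<partial>P) = p ^ N"
proof -
  have "(\<integral>\<omega>. real (tot D \<omega> 0 0 N) \<partial>P) = (\<Sum>s\<in>steps D N. \<integral>\<omega>. opn (edges 0 0 s) \<omega> \<partial>P)"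
    unfolding tot_eq_sum_opn
    by (intro Bochner_Integration.integral_sum integrable_opn finite_edges edges_I'[OF zero_V])
  also have "\<dots> = p ^ N"
    by (simp add: expectation_opn_path zero_V sum_distrib_left[symmetric] sum_wt_steps)
  finally show ?thesis .
qed

lemma tot_eq_sum_ends: "tot D \<omega> 0 0 N = (\<Sum>y\<in>ends N. cnt D \<omega> 0 0 N y)"
  using tot_eq_sum_cnt[OF finite_D, of \<omega> 0 0 N] by simp

definition fm :: "real \<Rightarrow> nat \<Rightarrow> real" where
  "fm \<theta> N = (\<Sum>y\<in>ends N. \<integral>\<omega>. real (cnt D \<omega> 0 0 N y) powr \<theta> \<partial>P)"

lemma fm_nonneg: "fm \<theta> N \<ge> 0"
  unfolding fm_def by (intro sum_nonneg integral_nonneg) auto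

text \<open>The count is decomposed over the site \<open>v\<close> visited at time \<open>N\<close>,
  subadditivity of the power is applied to this sum, and the two factors are independent because
  they use different time layers. By translation invariance, summing over endpoints removes the
  dependence on \<open>v\<close>.\<close>

lemma fm_append_le:
  assumes "0 < \<theta>" "\<theta> \<le> 1"
  shows "fm \<theta> (N + M) \<le> fm \<theta> N * fm \<theta> M"
proof -
  let ?a = "\<lambda>v. \<integral>\<omega>. real (cnt D \<omega> 0 0 N v) powr \<theta> \<partial>P"
  let ?b = "\<lambda>w. \<integral>\<omega>. real (cnt D \<omega> 0 0 M w) powr \<theta> \<partial>P"
  have fact: "(\<integral>\<omega>. real (cnt D \<omega> 0 0 N v) powr \<theta> * real (cnt D \<omega> N v M y) powr \<theta> \<partial>P) = ?a v * ?b (y - v)"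
    and int: "integrable P (\<lambda>\<omega>. real (cnt D \<omega> 0 0 N v) powr \<theta> * real (cnt D \<omega> N v M y) powr \<theta>)"
    if v: "v \<in> ends N" for v y
  proof -
    have vV: "v \<in> V" using v by (rule ends_V)
    note I1 = integrable_fun_cnt[OF zero_V, of "\<lambda>k. real k powr \<theta>" 0 N v]
    note I2 = integrable_fun_cnt[OF vV, of "\<lambda>k. real k powr \<theta>" N M y]
    note disj = integral_mult_PiM_disjoint[where I = I and M = Me and J = "{e \<in> I. fst e < N}" and J' = "{e \<in> I. N \<le> fst e}",
        OF prob_space_Me _ _ _ I1[unfolded P_def] _ I2[unfolded P_def], folded P_def]
    have c1: "real (cnt D \<omega> 0 0 N v) powr \<theta> = real (cnt D \<omega>' 0 0 N v) powr \<theta>" if "\<And>i. i \<in> {e \<in> I. fst e < N} \<Longrightarrow> \<omega> i = \<omega>' i" for \<omega> \<omega>'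
    proof -
      have "cnt D \<omega> 0 0 N v = cnt D \<omega>' 0 0 N v" by (rule cnt_cong) (use that zero_V in auto)
      then show ?thesis by simp
    qed
    have c2: "real (cnt D \<omega> N v M y) powr \<theta> = real (cnt D \<omega>' N v M y) powr \<theta>" if "\<And>i. i \<in> {e \<in> I. N \<le> fst e} \<Longrightarrow> \<omega> i = \<omega>' i" for \<omega> \<omega>'
    proof -
      have "cnt D \<omega> N v M y = cnt D \<omega>' N v M y" by (rule cnt_cong) (use that vV in auto)
      then show ?thesis by simp
    qed
    have "(\<integral>\<omega>. real (cnt D \<omega> 0 0 N v) powr \<theta> * real (cnt D \<omega> N v M y) powr \<theta> \<partial>P)
      = ?a v * (\<integral>\<omega>. real (cnt D \<omega> N v M y) powr \<theta> \<partial>P)"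
      by (rule disj(1)) ((rule c1, simp; fail) | (rule c2, simp; fail) | force)+
    also have "(\<integral>\<omega>. real (cnt D \<omega> N v M y) powr \<theta> \<partial>P) = ?b (y - v)"
      unfolding cnt_shift[OF vV]
      using integral_shift[OF vV borel_measurable_integrable[OF integrable_fun_cnt[OF zero_V, of "\<lambda>k. real k powr \<theta>" 0 M "y - v"]], of N]
      by simp
    finally show "(\<integral>\<omega>. real (cnt D \<omega> 0 0 N v) powr \<theta> * real (cnt D \<omega> N v M y) powr \<theta> \<partial>P) = ?a v * ?b (y - v)" .
    show "integrable P (\<lambda>\<omega>. real (cnt D \<omega> 0 0 N v) powr \<theta> * real (cnt D \<omega> N v M y) powr \<theta>)"
      by (rule disj(2)) ((rule c1, simp; fail) | (rule c2, simp; fail) | force)+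
  qed
  have "fm \<theta> (N + M) \<le> (\<Sum>y\<in>ends (N + M). \<Sum>v\<in>ends N. ?a v * ?b (y - v))"
    unfolding fm_def
  proof (rule sum_mono)
    fix y
    have "(\<integral>\<omega>. real (cnt D \<omega> 0 0 (N + M) y) powr \<theta> \<partial>P)
      \<le> (\<integral>\<omega>. (\<Sum>v\<in>ends N. real (cnt D \<omega> 0 0 N v) powr \<theta> * real (cnt D \<omega> N v M y) powr \<theta>) \<partial>P)"
    proof (rule integral_mono)
      show "integrable P (\<lambda>\<omega>. real (cnt D \<omega> 0 0 (N + M) y) powr \<theta>)"
        by (rule integrable_fun_cnt[OF zero_V, of "\<lambda>k. real k powr \<theta>"])
      show "integrable P (\<lambda>\<omega>. \<Sum>v\<in>ends N. real (cnt D \<omega> 0 0 N v) powr \<theta> * real (cnt D \<omega> N v M y) powr \<theta>)"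
        by (intro Bochner_Integration.integrable_sum int)
      fix \<omega>
      have "real (cnt D \<omega> 0 0 (N + M) y) = (\<Sum>v\<in>ends N. real (cnt D \<omega> 0 0 N v) * real (cnt D \<omega> N v M y))"
        using cnt_append[OF finite_D, of \<omega> 0 0 N M y] by simp
      also have "\<dots> powr \<theta> \<le> (\<Sum>v\<in>ends N. (real (cnt D \<omega> 0 0 N v) * real (cnt D \<omega> N v M y)) powr \<theta>)"
        by (intro powr_sum_le assms) auto
      finally show "real (cnt D \<omega> 0 0 (N + M) y) powr \<theta>
          \<le> (\<Sum>v\<in>ends N. real (cnt D \<omega> 0 0 N v) powr \<theta> * real (cnt D \<omega> N v M y) powr \<theta>)"
        by (simp add: powr_mult)
    qed
    also have "\<dots> = (\<Sum>v\<in>ends N. ?a v * ?b (y - v))"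
      using fact int by (simp add: Bochner_Integration.integral_sum)
    finally show "(\<integral>\<omega>. real (cnt D \<omega> 0 0 (N + M) y) powr \<theta> \<partial>P) \<le> (\<Sum>v\<in>ends N. ?a v * ?b (y - v))" .
  qed
  also have "\<dots> = (\<Sum>v\<in>ends N. ?a v * (\<Sum>y\<in>ends (N + M). ?b (y - v)))"
    by (subst sum.swap) (simp add: sum_distrib_left)
  also have "\<dots> \<le> (\<Sum>v\<in>ends N. ?a v * fm \<theta> M)"
  proof (intro sum_mono mult_left_mono integral_nonneg)
    fix v
    have "(\<Sum>y\<in>ends (N + M). ?b (y - v)) = (\<Sum>w\<in>(\<lambda>y. y - v) ` ends (N + M). ?b w)"
      by (subst sum.reindex) (auto simp: inj_on_def)
    also have "\<dots> = (\<Sum>w\<in>(\<lambda>y. y - v) ` ends (N + M) \<inter> ends M. ?b w)"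
      by (intro sum.mono_neutral_right) (auto simp: cnt_eq_0)
    also have "\<dots> \<le> fm \<theta> M"
      unfolding fm_def by (intro sum_mono2 integral_nonneg) auto
    finally show "(\<Sum>y\<in>ends (N + M). ?b (y - v)) \<le> fm \<theta> M" .
  qed auto
  also have "\<dots> = fm \<theta> N * fm \<theta> M"
    by (simp add: fm_def sum_distrib_right)
  finally show ?thesis .
qed

lemma fm_mult_le:
  assumes "0 < \<theta>" "\<theta> \<le> 1"
  shows "fm \<theta> (k * T + r) \<le> fm \<theta> T ^ k * fm \<theta> r"
proof (induction k)
  case (Suc k)
  have "fm \<theta> (Suc k * T + r) \<le> fm \<theta> T * fm \<theta> (k * T + r)"
    using fm_append_le[OF assms, of T "k * T + r"] by (simp add: add.assoc)
  also have "\<dots> \<le> fm \<theta> T * (fm \<theta> T ^ k * fm \<theta> r)"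
    by (intro mult_left_mono Suc fm_nonneg)
  finally show ?case by simp
qed simp

lemma expectation_tot_powr_le:
  assumes "0 < \<theta>" "\<theta> \<le> 1"
  shows "(\<integral>\<omega>. real (tot D \<omega> 0 0 N) powr \<theta> \<partial>P) \<le> fm \<theta> N"
    and "integrable P (\<lambda>\<omega>. real (tot D \<omega> 0 0 N) powr \<theta>)"
proof -
  have le: "real (tot D \<omega> 0 0 N) powr \<theta> \<le> (\<Sum>y\<in>ends N. real (cnt D \<omega> 0 0 N y) powr \<theta>)" for \<omega>
    unfolding tot_eq_sum_ends of_nat_sum by (intro powr_sum_le assms) auto
  have int: "integrable P (\<lambda>\<omega>. real (cnt D \<omega> 0 0 N y) powr \<theta>)" for y
    by (rule integrable_fun_cnt[OF zero_V, of "\<lambda>k. real k powr \<theta>"])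
  show "integrable P (\<lambda>\<omega>. real (tot D \<omega> 0 0 N) powr \<theta>)"
  proof (rule Bochner_Integration.integrable_bound)
    show "integrable P (\<lambda>\<omega>. \<Sum>y\<in>ends N. real (cnt D \<omega> 0 0 N y) powr \<theta>)"
      by (intro Bochner_Integration.integrable_sum int)
    show "(\<lambda>\<omega>. real (tot D \<omega> 0 0 N) powr \<theta>) \<in> borel_measurable P"
      using borel_measurable_tot[OF zero_V] by measurable
    show "AE \<omega> in P. norm (real (tot D \<omega> 0 0 N) powr \<theta>) \<le> norm (\<Sum>y\<in>ends N. real (cnt D \<omega> 0 0 N y) powr \<theta>)"
      using le by (intro AE_I2) (auto intro!: order.trans[OF le abs_ge_self])
  qed
  then have "(\<integral>\<omega>. real (tot D \<omega> 0 0 N) powr \<theta> \<partial>P) \<le> (\<integral>\<omega>. (\<Sum>y\<in>ends N. real (cnt D \<omega> 0 0 N y) powr \<theta>) \<partial>P)"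
    by (rule integral_mono) (use le int in \<open>auto intro!: Bochner_Integration.integrable_sum\<close>)
  also have "\<dots> = fm \<theta> N"
    using int by (simp add: fm_def Bochner_Integration.integral_sum)
  finally show "(\<integral>\<omega>. real (tot D \<omega> 0 0 N) powr \<theta> \<partial>P) \<le> fm \<theta> N" .
qed

section \<open>From moment bounds to almost sure bounds on the growth rate\<close>

lemma growth_le_of_summable:
  assumes "summable (\<lambda>N. measure P {\<omega> \<in> space P. exp (b * real N) \<le> real (tot D \<omega> 0 0 N)})"
  shows "AE \<omega> in P. growth \<omega> \<le> ereal b"
proof -
  let ?A = "\<lambda>N. {\<omega> \<in> space P. exp (b * real N) \<le> real (tot D \<omega> 0 0 N)}"
  have "AE \<omega> in P. eventually (\<lambda>N. \<omega> \<in> space P - ?A N) sequentially"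
    by (rule borel_cantelli_AE1) (use assms borel_measurable_tot[OF zero_V] in \<open>auto simp: P.emeasure_eq_measure\<close>)
  then show ?thesis
  proof (rule AE_mp, intro AE_I2 impI)
    fix \<omega> assume "eventually (\<lambda>N. \<omega> \<in> space P - ?A N) sequentially"
    then have "eventually (\<lambda>N. log_ext (tot D \<omega> 0 0 N) / ereal (real N) \<le> ereal b) sequentially"
      using eventually_gt_at_top[of 0]
    proof eventually_elim
      case (elim N)
      then have "real (tot D \<omega> 0 0 N) < exp (b * real N)" by auto
      then have "ln (real (tot D \<omega> 0 0 N)) / real N \<le> b" if "tot D \<omega> 0 0 N \<noteq> 0"
        using that elim ln_less_cancel_iff[of "real (tot D \<omega> 0 0 N)" "exp (b * real N)"]
        by (simp add: divide_simps del: ln_less_cancel_iff)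
      then show ?case using elim by (auto simp: log_ext_def)
    qed
    then show "growth \<omega> \<le> ereal b" unfolding growth_def by (intro Limsup_bounded)
  qed
qed

text \<open>For \<open>p < 1\<close> an open path of length \<open>n\<close> exists with probability
  at most \<open>p ^ n\<close>, so almost surely there are no long paths at all. The bound
  \<open>ln p - 1\<close> stands for any number below \<open>ln p\<close>.\<close>

lemma growth_subcritical:
  assumes "p < 1"
  shows "AE \<omega> in P. growth \<omega> \<le> ereal (ln p - 1)"
proof (rule growth_le_of_summable, rule summable_comparison_test)
  show "summable (\<lambda>N. p ^ N)" using assms p_pos by (intro summable_geometric) auto
  show "\<exists>N. \<forall>n\<ge>N. norm (measure P {\<omega> \<in> space P. exp ((ln p - 1) * real n) \<le> real (tot D \<omega> 0 0 n)}) \<le> p ^ n"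
  proof (intro exI allI impI)
    fix n :: nat
    let ?t = "\<lambda>\<omega>. real (tot D \<omega> 0 0 n)"
    have int: "integrable P ?t"
      unfolding tot_eq_sum_opn
      by (intro Bochner_Integration.integrable_sum integrable_opn finite_edges edges_I'[OF zero_V])
    have "measure P {\<omega> \<in> space P. exp ((ln p - 1) * real n) \<le> ?t \<omega>} \<le> measure P {\<omega> \<in> space P. 1 \<le> ?t \<omega>}"
    proof (rule P.finite_measure_mono)
      show "{\<omega> \<in> space P. 1 \<le> ?t \<omega>} \<in> sets P" using borel_measurable_tot[OF zero_V, of 0 n] by measurable
      show "{\<omega> \<in> space P. exp ((ln p - 1) * real n) \<le> ?t \<omega>} \<subseteq> {\<omega> \<in> space P. 1 \<le> ?t \<omega>}"
      proof safe
        fix \<omega> assume "exp ((ln p - 1) * real n) \<le> ?t \<omega>"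
        moreover have "exp ((ln p - 1) * real n) > 0" by simp
        ultimately have "0 < ?t \<omega>" by linarith
        then show "1 \<le> ?t \<omega>" by simp
      qed
    qed
    also have "\<dots> \<le> (\<integral>\<omega>. ?t \<omega> \<partial>P) / 1"
      by (rule integral_Markov_inequality_measure[where A = "{}"]) (use int in auto)
    finally show "norm (measure P {\<omega> \<in> space P. exp ((ln p - 1) * real n) \<le> real (tot D \<omega> 0 0 n)}) \<le> p ^ n"
      by (simp add: expectation_tot)
  qed
qed

text \<open>Submultiplicativity bounds \<open>fm \<theta> N\<close> by an exponential with rate
  \<gamma>, where \<open>\<gamma> / \<theta> < ln p\<close>. For \<open>b\<close> strictly in
  between, Markov's inequality for the power \<theta> of the path count gives summable
  probabilities.\<close>

lemma growth_le_of_fm: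
  assumes \<theta>: "0 < \<theta>" "\<theta> \<le> 1" and T: "0 < T" and less: "fm \<theta> T < p powr (\<theta> * real T)"
  shows "\<exists>b < ln p. AE \<omega> in P. growth \<omega> \<le> ereal b"
proof -
  obtain \<rho> where \<rho>: "fm \<theta> T < \<rho>" "\<rho> < p powr (\<theta> * real T)" using dense[OF less] by auto
  have \<rho>0: "0 < \<rho>" using \<rho> fm_nonneg[of \<theta> T] by simp
  define \<gamma> where "\<gamma> = ln \<rho> / real T"
  have "ln \<rho> < ln (p powr (\<theta> * real T))" using \<rho> \<rho>0 p_pos by (subst ln_less_cancel_iff) auto
  then have "\<gamma> < \<theta> * ln p" using T p_pos by (simp add: \<gamma>_def ln_powr field_simps)
  then have "\<gamma> / \<theta> < ln p" using \<theta> by (simp add: field_simps)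
  from dense[OF this] obtain b where b: "\<gamma> / \<theta> < b" "b < ln p" by auto
  have gb: "\<gamma> < \<theta> * b" using b \<theta> by (simp add: field_simps)
  have \<gamma>: "\<rho> = exp (\<gamma> * real T)" using T \<rho>0 by (simp add: \<gamma>_def)
  define A where "A = (\<Sum>r<T. fm \<theta> r) * exp (\<bar>\<gamma>\<bar> * real T)"
  have bound: "fm \<theta> N \<le> A * exp (\<gamma> * real N)" for N
  proof -
    let ?k = "N div T" and ?r = "N mod T"
    have r: "?r < T" using T by simp
    have "fm \<theta> N \<le> fm \<theta> T ^ ?k * fm \<theta> ?r"
      using fm_mult_le[OF \<theta>, of ?k T ?r] by simp
    also have "\<dots> \<le> \<rho> ^ ?k * (\<Sum>r<T. fm \<theta> r)"
      using \<rho> \<rho>0 r by (intro mult_mono power_mono fm_nonneg member_le_sum) (auto intro: fm_nonneg)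
    \<comment> \<open>\<gamma> may have either sign, so the fewer than \<open>T\<close> steps left
      over by the division are paid for with \<open>\<bar>\<gamma>\<bar>\<close>.\<close>
    also have "\<rho> ^ ?k \<le> exp (\<bar>\<gamma>\<bar> * real T) * exp (\<gamma> * real N)"
    proof -
      have "real N = real ?k * real T + real ?r"
        by (simp flip: of_nat_mult of_nat_add)
      then have "\<gamma> * real T * real ?k = \<gamma> * real N - \<gamma> * real ?r" by (simp add: algebra_simps)
      also have "- (\<gamma> * real ?r) \<le> \<bar>\<gamma>\<bar> * real T"
      proof -
        have "- (\<gamma> * real ?r) \<le> \<bar>\<gamma>\<bar> * real ?r" by (simp add: abs_if mult_le_0_iff)
        also have "\<dots> \<le> \<bar>\<gamma>\<bar> * real T" using r by (intro mult_left_mono) auto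
        finally show ?thesis .
      qed
      then have "\<gamma> * real N - \<gamma> * real ?r \<le> \<bar>\<gamma>\<bar> * real T + \<gamma> * real N" by simp
      finally have "exp (\<gamma> * real T * real ?k) \<le> exp (\<bar>\<gamma>\<bar> * real T + \<gamma> * real N)" by simp
      then show ?thesis by (simp add: \<gamma> exp_add exp_of_nat_mult[symmetric] mult.commute)
    qed
    finally show ?thesis
      using sum_nonneg[of "{..<T}" "fm \<theta>"] fm_nonneg
      by (simp add: A_def mult_right_mono ac_simps)
  qed
  have "AE \<omega> in P. growth \<omega> \<le> ereal b"
  proof (rule growth_le_of_summable, rule summable_comparison_test)
    show "summable (\<lambda>N. A * exp (\<gamma> - \<theta> * b) ^ N)"
      using gb by (intro summable_mult summable_geometric) auto
    show "\<exists>N. \<forall>n\<ge>N. norm (measure P {\<omega> \<in> space P. exp (b * real n) \<le> real (tot D \<omega> 0 0 n)}) \<le> A * exp (\<gamma> - \<theta> * b) ^ n"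
    proof (intro exI allI impI)
      fix n :: nat
      let ?t = "\<lambda>\<omega>. real (tot D \<omega> 0 0 n)"
      have "measure P {\<omega> \<in> space P. exp (b * real n) \<le> ?t \<omega>}
          \<le> measure P {\<omega> \<in> space P. exp (\<theta> * b * real n) \<le> ?t \<omega> powr \<theta>}"
      proof (rule P.finite_measure_mono)
        show "{\<omega> \<in> space P. exp (\<theta> * b * real n) \<le> ?t \<omega> powr \<theta>} \<in> sets P"
          using borel_measurable_tot[OF zero_V, of 0 n] by measurable
        show "{\<omega> \<in> space P. exp (b * real n) \<le> ?t \<omega>} \<subseteq> {\<omega> \<in> space P. exp (\<theta> * b * real n) \<le> ?t \<omega> powr \<theta>}"
        proof safe
          fix \<omega> assume "exp (b * real n) \<le> ?t \<omega>"
          then have "exp (b * real n) powr \<theta> \<le> ?t \<omega> powr \<theta>" using \<theta> by (intro powr_mono2) auto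
          then show "exp (\<theta> * b * real n) \<le> ?t \<omega> powr \<theta>" by (simp add: powr_def algebra_simps)
        qed
      qed
      also have "\<dots> \<le> (\<integral>\<omega>. ?t \<omega> powr \<theta> \<partial>P) / exp (\<theta> * b * real n)"
        by (rule integral_Markov_inequality_measure[where A = "{}"])
           (use expectation_tot_powr_le(2)[OF \<theta>] in auto)
      also have "\<dots> \<le> A * exp (\<gamma> * real n) / exp (\<theta> * b * real n)"
        using expectation_tot_powr_le(1)[OF \<theta>, of n] bound[of n] by (intro divide_right_mono) auto
      also have "\<dots> = A * exp (\<gamma> - \<theta> * b) ^ n"
        by (simp add: exp_diff exp_of_nat_mult[symmetric] algebra_simps power_divide)
      finally show "norm (measure P {\<omega> \<in> space P. exp (b * real n) \<le> ?t \<omega>}) \<le> A * exp (\<gamma> - \<theta> * b) ^ n" by simp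
    qed
  qed
  with b show ?thesis by blast
qed

text \<open>
  The two sides compare the derivatives at \<open>\<theta> = 1\<close> of \<open>p powr (\<theta> * T)\<close> and of the fractional
  moment \<open>fm \<theta> T\<close>, which agree at \<open>\<theta> = 1\<close>.
\<close>

lemma entropy_criterion:
  assumes less: "p ^ T * (real T * ln p) <
    (\<integral>\<omega>. (\<Sum>S\<in>steps D T. opn (edges 0 0 S) \<omega> * ln (real (cnt D \<omega> 0 0 T (sum_list S)))) \<partial>P)"
  shows "\<exists>b < ln p. AE \<omega> in P. growth \<omega> \<le> ereal b"
proof -
  let ?c = "\<lambda>y \<omega>. real (cnt D \<omega> 0 0 T y)"
  define H where "H = (\<Sum>y\<in>ends T. \<integral>\<omega>. ?c y \<omega> * ln (?c y \<omega>) \<partial>P)"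
  define C where "C = (\<Sum>y\<in>ends T. \<integral>\<omega>. ?c y \<omega> * (ln (?c y \<omega>))\<^sup>2 \<partial>P)"
  have int: "integrable P (\<lambda>\<omega>. g (cnt D \<omega> 0 0 T y))" for g :: "nat \<Rightarrow> real" and y
    by (rule integrable_fun_cnt[OF zero_V])
  note i1 = int[of "\<lambda>k. real k * ln (real k)"] int[of "\<lambda>k. real k * (ln (real k))\<^sup>2"] int[of real]
  have H: "(\<integral>\<omega>. (\<Sum>S\<in>steps D T. opn (edges 0 0 S) \<omega> * ln (?c (sum_list S) \<omega>)) \<partial>P) = H"
    unfolding sum_opn_cnt[where h = "\<lambda>k. ln (real k)"] H_def
    by (rule Bochner_Integration.integral_sum) (rule i1)
  have C: "C \<ge> 0" unfolding C_def by (intro sum_nonneg integral_nonneg) auto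
  have one: "(\<Sum>y\<in>ends T. \<integral>\<omega>. ?c y \<omega> \<partial>P) = p ^ T"
    using expectation_tot[of T] i1(3) by (simp add: tot_eq_sum_ends Bochner_Integration.integral_sum)
  define \<delta> where "\<delta> = H - p ^ T * (real T * ln p)"
  have \<delta>: "\<delta> > 0" using less by (simp add: \<delta>_def H)
  \<comment> \<open>Makes the second-order term \<open>s * C\<close> smaller than the first-order
    gain \<delta> while keeping the exponent \<open>1 - s\<close> in (0, 1). The summand 1 avoids a
    division by zero.\<close>
  define s where "s = min (1 / 2) (\<delta> / (2 * (C + 1)))"
  have s: "0 < s" "s < 1" using \<delta> C by (auto simp: s_def)
  have "s * C \<le> \<delta> / (2 * (C + 1)) * C" using C by (intro mult_right_mono) (auto simp: s_def)
  also have "\<dots> < \<delta>" using \<delta> C by (simp add: field_simps add_strict_increasing)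
  finally have sC: "s * C < \<delta>" .
  have "fm (1 - s) T \<le> (\<Sum>y\<in>ends T. \<integral>\<omega>. ?c y \<omega> - s * (?c y \<omega> * ln (?c y \<omega>)) + s\<^sup>2 * (?c y \<omega> * (ln (?c y \<omega>))\<^sup>2) \<partial>P)"
    unfolding fm_def
    by (intro sum_mono integral_mono int[of "\<lambda>k. real k powr (1 - s)"] powr_one_minus_le s
        Bochner_Integration.integrable_add Bochner_Integration.integrable_diff integrable_mult_right i1)
  also have "\<dots> = p ^ T - s * H + s\<^sup>2 * C"
    by (simp add: i1 sum.distrib sum_subtractf one[symmetric] H_def C_def sum_distrib_left)
  also have "\<dots> = p ^ T - s * (H - s * C)" by (simp add: power2_eq_square algebra_simps)
  also have "\<dots> < p ^ T - s * (p ^ T * (real T * ln p))"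
    using s sC by (simp add: \<delta>_def)
  also have "\<dots> = p ^ T * (1 + - (s * (real T * ln p)))" by (simp add: algebra_simps)
  \<comment> \<open>An exponential lies above its tangent, so the comparison of derivatives at
    \<theta> = 1 carries over to the exponent \<open>1 - s\<close>.\<close>
  also have "\<dots> \<le> p ^ T * exp (- (s * (real T * ln p)))"
    using p_pos by (intro mult_left_mono exp_ge_add_one_self) auto
  also have "\<dots> = p powr ((1 - s) * real T)"
    using p_pos by (simp add: powr_def powr_realpow[symmetric] left_diff_distrib exp_diff exp_minus field_simps)
  finally have "fm (1 - s) T < p powr ((1 - s) * real T)" .
  \<comment> \<open>For \<open>T = 0\<close> there is only the empty path, so both sides of the
    strict inequality assumed would vanish.\<close>
  moreover have "T \<noteq> 0"
  proof
    assume T: "T = 0"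
    have "cnt D \<omega> 0 0 0 0 \<le> 1" for \<omega> :: "'a config"
      unfolding cnt_def by (rule order.trans[OF card_mono[of "{[]}"]]) auto
    then have "ln (real (cnt D \<omega> 0 0 0 0)) = 0" for \<omega> :: "'a config"
      by (metis le_antisym less_one ln_0 ln_one not_le of_nat_0 of_nat_1)
    then show False using less T by simp
  qed
  ultimately show ?thesis using s by (intro growth_le_of_fm[of "1 - s" T]) auto
qed

end

section \<open>Counting good detours\<close>

lemma sum_Un_le:
  fixes g :: "'b \<Rightarrow> real"
  assumes "finite A" "finite B" "\<And>x. 0 \<le> g x"
  shows "sum g (A \<union> B) \<le> sum g A + sum g B"
  using sum.union_inter[OF assms(1,2), of g] sum_nonneg[of "A \<inter> B" g] assms(3) by simp

lemma sum_UNION_le: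
  fixes g :: "'b \<Rightarrow> real"
  assumes "finite K" "\<And>k. finite (A k)" "\<And>x. 0 \<le> g x"
  shows "sum g (\<Union>k\<in>K. A k) \<le> (\<Sum>k\<in>K. sum g (A k))"
  using assms(1)
proof (induction K rule: finite_induct)
  case (insert k K)
  have "sum g (A k \<union> (\<Union>k\<in>K. A k)) \<le> sum g (A k) + sum g (\<Union>k\<in>K. A k)"
    using insert assms by (intro sum_Un_le) auto
  then show ?case using insert by simp
qed simp

section \<open>Weights of the paths that avoid a given walk\<close>

context kernel begin

text \<open>A segment of a random walk path is again a random walk path; the weights of the parts
  before and after it sum to 1.\<close>

lemma sum_wt_slice:
  assumes "i + l \<le> T"
  shows "(\<Sum>S\<in>steps D T. wt f S * F (take l (drop i S))) = (\<Sum>s\<in>steps D l. wt f s * F s)"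
proof -
  have T: "T = i + (l + (T - i - l))" using assms by simp
  have "(\<Sum>S\<in>steps D T. wt f S * F (take l (drop i S)))
      = (\<Sum>r\<in>steps D i. \<Sum>s\<in>steps D l. \<Sum>t\<in>steps D (T - i - l).
          wt f (r @ s @ t) * F (take l (drop i (r @ s @ t))))"
    by (subst T) (simp only: sum_steps_append[OF finite_D])
  also have "\<dots> = (\<Sum>r\<in>steps D i. \<Sum>s\<in>steps D l. \<Sum>t\<in>steps D (T - i - l).
      wt f r * (wt f s * F s) * wt f t)"
    by (intro sum.cong refl) (simp add: length_steps)
  also have "\<dots> = (\<Sum>r\<in>steps D i. wt f r * (\<Sum>s\<in>steps D l. wt f s * F s))"
    by (simp add: sum_distrib_left[symmetric] sum_wt_steps)
  also have "\<dots> = (\<Sum>s\<in>steps D l. wt f s * F s)"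
    by (simp add: sum_distrib_right[symmetric] sum_wt_steps)
  finally show ?thesis .
qed

text \<open>By \<open>conv_power_double\<close> this is the probability that two independent walks
  are at the same site after \<open>l\<close> steps, that is, the mean weight of all paths with the
  endpoints of a walk of length \<open>l\<close>.\<close>

definition return :: "nat \<Rightarrow> real" where
  "return l = conv_power f (2 * l) 0"

lemma return_nonneg: "return l \<ge> 0"
  by (simp add: return_def conv_power_nonneg)

definition avoiding :: "'a list \<Rightarrow> 'a list set" where
  "avoiding s = {g \<in> steps D (length s). sum_list g = sum_list s \<and>
     (\<forall>m. 0 < m \<and> m < length s \<longrightarrow> pos g m \<noteq> pos s m)}"

lemma finite_avoiding [simp]: "finite (avoiding s)"
  by (simp add: avoiding_def)

lemma sum_wt_end: "(\<Sum>g\<in>{g \<in> steps D n. sum_list g = x}. wt f g) = conv_power f n x"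
  by (simp add: conv_power_steps sum.inter_filter)

lemma sum_wt_via:
  assumes "m \<le> l"
  shows "(\<Sum>g\<in>{g \<in> steps D l. sum_list g = x \<and> pos g m = y}. wt f g)
    = conv_power f m y * conv_power f (l - m) (x - y)"
proof -
  have "(\<Sum>g\<in>{g \<in> steps D l. sum_list g = x \<and> pos g m = y}. wt f g)
      = (\<Sum>g\<in>steps D (m + (l - m)). if sum_list g = x \<and> pos g m = y then wt f g else 0)"
    using assms by (simp add: sum.inter_filter)
  also have "\<dots> = (\<Sum>r\<in>steps D m. \<Sum>t\<in>steps D (l - m).
      if sum_list (r @ t) = x \<and> pos (r @ t) m = y then wt f (r @ t) else 0)"
    by (simp only: sum_steps_append[OF finite_D])
  also have "\<dots> = (\<Sum>r\<in>steps D m. \<Sum>t\<in>steps D (l - m).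
      (if sum_list r = y then wt f r else 0) * (if sum_list t = x - y then wt f t else 0))"
    by (intro sum.cong refl) (auto simp: length_steps algebra_simps)
  also have "\<dots> = conv_power f m y * conv_power f (l - m) (x - y)"
    by (simp add: conv_power_steps sum_product)
  finally show ?thesis .
qed

lemma sum_wt_avoiding_le: "s \<in> steps D l \<Longrightarrow> (\<Sum>g\<in>avoiding s. wt f g) \<le> conv_power f l (sum_list s)"
  unfolding sum_wt_end[symmetric] avoiding_def
  by (intro sum_mono2) (auto simp: length_steps wt_nonneg)

text \<open>Union bound over an intermediate meeting time \<open>m\<close>. The paths meeting
  \<open>s\<close> at \<open>m\<close> split there, and so does \<open>s\<close>; averaging over
  \<open>s\<close> turns the two pieces into \<open>return m\<close> and
  \<open>return (l - m)\<close>.\<close>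

lemma sum_wt_avoiding_ge:
  "(\<Sum>s\<in>steps D l. wt f s * (\<Sum>g\<in>avoiding s. wt f g)) \<ge> return l - (\<Sum>m\<in>{0<..<l}. return m * return (l - m))"
proof -
  let ?h = "\<lambda>s m. conv_power f m (pos s m) * conv_power f (l - m) (sum_list s - pos s m)"
  have le: "conv_power f l (sum_list s) \<le> (\<Sum>g\<in>avoiding s. wt f g) + (\<Sum>m\<in>{0<..<l}. ?h s m)"
    if s: "s \<in> steps D l" for s
  proof -
    let ?G = "\<lambda>m. {g \<in> steps D l. sum_list g = sum_list s \<and> pos g m = pos s m}"
    have "conv_power f l (sum_list s) = (\<Sum>g\<in>{g \<in> steps D l. sum_list g = sum_list s}. wt f g)"
      by (simp add: sum_wt_end)
    also have "\<dots> \<le> (\<Sum>g\<in>avoiding s \<union> (\<Union>m\<in>{0<..<l}. ?G m). wt f g)"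
      using s by (intro sum_mono2) (auto simp: avoiding_def length_steps wt_nonneg)
    also have "\<dots> \<le> (\<Sum>g\<in>avoiding s. wt f g) + (\<Sum>g\<in>(\<Union>m\<in>{0<..<l}. ?G m). wt f g)"
      by (intro sum_Un_le) (auto simp: wt_nonneg)
    also have "(\<Sum>g\<in>(\<Union>m\<in>{0<..<l}. ?G m). wt f g) \<le> (\<Sum>m\<in>{0<..<l}. \<Sum>g\<in>?G m. wt f g)"
      by (intro sum_UNION_le) (auto simp: wt_nonneg)
    also have "\<dots> = (\<Sum>m\<in>{0<..<l}. ?h s m)"
      by (intro sum.cong refl) (simp add: sum_wt_via)
    finally show ?thesis by simp
  qed
  have h: "(\<Sum>s\<in>steps D l. wt f s * ?h s m) = return m * return (l - m)" if m: "m \<in> {0<..<l}" for m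
  proof -
    have "(\<Sum>s\<in>steps D (m + (l - m)). wt f s * ?h s m)
        = (\<Sum>r\<in>steps D m. \<Sum>t\<in>steps D (l - m). wt f (r @ t) * ?h (r @ t) m)"
      by (simp only: sum_steps_append[OF finite_D])
    also have "\<dots> = (\<Sum>r\<in>steps D m. \<Sum>t\<in>steps D (l - m).
        (wt f r * conv_power f m (sum_list r)) * (wt f t * conv_power f (l - m) (sum_list t)))"
      by (intro sum.cong refl) (simp add: length_steps algebra_simps)
    also have "\<dots> = return m * return (l - m)"
      by (simp add: sum_product[symmetric] conv_power_double return_def)
    finally show ?thesis using m by simp
  qed
  have "return l = (\<Sum>s\<in>steps D l. wt f s * conv_power f l (sum_list s))"
    by (simp add: return_def conv_power_double)
  also have "\<dots> \<le> (\<Sum>s\<in>steps D l. wt f s * ((\<Sum>g\<in>avoiding s. wt f g) + (\<Sum>m\<in>{0<..<l}. ?h s m)))"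
    by (intro sum_mono mult_left_mono le wt_nonneg)
  also have "\<dots> = (\<Sum>s\<in>steps D l. wt f s * (\<Sum>g\<in>avoiding s. wt f g)) +
      (\<Sum>m\<in>{0<..<l}. \<Sum>s\<in>steps D l. wt f s * ?h s m)"
    by (simp add: distrib_left sum.distrib sum_distrib_left sum.swap[of _ "{0<..<l}"])
  finally show ?thesis by (simp add: h)
qed

lemma detour_iff_avoiding:
  assumes "length S = T"
  shows "detour D K S (i, l, g) \<longleftrightarrow> 2 \<le> l \<and> l \<le> K \<and> i + l \<le> T \<and> g \<in> avoiding (take l (drop i S))"
proof (cases "i + l \<le> T")
  case True
  have "pos S i + pos (take l (drop i S)) m = pos S (i + m)" if "m \<le> l" for m
    by (rule pos_slice[OF that])
  then have "pos S (i + m) = pos S i + pos (take l (drop i S)) m" if "m \<le> l" for m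
    using that by simp
  from this[of l] this show ?thesis
    using True assms by (auto simp: detour_def avoiding_def)
qed (use assms in \<open>auto simp: detour_def\<close>)

end

section \<open>Expected number of good detours\<close>

context perc begin

text \<open>The constant counts the freedom of an interference of length \<open>n\<close>: at most
  \<open>l + n\<close> starting times let it overlap the detour, and it has two possible vertices at
  its start and two at its end. With both ends fixed the total weight is at most
  \<open>M n\<close>.\<close>

lemma sum_interf_le:
  assumes M: "\<And>n x. 1 \<le> n \<Longrightarrow> n \<le> K \<Longrightarrow> conv_power f n x \<le> M n"
  shows "finite (interf D K S (i, l, g))"
    and "(\<Sum>(n, a, x, e)\<in>interf D K S (i, l, g). p ^ n * wt f e)
      \<le> (\<Sum>n=1..K. 4 * real (l + n) * p ^ n * M n)"
proof -
  let ?d = "(i, l, g)"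
  define A where "A n = {a. a < i + l \<and> i < a + n}" for n
  define X where "X a = {pos S a, dpos S ?d a}" for a
  define E where "E n a x = {e \<in> steps D n. x + sum_list e \<in> X (a + n)}" for n a x
  define W where "W = (SIGMA n:{1..K}. SIGMA a:A n. SIGMA x:X a. E n a x)"
  have finA: "finite (A n)" for n by (simp add: A_def)
  have finX: "finite (X a)" "card (X a) \<le> 2" for a
    by (simp_all add: X_def card_insert_if)
  have finE: "finite (E n a x)" for n a x by (simp add: E_def)
  have finW: "finite W" unfolding W_def by (intro finite_SigmaI finA finX finE) auto
  have sub: "interf D K S ?d \<subseteq> W"
    by (auto simp: interf_def W_def A_def X_def E_def)
  show "finite (interf D K S ?d)" using sub finW by (rule finite_subset)
  have M0: "0 \<le> M n" if "1 \<le> n" "n \<le> K" for n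
    using M[OF that, of 0] conv_power_nonneg[of n 0] by linarith
  have cardA: "card (A n) \<le> l + n" for n
  proof -
    have "A n \<subseteq> {i + 1 - n..<i + l}" by (auto simp: A_def)
    then have "card (A n) \<le> card {i + 1 - n..<i + l}" by (intro card_mono) auto
    then show ?thesis by simp
  qed
  have "(\<Sum>(n, a, x, e)\<in>interf D K S ?d. p ^ n * wt f e) \<le> (\<Sum>(n, a, x, e)\<in>W. p ^ n * wt f e)"
    using p_pos by (intro sum_mono2 finW sub) (auto simp: wt_nonneg)
  also have "\<dots> = (\<Sum>n=1..K. \<Sum>a\<in>A n. \<Sum>x\<in>X a. \<Sum>e\<in>E n a x. p ^ n * wt f e)"
    unfolding W_def by (simp add: sum.Sigma finA finX finE finite_SigmaI case_prod_unfold)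
  also have "\<dots> \<le> (\<Sum>n=1..K. \<Sum>a\<in>A n. \<Sum>x\<in>X a. \<Sum>y\<in>X (a + n). p ^ n * M n)"
  proof (intro sum_mono)
    fix n a x assume n: "n \<in> {1..K}"
    have "(\<Sum>e\<in>E n a x. wt f e) \<le> (\<Sum>e\<in>(\<Union>y\<in>X (a + n). {e \<in> steps D n. sum_list e = y - x}). wt f e)"
      by (intro sum_mono2) (auto simp: E_def wt_nonneg finX algebra_simps)
    also have "\<dots> \<le> (\<Sum>y\<in>X (a + n). \<Sum>e\<in>{e \<in> steps D n. sum_list e = y - x}. wt f e)"
      by (intro sum_UNION_le) (auto simp: wt_nonneg finX)
    also have "\<dots> \<le> (\<Sum>y\<in>X (a + n). M n)"
      unfolding sum_wt_end using M n by (intro sum_mono) auto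
    finally show "(\<Sum>e\<in>E n a x. p ^ n * wt f e) \<le> (\<Sum>y\<in>X (a + n). p ^ n * M n)"
      using p_pos by (simp add: sum_distrib_left[symmetric] mult_left_mono)
  qed
  also have "\<dots> \<le> (\<Sum>n=1..K. real (l + n) * (2 * (2 * (p ^ n * M n))))"
  proof (intro sum_mono)
    fix n assume n: "n \<in> {1..K}"
    have nn: "0 \<le> p ^ n * M n" using M0 n p_pos by auto
    have c2: "real (card (X a)) * z \<le> 2 * z" if "0 \<le> z" for a z
      using finX(2)[of a] that by (intro mult_right_mono) auto
    have "(\<Sum>a\<in>A n. \<Sum>x\<in>X a. \<Sum>y\<in>X (a + n). p ^ n * M n) \<le> (\<Sum>a\<in>A n. 2 * (2 * (p ^ n * M n)))"
    proof (intro sum_mono)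
      fix a
      have "(\<Sum>x\<in>X a. \<Sum>y\<in>X (a + n). p ^ n * M n) = real (card (X a)) * (real (card (X (a + n))) * (p ^ n * M n))"
        by simp
      also have "\<dots> \<le> 2 * (real (card (X (a + n))) * (p ^ n * M n))" using nn by (intro c2) auto
      also have "\<dots> \<le> 2 * (2 * (p ^ n * M n))" using nn by (intro mult_left_mono c2) auto
      finally show "(\<Sum>x\<in>X a. \<Sum>y\<in>X (a + n). p ^ n * M n) \<le> 2 * (2 * (p ^ n * M n))" .
    qed
    also have "\<dots> = real (card (A n)) * (2 * (2 * (p ^ n * M n)))" by simp
    also have "\<dots> \<le> real (l + n) * (2 * (2 * (p ^ n * M n)))"
      using cardA nn by (intro mult_right_mono) (auto simp flip: of_nat_add)
    finally show "(\<Sum>a\<in>A n. \<Sum>x\<in>X a. \<Sum>y\<in>X (a + n). p ^ n * M n) \<le> real (l + n) * (2 * (2 * (p ^ n * M n)))" .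
  qed
  finally show "(\<Sum>(n, a, x, e)\<in>interf D K S (i, l, g). p ^ n * wt f e) \<le> (\<Sum>n=1..K. 4 * real (l + n) * p ^ n * M n)"
    by (simp add: mult_ac)
qed

text \<open>For \<open>1 \<le> p\<close>, a lower bound for the expected number of good detours of
  length \<open>l\<close> per starting time: the factor \<open>p ^ l\<close> is dropped from the
  avoiding part and kept in the loss.\<close>

definition gain :: "nat \<Rightarrow> (nat \<Rightarrow> real) \<Rightarrow> nat \<Rightarrow> real" where
  "gain K M l = return l - (\<Sum>m\<in>{0<..<l}. return m * return (l - m))
     - p ^ l * return l * (\<Sum>n=1..K. 4 * real (l + n) * p ^ n * M n)"

lemma pos_V: "s \<in> steps D N \<Longrightarrow> pos s k \<in> V"
  using steps_V[of s N] by (intro sum_list_V) (auto dest: in_set_takeD)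

text \<open>
  On configurations in which \<open>S\<close> is open, this quantity is at most the indicator of the event that
  the detour \<open>d\<close> is good. It is a combination of probabilities of disjoint edge sets being open.
\<close>

definition good_minorant :: "nat \<Rightarrow> 'a list \<Rightarrow> nat \<times> nat \<times> 'a list \<Rightarrow> 'a config \<Rightarrow> real" where
  "good_minorant K S d \<omega> = opn (edges 0 0 S) \<omega> * (opn (dedges S d) \<omega> -
     (\<Sum>(n, a, x, e)\<in>interf D K S d. opn (dedges S d) \<omega> * opn (edges a x e) \<omega>))"

text \<open>The edge sets of \<open>S\<close>, of the detour and of an interference are pairwise
  disjoint, so every term of the minorant has a product expectation, and
  \<open>sum_interf_le\<close> bounds the sum over interferences.\<close>

lemma expectation_good:
  assumes S: "S \<in> steps D T" and d: "detour D K S (i, l, g)"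
    and M: "\<And>n x. 1 \<le> n \<Longrightarrow> n \<le> K \<Longrightarrow> conv_power f n x \<le> M n"
  shows "p ^ T * wt f S * (p ^ l * wt f g * (1 - (\<Sum>n=1..K. 4 * real (l + n) * p ^ n * M n)))
    \<le> (\<integral>\<omega>. good_minorant K S (i, l, g) \<omega> \<partial>P)"
    and "integrable P (good_minorant K S (i, l, g))"
proof -
  let ?d = "(i, l, g)"
  have g: "g \<in> steps D l" using d by (simp add: detour_def)
  have E1: "edges 0 0 S \<subseteq> I" by (rule edges_I'[OF zero_V S])
  have E2: "dedges S ?d \<subseteq> I" unfolding dedges_def using edges_I'[OF pos_V[OF S] g] by simp
  have fin2: "finite (dedges S ?d)" by (simp add: dedges_def)
  have disj: "edges 0 0 S \<inter> dedges S ?d = {}" using detour_edges_disjoint[OF d] by auto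
  have q1: "prod q (edges 0 0 S) = p ^ T * wt f S" using S by (simp add: prod_q_edges length_steps)
  have q2: "prod q (dedges S ?d) = p ^ l * wt f g" using g by (simp add: dedges_def prod_q_edges length_steps)
  have q12: "prod q (edges 0 0 S \<union> dedges S ?d) = p ^ T * wt f S * (p ^ l * wt f g)"
    using disj fin2 by (simp add: prod.union_disjoint q1 q2)
  note finI = sum_interf_le(1)[OF M, of K S i l g]
  define U where "U = edges 0 0 S \<union> dedges S ?d"
  define W where "W = p ^ T * wt f S * (p ^ l * wt f g)"
  define E where "E = (\<lambda>(n :: nat, a, x :: 'a, e). edges a x e)"
  define h where "h = (\<lambda>(n :: nat, a :: nat, x :: 'a, e). p ^ n * wt f e)"
  have U: "finite U" "U \<subseteq> I" using E1 E2 fin2 by (auto simp: U_def)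
  have int: "integrable P (opn (U \<union> E w))" and ex: "(\<integral>\<omega>. opn (U \<union> E w) \<omega> \<partial>P) = W * h w"
    if "w \<in> interf D K S ?d" for w
  proof -
    obtain n a x e where w: "w = (n, a, x, e)" by (metis prod_cases4)
    have dV: "dpos S ?d k \<in> V" for k
      using pos_V[OF S] pos_V[OF g] by (auto simp: dpos_def add_V)
    have e: "e \<in> steps D n" "x \<in> V" "edges a x e \<inter> U = {}"
      using that pos_V[OF S] dV by (auto simp: interf_def w U_def)
    have E3: "edges a x e \<subseteq> I" by (rule edges_I'[OF e(2,1)])
    show "integrable P (opn (U \<union> E w))"
      using U E3 by (intro integrable_opn) (auto simp: E_def w)
    have "(\<integral>\<omega>. opn (U \<union> E w) \<omega> \<partial>P) = prod q (U \<union> E w)"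
      using U E3 by (intro integral_opn) (auto simp: E_def w)
    also have "\<dots> = prod q U * prod q (edges a x e)"
      unfolding E_def w split using e(3) U by (intro prod.union_disjoint) auto
    finally show "(\<integral>\<omega>. opn (U \<union> E w) \<omega> \<partial>P) = W * h w"
      using e(1) by (simp add: q12[folded U_def] prod_q_edges length_steps W_def h_def w)
  qed
  have F: "good_minorant K S ?d = (\<lambda>\<omega>. opn U \<omega> - (\<Sum>w\<in>interf D K S ?d. opn (U \<union> E w) \<omega>))"
    by (simp add: good_minorant_def fun_eq_iff opn_Un U_def E_def right_diff_distrib sum_distrib_left case_prod_unfold mult.assoc)
  show "integrable P (good_minorant K S ?d)"
    unfolding F using int integrable_opn[OF U] by simp
  have "integral\<^sup>L P (good_minorant K S ?d) = (\<integral>\<omega>. opn U \<omega> \<partial>P) - (\<Sum>w\<in>interf D K S ?d. \<integral>\<omega>. opn (U \<union> E w) \<omega> \<partial>P)"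
    unfolding F using int integrable_opn[OF U]
    by (simp add: Bochner_Integration.integral_diff Bochner_Integration.integral_sum Bochner_Integration.integrable_sum)
  also have "\<dots> = W - (\<Sum>w\<in>interf D K S ?d. W * h w)"
    by (simp add: ex integral_opn[OF U] q12[folded U_def] W_def)
  also have "\<dots> = p ^ T * wt f S * (p ^ l * wt f g) -
      (\<Sum>(n, a, x, e)\<in>interf D K S ?d. p ^ T * wt f S * (p ^ l * wt f g) * (p ^ n * wt f e))"
    by (simp add: W_def h_def case_prod_unfold)
  also have "\<dots> = p ^ T * wt f S * (p ^ l * wt f g) * (1 - (\<Sum>(n, a, x, e)\<in>interf D K S ?d. p ^ n * wt f e))"
    by (simp add: right_diff_distrib sum_distrib_left case_prod_unfold)
  also have "\<dots> \<ge> p ^ T * wt f S * (p ^ l * wt f g) * (1 - (\<Sum>n=1..K. 4 * real (l + n) * p ^ n * M n))"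
    using sum_interf_le(2)[OF M, of K S i l g] p_pos wt_nonneg by (intro mult_left_mono) auto
  finally show "p ^ T * wt f S * (p ^ l * wt f g * (1 - (\<Sum>n=1..K. 4 * real (l + n) * p ^ n * M n)))
    \<le> integral\<^sup>L P (good_minorant K S ?d)" by (simp add: mult.assoc)
qed

lemma good_count_le_ln_cnt:
  assumes S: "S \<in> steps D T" and fin: "finite {d. detour D K S d}"
    and finI: "\<And>d. finite (interf D K S d)"
  shows "ln 2 * (\<Sum>d | detour D K S d. good_minorant K S d \<omega>)
    \<le> opn (edges 0 0 S) \<omega> * ln (real (cnt D \<omega> 0 0 T (sum_list S)))"
proof (cases "edges 0 0 S \<subseteq> Collect \<omega>")
  case True
  define G where "G = {d. detour D K S d \<and> good D K S \<omega> d}"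
  have finG: "finite G" unfolding G_def using fin by (rule rev_finite_subset) auto
  have "2 ^ card G \<le> cnt D \<omega> 0 0 T (sum_list S)"
    by (rule two_power_good_le_cnt[OF finite_D S True finG]) (auto simp: G_def)
  then have "real (2 ^ card G) \<le> real (cnt D \<omega> 0 0 T (sum_list S))" by (rule of_nat_mono)
  then have "ln (2 ^ card G) \<le> ln (real (cnt D \<omega> 0 0 T (sum_list S)))"
    by (intro ln_mono) auto
  then have ln: "ln 2 * real (card G) \<le> ln (real (cnt D \<omega> 0 0 T (sum_list S)))"
    by (simp add: ln_realpow mult.commute)
  have "(\<Sum>d | detour D K S d. good_minorant K S d \<omega>) \<le> (\<Sum>d | detour D K S d. of_bool (good D K S \<omega> d))"
  proof (rule sum_mono)
    fix d
    let ?s = "\<Sum>(n, a, x, e)\<in>interf D K S d. opn (dedges S d) \<omega> * opn (edges a x e) \<omega>"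
    have s: "?s \<ge> 0" by (intro sum_nonneg) (auto simp: opn_nonneg)
    have "opn (dedges S d) \<omega> - ?s \<le> of_bool (good D K S \<omega> d)"
    proof (cases "good D K S \<omega> d")
      case True
      moreover have "opn (dedges S d) \<omega> \<le> 1" by (simp add: opn_def)
      ultimately show ?thesis using s by simp
    next
      case ng: False
      show ?thesis
      proof (cases "dedges S d \<subseteq> Collect \<omega>")
        case True
        then obtain n a x e where e: "(n, a, x, e) \<in> interf D K S d" "edges a x e \<subseteq> Collect \<omega>"
          using ng by (auto simp: good_def)
        \<comment> \<open>One open interference already contributes 1 and cancels the indicator of
          the detour.\<close>
        have "(\<lambda>(n, a, x, e). opn (dedges S d) \<omega> * opn (edges a x e) \<omega>) (n, a, x, e) \<le> ?s"
          by (intro member_le_sum e finI) (auto simp: opn_nonneg)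
        then show ?thesis using True e ng by (simp add: opn_def)
      qed (use s in \<open>simp add: opn_def\<close>)
    qed
    then show "good_minorant K S d \<omega> \<le> of_bool (good D K S \<omega> d)"
      using True by (simp add: good_minorant_def opn_def)
  qed
  also have "\<dots> = real (card G)"
    using fin by (simp add: G_def Int_def)
  finally have "ln 2 * (\<Sum>d | detour D K S d. good_minorant K S d \<omega>) \<le> ln 2 * real (card G)"
    by (intro mult_left_mono) auto
  also note ln
  finally show ?thesis using True by (simp add: opn_def)
qed (simp add: good_minorant_def opn_def)

text \<open>The expected numbers of good detours are summed over \<open>S\<close>, lengths and
  starting times. A detour of length \<open>l\<close> fits into \<open>T\<close> steps at
  \<open>T + 1 - l\<close> starting times; truncated subtraction gives 0 if \<open>l\<close> exceeds
  \<open>T\<close>.\<close>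

lemma entropy_lower_bound:
  assumes p: "1 \<le> p" and M: "\<And>n x. 1 \<le> n \<Longrightarrow> n \<le> K \<Longrightarrow> conv_power f n x \<le> M n"
  shows "ln 2 * p ^ T * (\<Sum>l=2..K. real (T + 1 - l) * gain K M l) \<le>
    (\<integral>\<omega>. (\<Sum>S\<in>steps D T. opn (edges 0 0 S) \<omega> * ln (real (cnt D \<omega> 0 0 T (sum_list S)))) \<partial>P)"
proof -
  define B where "B l = (\<Sum>n=1..K. 4 * real (l + n) * p ^ n * M n)" for l
  have M0: "0 \<le> M n" if "1 \<le> n" "n \<le> K" for n
    using M[OF that, of 0] conv_power_nonneg[of n 0] by linarith
  have B0: "0 \<le> B l" for l unfolding B_def using M0 p by (intro sum_nonneg) auto
  define av where "av l = (\<Sum>s\<in>steps D l. wt f s * (\<Sum>g\<in>avoiding s. wt f g))" for l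
  have av0: "0 \<le> av l" for l unfolding av_def by (intro sum_nonneg mult_nonneg_nonneg wt_nonneg)
  have av_le: "av l \<le> return l" for l
  proof -
    have "av l \<le> (\<Sum>s\<in>steps D l. wt f s * conv_power f l (sum_list s))"
      unfolding av_def by (intro sum_mono mult_left_mono sum_wt_avoiding_le wt_nonneg)
    then show ?thesis by (simp add: conv_power_double return_def)
  qed
  have gain_le: "gain K M l \<le> p ^ l * av l * (1 - B l)" for l
  proof -
    have "1 * av l \<le> p ^ l * av l" using p av0 by (intro mult_right_mono) auto
    moreover have "p ^ l * av l * B l \<le> p ^ l * return l * B l"
      using p av_le B0 by (intro mult_right_mono mult_left_mono) auto
    ultimately show ?thesis
      using sum_wt_avoiding_ge[of l] unfolding gain_def av_def[symmetric] B_def[symmetric]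
      by (simp add: right_diff_distrib)
  qed
  let ?Det = "\<lambda>S. {d. detour D K S d}"
  let ?F = "\<lambda>S d \<omega>. good_minorant K S d \<omega>"
  let ?L = "\<lambda>S. SIGMA l:{2..K}. SIGMA i:{..<T + 1 - l}. avoiding (take l (drop i S))"
  have bij: "bij_betw (\<lambda>(l, i, g). (i, l, g)) (?L S) (?Det S)" if "S \<in> steps D T" for S
    using detour_iff_avoiding[OF length_steps[OF that]]
    by (intro bij_betw_byWitness[where f' = "\<lambda>(i, l, g). (l, i, g)"]) auto
  have finL: "finite (?L S)" for S by (intro finite_SigmaI) auto
  have fin: "finite (?Det S)" if "S \<in> steps D T" for S
    using bij_betw_finite[OF bij[OF that]] finL by simp
  have finI: "finite (interf D K S d)" for S d
    using sum_interf_le(1)[OF M, of K S] by (cases d) auto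
  have F_int: "integrable P (?F S d)" if "S \<in> steps D T" "detour D K S d" for S d
    using expectation_good(2)[OF that(1) _ M] that(2) by (cases d) auto
  have "ln 2 * p ^ T * (\<Sum>l=2..K. real (T + 1 - l) * gain K M l)
      \<le> ln 2 * p ^ T * (\<Sum>l=2..K. \<Sum>i<T + 1 - l. p ^ l * (1 - B l) * av l)"
  proof (intro mult_left_mono sum_mono)
    fix l
    have "real (T + 1 - l) * gain K M l \<le> real (T + 1 - l) * (p ^ l * av l * (1 - B l))"
      by (intro mult_left_mono gain_le) simp
    then show "real (T + 1 - l) * gain K M l \<le> (\<Sum>i<T + 1 - l. p ^ l * (1 - B l) * av l)"
      by (simp add: mult_ac)
  qed (use p in simp)
  also have "(\<Sum>l=2..K. \<Sum>i<T + 1 - l. p ^ l * (1 - B l) * av l)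
      = (\<Sum>l=2..K. \<Sum>i<T + 1 - l. \<Sum>S\<in>steps D T. wt f S *
          (p ^ l * (1 - B l) * (\<Sum>g\<in>avoiding (take l (drop i S)). wt f g)))"
  proof (intro sum.cong refl)
    fix l i assume "l \<in> {2..K}" "i \<in> {..<T + 1 - l}"
    then have "i + l \<le> T" by auto
    from sum_wt_slice[OF this, of "\<lambda>s. p ^ l * (1 - B l) * (\<Sum>g\<in>avoiding s. wt f g)"]
    show "p ^ l * (1 - B l) * av l = (\<Sum>S\<in>steps D T. wt f S *
          (p ^ l * (1 - B l) * (\<Sum>g\<in>avoiding (take l (drop i S)). wt f g)))"
      by (simp add: av_def sum_distrib_left mult_ac)
  qed
  also have "\<dots> = (\<Sum>S\<in>steps D T. \<Sum>l=2..K. \<Sum>i<T + 1 - l. wt f S *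
          (p ^ l * (1 - B l) * (\<Sum>g\<in>avoiding (take l (drop i S)). wt f g)))"
    by (simp only: sum.swap[of _ "steps D T"])
  also have "\<dots> = (\<Sum>S\<in>steps D T. \<Sum>(l, i, g)\<in>?L S. wt f S * (p ^ l * wt f g * (1 - B l)))"
    by (intro sum.cong refl) (simp add: sum.Sigma[symmetric] finite_SigmaI sum_distrib_left mult_ac)
  also have "\<dots> = (\<Sum>S\<in>steps D T. \<Sum>(i, l, g)\<in>?Det S. wt f S * (p ^ l * wt f g * (1 - B l)))"
  proof (rule sum.cong[OF refl])
    fix S assume "S \<in> steps D T"
    from sum.reindex_bij_betw[OF bij[OF this], of "\<lambda>(i, l, g). wt f S * (p ^ l * wt f g * (1 - B l))"]
    show "(\<Sum>(l, i, g)\<in>?L S. wt f S * (p ^ l * wt f g * (1 - B l)))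
        = (\<Sum>(i, l, g)\<in>?Det S. wt f S * (p ^ l * wt f g * (1 - B l)))"
      by (simp add: case_prod_unfold)
  qed
  also have "ln 2 * p ^ T * \<dots> = ln 2 * (\<Sum>S\<in>steps D T. \<Sum>(i, l, g)\<in>?Det S. p ^ T * wt f S * (p ^ l * wt f g * (1 - B l)))"
    by (simp add: sum_distrib_left case_prod_unfold mult_ac)
  also have "\<dots> \<le> ln 2 * (\<Sum>S\<in>steps D T. \<Sum>d\<in>?Det S. \<integral>\<omega>. ?F S d \<omega> \<partial>P)"
  proof (intro mult_left_mono sum_mono)
    fix S d assume S: "S \<in> steps D T" and d: "d \<in> ?Det S"
    show "(case d of (i, l, g) \<Rightarrow> p ^ T * wt f S * (p ^ l * wt f g * (1 - B l))) \<le> (\<integral>\<omega>. ?F S d \<omega> \<partial>P)"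
      using expectation_good(1)[OF S _ M] d by (cases d) (simp add: B_def)
  qed simp
  also have "\<dots> = (\<integral>\<omega>. (\<Sum>S\<in>steps D T. ln 2 * (\<Sum>d\<in>?Det S. ?F S d \<omega>)) \<partial>P)"
  proof -
    have "(\<integral>\<omega>. (\<Sum>S\<in>steps D T. ln 2 * (\<Sum>d\<in>?Det S. ?F S d \<omega>)) \<partial>P)
        = (\<Sum>S\<in>steps D T. \<integral>\<omega>. ln 2 * (\<Sum>d\<in>?Det S. ?F S d \<omega>) \<partial>P)"
      by (intro Bochner_Integration.integral_sum integrable_mult_right Bochner_Integration.integrable_sum F_int) auto
    also have "\<dots> = (\<Sum>S\<in>steps D T. ln 2 * (\<Sum>d\<in>?Det S. \<integral>\<omega>. ?F S d \<omega> \<partial>P))"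
    proof (rule sum.cong[OF refl])
      fix S assume S: "S \<in> steps D T"
      have "(\<integral>\<omega>. (\<Sum>d\<in>?Det S. ?F S d \<omega>) \<partial>P) = (\<Sum>d\<in>?Det S. \<integral>\<omega>. ?F S d \<omega> \<partial>P)"
        by (intro Bochner_Integration.integral_sum F_int[OF S]) simp
      then show "(\<integral>\<omega>. ln 2 * (\<Sum>d\<in>?Det S. ?F S d \<omega>) \<partial>P) = ln 2 * (\<Sum>d\<in>?Det S. \<integral>\<omega>. ?F S d \<omega> \<partial>P)"
        by (simp only: integral_mult_right_zero)
    qed
    finally show ?thesis by (simp only: sum_distrib_left)
  qed
  also have "\<dots> \<le> (\<integral>\<omega>. (\<Sum>S\<in>steps D T. opn (edges 0 0 S) \<omega> * ln (real (cnt D \<omega> 0 0 T (sum_list S)))) \<partial>P)"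
  proof (rule integral_mono)
    show "integrable P (\<lambda>\<omega>. \<Sum>S\<in>steps D T. ln 2 * (\<Sum>d\<in>?Det S. ?F S d \<omega>))"
      by (intro Bochner_Integration.integrable_sum integrable_mult_right F_int) auto
    show "integrable P (\<lambda>\<omega>. \<Sum>S\<in>steps D T. opn (edges 0 0 S) \<omega> * ln (real (cnt D \<omega> 0 0 T (sum_list S))))"
      unfolding sum_opn_cnt[where h = "\<lambda>k. ln (real k)"]
      by (intro Bochner_Integration.integrable_sum integrable_fun_cnt[OF zero_V, of "\<lambda>k. real k * ln (real k)"])
  qed (intro sum_mono good_count_le_ln_cnt fin finI)
  finally show ?thesis .
qed

text \<open>For large \<open>T\<close> the entropy is at least
  \<open>p ^ T * ln 2 * (T * g - c)\<close>, where \<open>c\<close> collects the starting times lost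
  at the end of the path. Since \<open>ln p < ln 2 * g\<close>, the linear term eventually outweighs
  this constant.\<close>

lemma growth_rate_neq_of_gain:
  assumes p: "1 \<le> p" and M: "\<And>n x. 1 \<le> n \<Longrightarrow> n \<le> K \<Longrightarrow> conv_power f n x \<le> M n"
    and less: "ln p < ln 2 * (\<Sum>l=2..K. gain K M l)"
  shows "growth_rate V f p \<noteq> ereal (ln p)"
proof -
  define g where "g = (\<Sum>l=2..K. gain K M l)"
  define c where "c = (\<Sum>l=2..K. (real l - 1) * gain K M l)"
  have \<delta>: "0 < ln 2 * g - ln p" using less by (simp add: g_def)
  obtain T0 :: nat where T0: "ln 2 * c < real T0 * (ln 2 * g - ln p)"
    using reals_Archimedean3[OF \<delta>] by blast
  \<comment> \<open>\<open>K \<le> T\<close> keeps every \<open>T + 1 - l\<close> free of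
    truncation.\<close>
  define T where "T = max T0 K"
  have "ln 2 * c < real T * (ln 2 * g - ln p)"
    using T0 by (rule less_le_trans) (use \<delta> in \<open>auto simp: T_def intro!: mult_right_mono\<close>)
  then have "real T * ln p < ln 2 * (real T * g - c)" by (simp add: algebra_simps)
  also have "real T * g - c = (\<Sum>l=2..K. real (T + 1 - l) * gain K M l)"
    unfolding g_def c_def sum_distrib_left sum_subtractf[symmetric]
    by (intro sum.cong refl) (auto simp: T_def of_nat_diff algebra_simps)
  finally have "p ^ T * (real T * ln p) < p ^ T * (ln 2 * (\<Sum>l=2..K. real (T + 1 - l) * gain K M l))"
    using p_pos by (intro mult_strict_left_mono) auto
  also have "\<dots> \<le> (\<integral>\<omega>. (\<Sum>S\<in>steps D T. opn (edges 0 0 S) \<omega> * ln (real (cnt D \<omega> 0 0 T (sum_list S)))) \<partial>P)"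
    using entropy_lower_bound[OF p M, of K T] by (simp add: mult_ac)
  finally obtain b where "b < ln p" "AE \<omega> in P. growth \<omega> \<le> ereal b"
    using entropy_criterion by blast
  then show ?thesis by (intro growth_rate_neq[of "ereal b"]) auto
qed

lemma growth_rate_neq_subcritical:
  assumes "p < 1"
  shows "growth_rate V f p \<noteq> ereal (ln p)"
  using growth_subcritical[OF assms] by (rule growth_rate_neq) simp

end

section \<open>Lower bounds on the threshold\<close>

lemma p_max_geD:
  assumes "ereal p \<le> p_max V f" "0 < p" "z \<in> V" "0 \<le> f z"
  shows "p * f z \<le> 1"
proof (cases "f z = 0")
  case False
  have "ereal p \<le> 1 / ereal (f z)"
    using assms(1,3) by (auto simp: p_max_def le_INF_iff)
  then show ?thesis using False assms(4) by (simp add: field_simps one_ereal_def)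
qed simp

lemma p_max_geI:
  assumes "\<And>z. z \<in> V \<Longrightarrow> 0 \<le> f z" "\<And>z. z \<in> V \<Longrightarrow> p * f z \<le> 1"
  shows "ereal p \<le> p_max V f"
  unfolding p_max_def
proof (rule INF_greatest)
  fix z assume z: "z \<in> V"
  show "ereal p \<le> 1 / ereal (f z)"
    using assms[OF z] by (cases "f z = 0") (simp_all add: field_simps one_ereal_def)
qed

context kernel begin

text \<open>Each \<open>p < B\<close> is kept out of the set defining the threshold. For
  \<open>1 \<le> p\<close> the two powers of \<open>p\<close> in the loss are at most
  \<open>c\<close> each, whence \<open>c\<^sup>2\<close>, and \<open>ln p \<le> p - 1\<close> brings
  in \<open>B\<close>. The bound on \<open>B * f z\<close> places \<open>B\<close> below
  \<open>p_max\<close>, which is the threshold if that set is empty.\<close>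

lemma pc2_ge:
  assumes V: "countable V" "{z. f z \<noteq> 0} \<subseteq> V" "0 \<in> V"
      "\<And>x y. x \<in> V \<Longrightarrow> y \<in> V \<Longrightarrow> x + y \<in> V"
    and M: "\<And>n x. 1 \<le> n \<Longrightarrow> n \<le> K \<Longrightarrow> conv_power f n x \<le> M n"
    and c: "1 \<le> B \<Longrightarrow> B ^ K \<le> c" and B: "\<And>z. B * f z \<le> 1"
    and le: "B \<le> 1 + ln 2 * (\<Sum>l=2..K. return l - (\<Sum>m\<in>{0<..<l}. return m * return (l - m))
      - 4 * c\<^sup>2 * return l * (\<Sum>n=1..K. real (l + n) * M n))"
  shows "ereal B \<le> pc2 V f"
proof -
  have ne: "growth_rate V f p \<noteq> ereal (ln p)"
    if p: "0 < p" "ereal p \<le> p_max V f" "p < B" for p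
  proof -
    have pf: "p * f z \<le> 1" for z
      using p_max_geD[OF p(2,1) _ nonneg, of z] V(2) by (cases "f z = 0") auto
    interpret perc f V p
      by unfold_locales (use V p pf in auto)
    show ?thesis
    proof (cases "p < 1")
      case True
      then show ?thesis by (rule growth_rate_neq_subcritical)
    next
      case False
      then have p1: "1 \<le> p" by simp
      have M0: "0 \<le> M n" if "1 \<le> n" "n \<le> K" for n
        using M[OF that, of 0] conv_power_nonneg[of n 0] by linarith
      have pn: "p ^ n \<le> c" if "n \<le> K" for n
      proof -
        have "p ^ n \<le> p ^ K" using p1 that by (rule power_increasing[rotated])
        also have "\<dots> \<le> B ^ K" using p1 p by (intro power_mono) auto
        finally show ?thesis using c p1 p by simp
      qed
      have c0: "0 \<le> c" using pn[of 0] by simp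
      have gain: "return l - (\<Sum>m\<in>{0<..<l}. return m * return (l - m))
          - 4 * c\<^sup>2 * return l * (\<Sum>n=1..K. real (l + n) * M n) \<le> gain K M l" if l: "l \<in> {2..K}" for l
      proof -
        have "p ^ l * return l * (\<Sum>n=1..K. 4 * real (l + n) * p ^ n * M n)
            \<le> c * return l * (\<Sum>n=1..K. 4 * real (l + n) * c * M n)"
        proof (rule mult_mono)
          show "p ^ l * return l \<le> c * return l"
            using l by (intro mult_right_mono pn return_nonneg) auto
          show "(\<Sum>n=1..K. 4 * real (l + n) * p ^ n * M n) \<le> (\<Sum>n=1..K. 4 * real (l + n) * c * M n)"
            using M0 by (intro sum_mono mult_right_mono mult_left_mono pn) auto
          show "0 \<le> (\<Sum>n=1..K. 4 * real (l + n) * p ^ n * M n)"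
            using M0 p by (intro sum_nonneg mult_nonneg_nonneg) auto
        qed (use c0 return_nonneg in auto)
        also have "\<dots> = 4 * c\<^sup>2 * return l * (\<Sum>n=1..K. real (l + n) * M n)"
          by (simp add: sum_distrib_left power2_eq_square mult_ac)
        finally show ?thesis by (simp add: gain_def)
      qed
      have "ln p \<le> p - 1" using p by (intro ln_le_minus_one) simp
      also have "\<dots> < B - 1" using p by simp
      also have "\<dots> \<le> ln 2 * (\<Sum>l=2..K. return l - (\<Sum>m\<in>{0<..<l}. return m * return (l - m))
          - 4 * c\<^sup>2 * return l * (\<Sum>n=1..K. real (l + n) * M n))" using le by simp
      also have "\<dots> \<le> ln 2 * (\<Sum>l=2..K. gain K M l)"
        using gain by (intro mult_left_mono sum_mono) auto
      finally have less: "ln p < ln 2 * (\<Sum>l=2..K. gain K M l)" .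
      show ?thesis by (rule growth_rate_neq_of_gain[OF p1 _ less]) (rule M)
    qed
  qed
  have "ereal B \<le> p_max V f" by (intro p_max_geI nonneg B)
  moreover have "ereal B \<le> (INF p\<in>{p. 0 < p \<and> ereal p \<le> p_max V f \<and> growth_rate V f p = ereal (ln p)}. ereal p)"
  proof (rule INF_greatest)
    fix p assume "p \<in> {p. 0 < p \<and> ereal p \<le> p_max V f \<and> growth_rate V f p = ereal (ln p)}"
    with ne[of p] show "ereal B \<le> ereal p" by fastforce
  qed
  ultimately show ?thesis unfolding pc2_def Let_def by simp
qed

end

lemma pc2_cong:
  assumes "\<And>z. z \<in> V \<Longrightarrow> f z = g z" "\<And>x y. x \<in> V \<Longrightarrow> y \<in> V \<Longrightarrow> x - y \<in> V"
  shows "pc2 V f = pc2 V g"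
proof -
  have "perc_measure V f p = perc_measure V g p" for p
    unfolding perc_measure_def
    by (intro arg_cong[where f = completion] PiM_cong refl) (auto simp: assms)
  then have "growth_rate V f p = growth_rate V g p" for p
    by (simp only: growth_rate_def percolation_event_def)
  moreover have "p_max V f = p_max V g"
    unfolding p_max_def by (intro INF_cong refl) (simp add: assms)
  ultimately show ?thesis by (simp only: pc2_def)
qed

section \<open>The nearest-neighbour model\<close>

definition unit_vec :: "nat \<Rightarrow> nat \<Rightarrow> int" where
  "unit_vec i = (\<lambda>j. if j = i then 1 else 0)"

definition nn_set :: "nat \<Rightarrow> (nat \<Rightarrow> int) set" where
  "nn_set d = unit_vec ` {..<d} \<union> (\<lambda>i. - unit_vec i) ` {..<d}"

lemma unit_vec_apply: "unit_vec i j = (if j = i then 1 else 0)"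
  by (simp add: unit_vec_def)

lemma unit_vec_eq_iff [simp]: "unit_vec i = unit_vec j \<longleftrightarrow> i = j"
  by (metis unit_vec_apply zero_neq_one)

lemma unit_vec_neq_minus [simp]: "unit_vec i \<noteq> - unit_vec j"
proof
  assume "unit_vec i = - unit_vec j"
  from fun_cong[OF this, of i] show False
    by (simp add: fun_Compl_def unit_vec_apply split: if_splits)
qed

lemma finite_nn_set [simp]: "finite (nn_set d)"
  by (simp add: nn_set_def)

lemma card_nn_set: "card (nn_set d) = 2 * d"
proof -
  have "unit_vec ` {..<d} \<inter> (\<lambda>i. - unit_vec i) ` {..<d} = {}" by auto
  then have "card (nn_set d) = card (unit_vec ` {..<d}) + card ((\<lambda>i. - unit_vec i) ` {..<d})"
    unfolding nn_set_def by (intro card_Un_disjoint) auto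
  also have "card (unit_vec ` {..<d}) = d" by (simp add: card_image inj_on_def)
  also have "card ((\<lambda>i. - unit_vec i) ` {..<d}) = d" by (simp add: card_image inj_on_def)
  finally show ?thesis by simp
qed

lemma uminus_nn_set: "- z \<in> nn_set d \<longleftrightarrow> z \<in> nn_set d"
  by (auto simp: nn_set_def image_iff) (metis lessThan_iff minus_minus)+

lemma nn_set_iff: "z \<in> nn_set d \<longleftrightarrow> z \<in> Zd d \<and> (\<Sum>i<d. \<bar>z i\<bar>) = 1"
proof
  assume "z \<in> nn_set d"
  then obtain i where i: "i < d" "z = unit_vec i \<or> z = - unit_vec i" by (auto simp: nn_set_def)
  then have "\<bar>z j\<bar> = (if j = i then 1 else 0)" for j
    by (auto simp: unit_vec_apply fun_Compl_def)
  then show "z \<in> Zd d \<and> (\<Sum>i<d. \<bar>z i\<bar>) = 1"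
    using i(1) by (auto simp: Zd_def) (metis abs_eq_0 not_le)
next
  assume z: "z \<in> Zd d \<and> (\<Sum>i<d. \<bar>z i\<bar>) = 1"
  then have "\<exists>i<d. z i \<noteq> 0" by (metis abs_zero lessThan_iff sum.neutral zero_neq_one)
  then obtain i where i: "i < d" "z i \<noteq> 0" by auto
  have "(\<Sum>j<d. \<bar>z j\<bar>) = \<bar>z i\<bar> + (\<Sum>j\<in>{..<d} - {i}. \<bar>z j\<bar>)"
    using i by (simp add: sum.remove)
  moreover have "(\<Sum>j\<in>{..<d} - {i}. \<bar>z j\<bar>) \<ge> 0" by (simp add: sum_nonneg)
  ultimately have zi: "\<bar>z i\<bar> = 1" and s0: "(\<Sum>j\<in>{..<d} - {i}. \<bar>z j\<bar>) = 0" using z i by linarith+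
  from s0 have "z j = 0" if "j < d" "j \<noteq> i" for j
    using that by (subst (asm) sum_nonneg_eq_0_iff) auto
  moreover have "z j = 0" if "j \<ge> d" for j using z that by (simp add: Zd_def)
  ultimately have zj: "z j = 0" if "j \<noteq> i" for j using that by (meson not_le)
  from zi have "z i = 1 \<or> z i = - 1" by linarith
  then have "z = unit_vec i \<or> z = - unit_vec i"
    using zj by (auto simp: fun_eq_iff unit_vec_apply fun_Compl_def)
  then show "z \<in> nn_set d" using i by (auto simp: nn_set_def)
qed

text \<open>
  As a function on \<open>nat \<Rightarrow> int\<close>, \<open>nn_kernel d\<close> ignores the coordinates beyond \<open>d\<close> and has infinite
  support; \<open>nn d\<close> is its restriction to \<open>Zd d\<close>.
\<close>

definition nn :: "nat \<Rightarrow> (nat \<Rightarrow> int) \<Rightarrow> real" where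
  "nn d z = (if z \<in> nn_set d then 1 / (2 * real d) else 0)"

lemma kernel_nn: "1 \<le> d \<Longrightarrow> kernel (nn d)"
proof
  assume d: "1 \<le> d"
  then have supp: "{z. nn d z \<noteq> 0} = nn_set d" by (auto simp: nn_def)
  show "finite {z. nn d z \<noteq> 0}" by (simp add: supp)
  have "(\<Sum>z\<in>nn_set d. nn d z) = (\<Sum>z\<in>nn_set d. 1 / (2 * real d))"
    by (intro sum.cong refl) (simp add: nn_def)
  then show "(\<Sum>z | nn d z \<noteq> 0. nn d z) = 1"
    using d by (simp add: supp card_nn_set)
qed (auto simp: nn_def uminus_nn_set)

text \<open>\<open>N x\<close> counts the ways to write \<open>x\<close> as a sum of two unit steps,
  so \<open>return 2\<close> is the sum of \<open>N (a + b)\<close> over pairs of steps, divided by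
  \<open>(2 * d) ^ 4\<close>. At 0 it is \<open>2 * d\<close>; elsewhere it is at most 4, and the
  two orders of the pair give at least 2, or 1 if \<open>a = b\<close>.\<close>

lemma nn_return_bounds:
  assumes d: "1 \<le> d"
  shows "kernel.return (nn d) 1 = 1 / (2 * real d)"
    and "(12 * (real d)\<^sup>2 - 6 * real d) / (16 * real d ^ 4) \<le> kernel.return (nn d) 2"
    and "kernel.return (nn d) 2 \<le> 5 / (4 * (real d)\<^sup>2)"
proof -
  interpret kernel "nn d" by (rule kernel_nn[OF d])
  have D: "D = nn_set d" unfolding D_def using d by (auto simp: nn_def)
  define N where "N x = real (card {y \<in> nn_set d. x - y \<in> nn_set d})" for x
  have d0: "real d > 0" using d by simp
  have c1: "conv_power (nn d) 1 x = nn d x" for x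
    by (rule conv_power_1_on[OF finite_D]) (simp add: D_def)
  have c2: "conv_power (nn d) 2 x = N x / (2 * real d)\<^sup>2" for x
  proof -
    have "conv_power (nn d) (Suc 1) x = (\<Sum>y\<in>nn_set d. nn d y * nn d (x - y))"
      by (simp only: conv_power_Suc c1 D)
    also have "\<dots> = (\<Sum>y\<in>nn_set d. if x - y \<in> nn_set d then 1 / (2 * real d)\<^sup>2 else 0)"
      by (intro sum.cong refl) (simp add: nn_def power2_eq_square)
    also have "\<dots> = N x / (2 * real d)\<^sup>2"
      by (simp add: sum.inter_filter[symmetric] N_def)
    finally show ?thesis by (simp add: numeral_2_eq_2)
  qed
  have N0: "N 0 = 2 * real d"
    by (simp add: N_def uminus_nn_set card_nn_set)
  show "return 1 = 1 / (2 * real d)"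
    using d0 by (simp add: return_def c2 N0 power2_eq_square)
  have "return 2 = (\<Sum>s\<in>steps (nn_set d) (1 + 1). wt (nn d) s * conv_power (nn d) 2 (sum_list s))"
    using conv_power_double[of 2] unfolding one_add_one by (simp add: return_def D)
  also have "\<dots> = (\<Sum>a\<in>nn_set d. \<Sum>b\<in>nn_set d. nn d a * nn d b * conv_power (nn d) 2 (a + b))"
    by (simp only: sum_steps_append[OF finite_nn_set] sum_steps_1) simp
  also have "\<dots> = (\<Sum>a\<in>nn_set d. \<Sum>b\<in>nn_set d. N (a + b)) / (16 * real d ^ 4)"
    by (simp add: nn_def c2 sum_divide_distrib power2_eq_square power4_eq_xxxx mult.assoc)
  finally have r2: "return 2 = (\<Sum>a\<in>nn_set d. \<Sum>b\<in>nn_set d. N (a + b)) / (16 * real d ^ 4)" .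
  have lower: "12 * (real d)\<^sup>2 - 6 * real d \<le> (\<Sum>a\<in>nn_set d. \<Sum>b\<in>nn_set d. N (a + b))"
  proof -
    \<comment> \<open>Over the \<open>2 * d\<close> values of \<open>b\<close> the left side sums to
      \<open>4 * d + (2 * d - 2) - 1 = 6 * d - 3\<close>.\<close>
    have "(\<Sum>b\<in>nn_set d. 2 + (if b = - a then 2 * real d - 2 else 0) - (if b = a then 1 else 0))
        \<le> (\<Sum>b\<in>nn_set d. N (a + b))" if a: "a \<in> nn_set d" for a
    proof (rule sum_mono)
      fix b assume b: "b \<in> nn_set d"
      have "a \<noteq> - a"
      proof
        assume "a = - a"
        with a obtain i where "unit_vec i = - unit_vec i"
          by (auto simp: nn_set_def simp del: unit_vec_neq_minus)
        then show False by simp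
      qed
      show "2 + (if b = - a then 2 * real d - 2 else 0) - (if b = a then 1 else 0) \<le> N (a + b)"
      proof (cases "b = - a")
        case True
        then show ?thesis using N0 \<open>a \<noteq> - a\<close> by auto
      next
        case False
        have "card {a, b} \<le> card {y \<in> nn_set d. a + b - y \<in> nn_set d}"
          using a b by (intro card_mono) auto
        then have "real (card {a, b}) \<le> N (a + b)" by (simp add: N_def)
        then show ?thesis using False by (auto simp: card_insert_if split: if_splits)
      qed
    qed
    then have "(\<Sum>a\<in>nn_set d. \<Sum>b\<in>nn_set d. 2 + (if b = - a then 2 * real d - 2 else 0) - (if b = a then 1 else 0))
        \<le> (\<Sum>a\<in>nn_set d. \<Sum>b\<in>nn_set d. N (a + b))"
      by (rule sum_mono)
    also have "(\<Sum>a\<in>nn_set d. \<Sum>b\<in>nn_set d. 2 + (if b = - a then 2 * real d - 2 else 0) - (if b = a then 1 else 0))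
        = (\<Sum>a\<in>nn_set d. 6 * real d - 3)"
      by (intro sum.cong refl) (simp add: sum.distrib sum_subtractf card_nn_set uminus_nn_set)
    also have "(\<Sum>a\<in>nn_set d. 6 * real d - 3) = 12 * (real d)\<^sup>2 - 6 * real d"
      by (simp add: card_nn_set power2_eq_square algebra_simps)
    finally show ?thesis .
  qed
  show "(12 * (real d)\<^sup>2 - 6 * real d) / (16 * real d ^ 4) \<le> return 2"
    unfolding r2 by (intro divide_right_mono lower) simp
  have "(\<Sum>a\<in>nn_set d. \<Sum>b\<in>nn_set d. N (a + b)) \<le> 20 * (real d)\<^sup>2"
  proof -
    have N4: "N x \<le> 4" if nz: "x \<noteq> 0" for x
    proof -
      have "\<exists>i. x i \<noteq> 0" using nz by (auto simp: fun_eq_iff)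
      then obtain i where i: "x i \<noteq> 0" by auto
      \<comment> \<open>At least one of \<open>y\<close> and \<open>x - y\<close> has a nonzero
        coordinate \<open>i\<close>, and only the two unit steps along this axis do.\<close>
      have "{y \<in> nn_set d. x - y \<in> nn_set d} \<subseteq> {unit_vec i, - unit_vec i, x - unit_vec i, x + unit_vec i}"
      proof
        fix y assume y: "y \<in> {y \<in> nn_set d. x - y \<in> nn_set d}"
        have nz: "z \<in> {unit_vec i, - unit_vec i}" if "z \<in> nn_set d" "z i \<noteq> 0" for z
          using that by (auto simp: nn_set_def unit_vec_apply fun_Compl_def split: if_splits)
        have "y i \<noteq> 0 \<or> (x - y) i \<noteq> 0" using i by auto
        then have "y \<in> {unit_vec i, - unit_vec i} \<or> x - y \<in> {unit_vec i, - unit_vec i}"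
          using nz y by blast
        then show "y \<in> {unit_vec i, - unit_vec i, x - unit_vec i, x + unit_vec i}"
          by (auto simp: algebra_simps)
      qed
      then have "card {y \<in> nn_set d. x - y \<in> nn_set d} \<le> card {unit_vec i, - unit_vec i, x - unit_vec i, x + unit_vec i}"
        by (intro card_mono) auto
      also have "\<dots> \<le> 4" by (simp add: card_insert_if)
      finally show ?thesis by (simp add: N_def)
    qed
    have "(\<Sum>b\<in>nn_set d. N (a + b)) \<le> (\<Sum>b\<in>nn_set d. 4 + (if b = - a then 2 * real d else 0))" for a
    proof (rule sum_mono)
      fix b
      show "N (a + b) \<le> 4 + (if b = - a then 2 * real d else 0)"
        using N4[of "a + b"] N0 by (auto simp: add_eq_0_iff)
    qed
    then have "(\<Sum>a\<in>nn_set d. \<Sum>b\<in>nn_set d. N (a + b)) \<le> (\<Sum>a\<in>nn_set d. \<Sum>b\<in>nn_set d. 4 + (if b = - a then 2 * real d else 0))"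
      by (rule sum_mono)
    also have "\<dots> = (\<Sum>a\<in>nn_set d. 10 * real d)"
      by (intro sum.cong refl) (simp add: sum.distrib card_nn_set uminus_nn_set)
    also have "\<dots> = 20 * (real d)\<^sup>2"
      by (simp add: card_nn_set power2_eq_square)
    finally show ?thesis .
  qed
  then have "return 2 \<le> 20 * (real d)\<^sup>2 / (16 * real d ^ 4)"
    unfolding r2 by (intro divide_right_mono) auto
  also have "\<dots> = 5 / (4 * (real d)\<^sup>2)"
    using d0 by (simp add: power2_eq_square power4_eq_xxxx)
  finally show "return 2 \<le> 5 / (4 * (real d)\<^sup>2)" .
qed

lemma countable_Zd: "countable (Zd d)"
proof -
  have "Zd d \<subseteq> (\<lambda>l i. if i < length l then l ! i else 0) ` (UNIV :: int list set)"
  proof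
    fix z assume "z \<in> Zd d"
    then have "z = (\<lambda>l i. if i < length l then l ! i else 0) (map z [0..<d])"
      by (auto simp: Zd_def fun_eq_iff)
    then show "z \<in> (\<lambda>l i. if i < length l then l ! i else 0) ` UNIV" by blast
  qed
  then show ?thesis by (rule countable_subset) auto
qed

text \<open>Only detours of length 2 are used; \<open>B \<le> 2\<close> allows \<open>c = 4\<close>.
  The leading coefficient is \<open>12 / 16 - 1 / 4 = 1 / 2\<close>. At order
  \<open>1 / d ^ 3\<close> the lower bound on \<open>return 2\<close> loses \<open>6 / 16\<close>,
  and interferences lose \<open>64 * (5 / 4) * (7 / 2) = 280\<close>, where
  \<open>7 = (2 + 1) + (2 + 2)\<close>; 281 bounds the total.\<close>

lemma pc2_nn_ge:
  assumes d: "1 \<le> d" and \<epsilon>: "0 < \<epsilon>" "281 * ln 2 \<le> \<epsilon> * real d"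
  shows "ereal (1 + ln 2 / (2 * (real d)\<^sup>2) - \<epsilon> / (real d)\<^sup>2) \<le> pc2 (Zd d) (nn_kernel d)"
proof -
  interpret kernel "nn d" by (rule kernel_nn[OF d])
  let ?B = "1 + ln 2 / (2 * (real d)\<^sup>2) - \<epsilon> / (real d)\<^sup>2"
  have d0: "real d \<ge> 1" using d by simp
  have M1: "conv_power (nn d) n x \<le> 1 / (2 * real d)" if "1 \<le> n" for n x
  proof -
    have "conv_power (nn d) 1 y \<le> 1 / (2 * real d)" for y
      by (subst conv_power_1_on[OF finite_D]) (simp_all add: D_def nn_def)
    from conv_power_le[of 1, OF this, of "n - 1" x] that show ?thesis by simp
  qed
  have "ln 2 / (2 * (real d)\<^sup>2) \<le> 1 / 1"
    using d0 ln_2_less_1 by (intro frac_le) (auto simp: power2_eq_square mult_ge1_I intro: order.trans[of _ "2 * 1"])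
  moreover have "0 \<le> \<epsilon> / (real d)\<^sup>2" using \<epsilon> by simp
  ultimately have B2: "?B \<le> 2" by simp
  have "ereal ?B \<le> pc2 (Zd d) (nn d)"
  proof (rule pc2_ge[where K = 2 and c = 4 and M = "\<lambda>_. 1 / (2 * real d)"])
    show "countable (Zd d)" by (rule countable_Zd)
    show "{z. nn d z \<noteq> 0} \<subseteq> Zd d" by (auto simp: nn_def nn_set_iff)
    show "?B ^ 2 \<le> 4" if "1 \<le> ?B"
      using power_mono[OF B2, of 2] that by simp
    show "?B * nn d z \<le> 1" for z
    proof -
      have "?B * nn d z \<le> 2 * nn d z" using B2 nonneg by (intro mult_right_mono)
      also have "\<dots> \<le> 1" using d0 by (simp add: nn_def)
      finally show ?thesis .
    qed
    have "{0<..<2::nat} = {1}" by auto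
    then have "(\<Sum>l=2..2. return l - (\<Sum>m\<in>{0<..<l}. return m * return (l - m))
        - 4 * 4\<^sup>2 * return l * (\<Sum>n=1..2. real (l + n) * (1 / (2 * real d))))
      = return 2 - return 1 * return 1 - 64 * return 2 * (7 / (2 * real d))"
      by (simp add: numeral_2_eq_2 field_simps)
    also have "\<dots> \<ge> (12 * (real d)\<^sup>2 - 6 * real d) / (16 * real d ^ 4) - 1 / (2 * real d) * (1 / (2 * real d))
        - 64 * (5 / (4 * (real d)\<^sup>2)) * (7 / (2 * real d))"
      unfolding nn_return_bounds(1)[OF d]
      using nn_return_bounds(2,3)[OF d] d0
      by (intro diff_mono mult_right_mono mult_left_mono) auto
    also have "(12 * (real d)\<^sup>2 - 6 * real d) / (16 * real d ^ 4) - 1 / (2 * real d) * (1 / (2 * real d))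
        - 64 * (5 / (4 * (real d)\<^sup>2)) * (7 / (2 * real d)) = 1 / (2 * (real d)\<^sup>2) - (280 + 3 / 8) / real d ^ 3"
      using d0 by (simp add: field_simps power2_eq_square power3_eq_cube power4_eq_xxxx)
    finally have "ln 2 * (1 / (2 * (real d)\<^sup>2) - (280 + 3 / 8) / real d ^ 3) \<le> ln 2 * (\<Sum>l=2..2. return l - (\<Sum>m\<in>{0<..<l}. return m * return (l - m))
        - 4 * 4\<^sup>2 * return l * (\<Sum>n=1..2. real (l + n) * (1 / (2 * real d))))"
      by (intro mult_left_mono) auto
    moreover have "ln 2 * ((280 + 3 / 8) / real d ^ 3) \<le> \<epsilon> / (real d)\<^sup>2"
    proof -
      have "ln 2 * ((280 + 3 / 8) / real d ^ 3) \<le> 281 * ln 2 / real d ^ 3"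
        using d0 by (simp add: field_simps)
      also have "\<dots> \<le> \<epsilon> * real d / real d ^ 3" using \<epsilon> d0 by (intro divide_right_mono) auto
      also have "\<dots> = \<epsilon> / (real d)\<^sup>2" using d0 by (simp add: power2_eq_square power3_eq_cube)
      finally show ?thesis .
    qed
    ultimately show "?B \<le> 1 + ln 2 * (\<Sum>l=2..2. return l - (\<Sum>m\<in>{0<..<l}. return m * return (l - m))
        - 4 * 4\<^sup>2 * return l * (\<Sum>n=1..2. real (l + n) * (1 / (2 * real d))))"
      by (simp add: right_diff_distrib)
  qed (use M1 in \<open>auto simp: Zd_def\<close>)
  also have "pc2 (Zd d) (nn d) = pc2 (Zd d) (nn_kernel d)"
    by (rule pc2_cong) (auto simp: nn_def nn_set_iff nn_kernel_def, auto simp: Zd_def)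
  finally show ?thesis .
qed

lemma eventually_pc2_nn_ge:
  assumes "0 < \<epsilon>"
  shows "\<forall>\<^sub>F d in sequentially.
    ereal (1 + ln 2 / (2 * (real d)\<^sup>2) - \<epsilon> / (real d)\<^sup>2) \<le> pc2 (Zd d) (nn_kernel d)"
  using eventually_ge_at_top[of "max 1 (nat \<lceil>281 * ln 2 / \<epsilon>\<rceil>)"]
proof eventually_elim
  case (elim d)
  then have "281 * ln 2 / \<epsilon> \<le> real d" by linarith
  then have "281 * ln 2 \<le> \<epsilon> * real d" using assms by (simp add: field_simps)
  with elim show ?case by (intro pc2_nn_ge assms) auto
qed

section \<open>Decay of convolution powers\<close>

lemma conv_on_commute: "conv_on S f (conv_on S u h) = conv_on S u (conv_on S f h)"
proof
  fix x
  have "conv_on S f (conv_on S u h) x = (\<Sum>y\<in>S. \<Sum>z\<in>S. f y * u z * h (x - y - z))"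
    by (simp add: conv_on_def sum_distrib_left mult.assoc)
  also have "\<dots> = (\<Sum>z\<in>S. \<Sum>y\<in>S. f y * u z * h (x - y - z))" by (rule sum.swap)
  also have "\<dots> = (\<Sum>z\<in>S. \<Sum>y\<in>S. u z * (f y * h (x - z - y)))"
    by (intro sum.cong refl) (simp add: algebra_simps)
  finally show "conv_on S f (conv_on S u h) x = conv_on S u (conv_on S f h) x"
    by (simp add: conv_on_def sum_distrib_left)
qed

lemma conv_on_funpow_commute: "(conv_on S u ^^ j) (conv_on S f h) = conv_on S f ((conv_on S u ^^ j) h)"
  by (induction j) (simp_all add: conv_on_commute)

lemma conv_on_le:
  assumes "\<And>y. y \<in> S \<Longrightarrow> 0 \<le> f y" "\<And>x. h x \<le> B"
  shows "conv_on S f h x \<le> sum f S * B"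
  unfolding conv_on_def sum_distrib_right by (intro sum_mono mult_left_mono assms)

section \<open>Binomial mixtures of decay bounds\<close>

lemma sum_binomial_Suc:
  fixes h :: "nat \<Rightarrow> real"
  shows "(\<Sum>k\<le>Suc n. real (Suc n choose k) * h k) = (\<Sum>k\<le>n. real (n choose k) * (h k + h (Suc k)))"
proof -
  have 1: "(\<Sum>k\<le>Suc n. real (Suc n choose k) * h k)
      = h 0 + (\<Sum>k\<le>n. real (n choose k) * h (Suc k)) + (\<Sum>k\<le>n. real (n choose Suc k) * h (Suc k))"
    by (simp add: sum.atMost_Suc_shift distrib_right sum.distrib del: sum.atMost_Suc)
  have "h 0 + (\<Sum>k\<le>n. real (n choose Suc k) * h (Suc k)) = (\<Sum>k\<le>Suc n. real (n choose k) * h k)"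
    by (simp add: sum.atMost_Suc_shift del: sum.atMost_Suc)
  then have "h 0 + (\<Sum>k\<le>n. real (n choose Suc k) * h (Suc k)) = (\<Sum>k\<le>n. real (n choose k) * h k)"
    by simp
  with 1 show ?thesis by (simp add: distrib_left sum.distrib)
qed

text \<open>Expectation of \<open>A\<close> at a binomial random variable with \<open>n\<close>
  trials and success probability \<alpha>.\<close>

definition binomial_mean :: "real \<Rightarrow> nat \<Rightarrow> (nat \<Rightarrow> real) \<Rightarrow> real" where
  "binomial_mean \<alpha> n A = (\<Sum>k\<le>n. real (n choose k) * (\<alpha> ^ k * (1 - \<alpha>) ^ (n - k) * A k))"

lemma binomial_mean_Suc:
  "binomial_mean \<alpha> (Suc n) A = \<alpha> * binomial_mean \<alpha> n (\<lambda>k. A (Suc k)) + (1 - \<alpha>) * binomial_mean \<alpha> n A"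
proof -
  have "binomial_mean \<alpha> (Suc n) A = (\<Sum>k\<le>n. real (n choose k) * (\<alpha> ^ k * (1 - \<alpha>) ^ (Suc n - k) * A k
      + \<alpha> ^ Suc k * (1 - \<alpha>) ^ (n - k) * A (Suc k)))"
    unfolding binomial_mean_def by (subst sum_binomial_Suc) simp
  also have "\<dots> = (\<Sum>k\<le>n. \<alpha> * (real (n choose k) * (\<alpha> ^ k * (1 - \<alpha>) ^ (n - k) * A (Suc k)))
      + (1 - \<alpha>) * (real (n choose k) * (\<alpha> ^ k * (1 - \<alpha>) ^ (n - k) * A k)))"
    by (intro sum.cong refl) (simp add: Suc_diff_le algebra_simps)
  finally show ?thesis by (simp add: binomial_mean_def sum.distrib sum_distrib_left)
qed

text \<open>
  Each step with law \<open>f\<close> is a step with law \<open>u\<close> with probability \<open>\<alpha>\<close>; given that \<open>k\<close> steps are of this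
  kind, the bound \<open>A k\<close> applies.
\<close>

lemma conv_power_le_binomial_mean:
  assumes S: "finite S" and f: "{z. f z \<noteq> 0} \<subseteq> S" "sum f S = 1"
    and u: "{z. u z \<noteq> 0} \<subseteq> S" "\<And>z. 0 \<le> u z" "sum u S = 1"
    and \<alpha>: "0 \<le> \<alpha>" "\<And>z. \<alpha> * u z \<le> f z"
    and A: "\<And>x. f x \<le> A 0" "\<And>j x. 1 \<le> j \<Longrightarrow> conv_power u j x \<le> A j"
  shows "conv_power f (Suc n) x \<le> binomial_mean \<alpha> n A"
proof -
  have f0: "0 \<le> f z" for z using \<alpha>(1) u(2)[of z] \<alpha>(2)[of z] by (meson mult_nonneg_nonneg order.trans)
  have up: "conv_power u j = (conv_on S u ^^ j) (conv_power u 0)" for j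
    by (induction j) (simp_all add: conv_power_Suc_on[OF S u(1)] del: conv_power.simps)
  \<comment> \<open>The claim is generalised to \<open>j\<close> steps of law \<open>u\<close>
    already taken: decomposing one more step either increases \<open>j\<close> or leaves it
    unchanged, which matches \<open>binomial_mean_Suc\<close>.\<close>
  have "(conv_on S u ^^ j) (conv_power f (Suc n)) x \<le> binomial_mean \<alpha> n (\<lambda>k. A (j + k))" for j
  proof (induction n arbitrary: j x)
    \<comment> \<open>One of the \<open>Suc n\<close> steps is left undecomposed. It serves the case
      without any step of law \<open>u\<close>, where \<open>conv_power u 0\<close> is a point mass
      and gives no decay; this is why \<open>A 0\<close> bounds \<open>f\<close> itself.\<close>
    case 0
    show ?case
    proof (cases "j = 0")
      case True
      then show ?thesis using A(1)[of x] conv_power_1_on[OF S f(1), of x] by (simp add: binomial_mean_def)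
    next
      case False
      have z: "conv_power f 0 = conv_power u 0" by (simp add: fun_eq_iff)
      have "(conv_on S u ^^ j) (conv_power f (Suc 0)) x = conv_on S f (conv_power u j) x"
        by (simp only: conv_power_Suc_on[OF S f(1)] z conv_on_funpow_commute up[of j])
      also have "\<dots> \<le> sum f S * A j"
      proof (rule conv_on_le)
        show "conv_power u j y \<le> A j" for y using False by (intro A(2)) simp
      qed (rule f0)
      finally show ?thesis using f by (simp add: binomial_mean_def)
    qed
  next
    case (Suc n)
    let ?h = "(conv_on S u ^^ j) (conv_power f (Suc n))"
    let ?B = "binomial_mean \<alpha> n (\<lambda>k. A (j + k))"
    have "(conv_on S u ^^ j) (conv_power f (Suc (Suc n))) x = conv_on S f ?h x"
      by (simp only: conv_power_Suc_on[OF S f(1), of "Suc n"] conv_on_funpow_commute)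
    also have "\<dots> = \<alpha> * conv_on S u ?h x + conv_on S (\<lambda>y. f y - \<alpha> * u y) ?h x"
      by (simp add: conv_on_def sum_distrib_left sum.distrib[symmetric] algebra_simps)
    also have "conv_on S (\<lambda>y. f y - \<alpha> * u y) ?h x \<le> (\<Sum>y\<in>S. f y - \<alpha> * u y) * ?B"
      using \<alpha>(2) Suc.IH by (intro conv_on_le) auto
    also have "(\<Sum>y\<in>S. f y - \<alpha> * u y) = 1 - \<alpha>"
      using f u by (simp add: sum_subtractf sum_distrib_left[symmetric])
    also have "conv_on S u ?h x = (conv_on S u ^^ Suc j) (conv_power f (Suc n)) x" by simp
    also have "\<dots> \<le> binomial_mean \<alpha> n (\<lambda>k. A (Suc j + k))" by (rule Suc.IH)
    finally show ?case
      using \<alpha>(1) by (simp add: binomial_mean_Suc mult_left_mono)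
  qed
  from this[of 0] show ?thesis by simp
qed

lemma binomial_mean_mono:
  assumes "0 \<le> \<alpha>" "\<alpha> \<le> 1" "\<And>k. A k \<le> A' k"
  shows "binomial_mean \<alpha> n A \<le> binomial_mean \<alpha> n A'"
  unfolding binomial_mean_def using assms by (intro sum_mono mult_left_mono) auto

lemma binomial_mean_const: "binomial_mean \<alpha> n (\<lambda>_. c) = c"
proof (induction n)
  case (Suc n)
  then show ?case by (simp add: binomial_mean_Suc algebra_simps)
qed (simp add: binomial_mean_def)

lemma binomial_mean_add:
  "binomial_mean \<alpha> n (\<lambda>k. a * A k + B k) = a * binomial_mean \<alpha> n A + binomial_mean \<alpha> n B"
  by (simp add: binomial_mean_def algebra_simps sum.distrib sum_distrib_left)

text \<open>Absorbing twice turns \<open>(n choose k) / ((k + 1) * (k + 2))\<close> into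
  \<open>(n + 2 choose k + 2) / ((n + 1) * (n + 2))\<close>. What remains is part of the binomial
  expansion of \<open>(\<alpha> + (1 - \<alpha>)) ^ (n + 2)\<close>.\<close>

lemma binomial_mean_inverse_square:
  assumes "0 < \<alpha>" "\<alpha> \<le> 1"
  shows "binomial_mean \<alpha> n (\<lambda>k. 1 / ((real k + 1) * (real k + 2))) \<le> 1 / (\<alpha>\<^sup>2 * (real n + 1) * (real n + 2))"
proof -
  have ch: "real (n choose k) / ((real k + 1) * (real k + 2)) = real (Suc (Suc n) choose Suc (Suc k)) / ((real n + 1) * (real n + 2))" for k
  proof -
    have "Suc k * (Suc n choose Suc k) = Suc n * (n choose k)"
      "Suc (Suc k) * (Suc (Suc n) choose Suc (Suc k)) = Suc (Suc n) * (Suc n choose Suc k)"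
      by (simp_all only: Suc_times_binomial_eq Suc_times_binomial)
    then have "(real k + 1) * real (Suc n choose Suc k) = (real n + 1) * real (n choose k)"
      "(real k + 2) * real (Suc (Suc n) choose Suc (Suc k)) = (real n + 2) * real (Suc n choose Suc k)"
      by (simp_all flip: of_nat_eq_iff[where 'a = real] add: algebra_simps del: binomial_Suc_Suc)
    then show ?thesis by (simp add: divide_simps del: binomial_Suc_Suc) algebra
  qed
  let ?t = "\<lambda>k. real (Suc (Suc n) choose k) * (\<alpha> ^ k * (1 - \<alpha>) ^ (Suc (Suc n) - k))"
  have "binomial_mean \<alpha> n (\<lambda>k. 1 / ((real k + 1) * (real k + 2)))
      = (\<Sum>k\<le>n. real (n choose k) / ((real k + 1) * (real k + 2)) * (\<alpha> ^ k * (1 - \<alpha>) ^ (n - k)))"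
    by (simp add: binomial_mean_def)
  also have "\<dots> = (\<Sum>k\<le>n. ?t (Suc (Suc k))) / (\<alpha>\<^sup>2 * (real n + 1) * (real n + 2))"
    unfolding ch sum_divide_distrib using assms
    by (intro sum.cong refl) (simp add: divide_simps power2_eq_square del: binomial_Suc_Suc)
  also have "(\<Sum>k\<le>n. ?t (Suc (Suc k))) \<le> (\<Sum>k\<le>Suc (Suc n). ?t k)"
  proof -
    have "(\<Sum>k\<le>n. ?t (Suc (Suc k))) = (\<Sum>k\<in>(\<lambda>k. Suc (Suc k)) ` {..n}. ?t k)"
      by (subst sum.reindex) (auto simp: inj_on_def)
    also have "\<dots> \<le> (\<Sum>k\<le>Suc (Suc n). ?t k)"
      using assms by (intro sum_mono2) auto
    finally show ?thesis .
  qed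
  also have "(\<Sum>k\<le>Suc (Suc n). ?t k) = (\<alpha> + (1 - \<alpha>)) ^ Suc (Suc n)"
    by (subst binomial_ring) (simp add: mult.assoc del: binomial_Suc_Suc sum.atMost_Suc)
  finally show ?thesis using assms by (simp add: divide_right_mono)
qed

lemma powr_m32: "0 \<le> (x::real) \<Longrightarrow> x powr (- 3 / 2) = 1 / (x * sqrt x)"
  by (cases "x = 0") (simp_all add: powr_minus_divide powr_add[of x 1 "1/2", simplified] powr_half_sqrt)

text \<open>
  Young's inequality reduces the exponent \<open>3 / 2\<close> to the exponent \<open>2\<close>, for which the
  binomial mean has a closed form.
\<close>

lemma binomial_mean_m32:
  assumes "0 < \<alpha>" "\<alpha> \<le> 1"
  shows "binomial_mean \<alpha> n (\<lambda>k. real (Suc k) powr (- 3 / 2)) \<le> (3 / (2 * \<alpha>\<^sup>2) + 1 / 4) * real (Suc n) powr (- 3 / 2)"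
proof -
  define m where "m = real (Suc n)"
  have m: "m > 0" by (simp add: m_def)
  have le: "real (Suc k) powr (- 3 / 2) \<le> 3 / 2 * sqrt m * (1 / ((real k + 1) * (real k + 2))) + 1 / 4 * m powr (- 3 / 2)" for k
  proof -
    define x where "x = real (Suc k)"
    define s where "s = sqrt x"
    define r where "r = sqrt m"
    have x: "x \<ge> 1" by (simp add: x_def)
    have s: "s > 0" "x = s ^ 2" and r: "r > 0" "m = r ^ 2" using x m by (auto simp: s_def r_def)
    \<comment> \<open>Explicit form of Young's inequality
      \<open>4 * s * r ^ 3 \<le> s ^ 4 + 3 * r ^ 4\<close>. It is sharp at \<open>s = r\<close>,
      where \<open>k\<close> is \<open>n\<close>, so no power of \<open>n\<close> is lost.\<close>
    have "0 \<le> (s - r)\<^sup>2 * (s\<^sup>2 + 2 * s * r + 3 * r\<^sup>2)" using s r by simp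
    also have "\<dots> = s ^ 4 - 4 * s * r ^ 3 + 3 * r ^ 4"
      by (simp add: power2_eq_square power3_eq_cube power4_eq_xxxx algebra_simps)
    finally have "4 * s * r ^ 3 \<le> 3 * r ^ 4 + s ^ 4" by simp
    then have "1 / (s\<^sup>2 * s) \<le> 3 / 4 * r / s ^ 4 + 1 / 4 * (1 / (r\<^sup>2 * r))"
      using s r by (simp add: field_simps power2_eq_square power3_eq_cube power4_eq_xxxx)
    also have "3 / 4 * r / s ^ 4 = 3 / 4 * r * (1 / x\<^sup>2)" using s by (simp add: power2_eq_square power4_eq_xxxx)
    also have "1 / x\<^sup>2 \<le> 2 * (1 / ((real k + 1) * (real k + 2)))"
      by (simp add: x_def divide_simps power2_eq_square) (simp add: algebra_simps)
    finally have "1 / (s\<^sup>2 * s) \<le> 3 / 4 * r * (2 * (1 / ((real k + 1) * (real k + 2)))) + 1 / 4 * (1 / (r\<^sup>2 * r))"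
      using r by simp
    moreover have "x powr (- 3 / 2) = 1 / (s\<^sup>2 * s)"
      using powr_m32[of x] x unfolding s(2)[symmetric] s_def by simp
    moreover have "m powr (- 3 / 2) = 1 / (r\<^sup>2 * r)"
      using powr_m32[of m] m unfolding r(2)[symmetric] r_def by simp
    ultimately show ?thesis by (simp add: x_def r_def)
  qed
  have "binomial_mean \<alpha> n (\<lambda>k. real (Suc k) powr (- 3 / 2))
      \<le> binomial_mean \<alpha> n (\<lambda>k. 3 / 2 * sqrt m * (1 / ((real k + 1) * (real k + 2))) + 1 / 4 * m powr (- 3 / 2))"
    using assms le by (intro binomial_mean_mono) auto
  also have "\<dots> = 3 / 2 * sqrt m * binomial_mean \<alpha> n (\<lambda>k. 1 / ((real k + 1) * (real k + 2))) + 1 / 4 * m powr (- 3 / 2)"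
    by (simp only: binomial_mean_add binomial_mean_const)
  also have "\<dots> \<le> 3 / 2 * sqrt m * (1 / (\<alpha>\<^sup>2 * m\<^sup>2)) + 1 / 4 * m powr (- 3 / 2)"
  proof -
    have "binomial_mean \<alpha> n (\<lambda>k. 1 / ((real k + 1) * (real k + 2))) \<le> 1 / (\<alpha>\<^sup>2 * (real n + 1) * (real n + 2))"
      by (rule binomial_mean_inverse_square[OF assms])
    also have "\<dots> \<le> 1 / (\<alpha>\<^sup>2 * m\<^sup>2)"
    proof (rule divide_left_mono)
      have "m\<^sup>2 \<le> (real n + 1) * (real n + 2)" by (simp add: m_def power2_eq_square algebra_simps)
      then show "\<alpha>\<^sup>2 * m\<^sup>2 \<le> \<alpha>\<^sup>2 * (real n + 1) * (real n + 2)"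
        by (simp add: mult.assoc mult_left_mono)
    qed (use assms m in auto)
    finally show ?thesis using m by (intro add_right_mono mult_left_mono) auto
  qed
  also have "sqrt m * (1 / (\<alpha>\<^sup>2 * m\<^sup>2)) = 1 / \<alpha>\<^sup>2 * m powr (- 3 / 2)"
  proof -
    have "m = sqrt m * sqrt m" using m by simp
    then have "sqrt m / m\<^sup>2 = 1 / (m * sqrt m)"
      using m by (simp add: field_simps power2_eq_square)
    also have "\<dots> = m powr (- 3 / 2)" using powr_m32[of m] m by simp
    finally have "1 / \<alpha>\<^sup>2 * (sqrt m / m\<^sup>2) = 1 / \<alpha>\<^sup>2 * m powr (- 3 / 2)" by simp
    then show ?thesis by simp
  qed
  then have "3 / 2 * sqrt m * (1 / (\<alpha>\<^sup>2 * m\<^sup>2)) + 1 / 4 * m powr (- 3 / 2) = (3 / (2 * \<alpha>\<^sup>2) + 1 / 4) * m powr (- 3 / 2)"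
    by (simp add: algebra_simps)
  finally show ?thesis by (simp add: m_def)
qed

text \<open>Passing from \<open>m\<close> to \<open>m + 1\<close> multiplies the left side by
  \<open>(2 * m + 1) / (2 * m + 2)\<close>, and
  \<open>(2 * m + 1) * (2 * m + 3) \<le> (2 * m + 2)\<^sup>2\<close>.\<close>

lemma central_binomial_upper_bound: "real ((2 * m) choose m) / 4 ^ m \<le> 1 / sqrt (2 * real m + 1)"
proof (induction m)
  case (Suc m)
  let ?c = "real ((2 * m) choose m) / 4 ^ m"
  have "Suc m * (Suc (Suc (2 * m)) choose Suc m) = Suc (Suc (2 * m)) * (Suc (2 * m) choose m)"
    by (rule Suc_times_binomial_eq[symmetric, simplified mult.commute]) 
  then have 1: "(real m + 1) * real (2 * Suc m choose Suc m) = (2 * real m + 2) * real (Suc (2 * m) choose m)"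
    by (simp flip: of_nat_eq_iff[where 'a = real] add: algebra_simps del: binomial_Suc_Suc)
  have "(Suc (2 * m) choose m) = (Suc (2 * m) choose Suc m)"
    by (subst binomial_symmetric) auto
  moreover have "Suc m * (Suc (2 * m) choose Suc m) = Suc (2 * m) * (2 * m choose m)"
    by (rule Suc_times_binomial)
  ultimately have "Suc m * (Suc (2 * m) choose m) = Suc (2 * m) * (2 * m choose m)" by (simp only:)
  then have "real (Suc m * (Suc (2 * m) choose m)) = real (Suc (2 * m) * (2 * m choose m))" by (simp only:)
  then have 2: "(real m + 1) * real (Suc (2 * m) choose m) = (2 * real m + 1) * real (2 * m choose m)"
    by (simp only: of_nat_mult of_nat_Suc) (simp add: add.commute del: binomial_Suc_Suc)
  have "real (2 * Suc m choose Suc m) / 4 ^ Suc m = ?c * ((2 * real m + 1) / (2 * real m + 2))"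
  proof -
    have "real (2 * Suc m choose Suc m) = 2 * real (Suc (2 * m) choose m)"
    proof -
      have "(real m + 1) * real (2 * Suc m choose Suc m) = (real m + 1) * (2 * real (Suc (2 * m) choose m))"
        using 1 by (simp add: algebra_simps del: binomial_Suc_Suc)
      then show ?thesis by (subst (asm) mult_left_cancel) auto
    qed
    also have "real (Suc (2 * m) choose m) = (2 * real m + 1) * real (2 * m choose m) / (real m + 1)"
      using 2 by (subst eq_divide_eq) (simp add: mult.commute del: binomial_Suc_Suc)
    finally have X: "real (2 * Suc m choose Suc m) = 2 * ((2 * real m + 1) * real (2 * m choose m) / (real m + 1))" .
    have "2 * (w * z / M) / (4 * r) = z / r * (w / (2 * M))" for w z M r :: real
      by (simp add: mult.commute)
    moreover have "2 * real m + 2 = 2 * (real m + 1)" by simp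
    ultimately show ?thesis unfolding X by (simp only: power_Suc)
  qed
  also have "\<dots> \<le> 1 / sqrt (2 * real m + 1) * ((2 * real m + 1) / (2 * real m + 2))"
    by (intro mult_right_mono Suc.IH) auto
  also have "\<dots> = sqrt (2 * real m + 1) / (2 * real m + 2)"
  proof -
    have "1 / r * (r * r / M) = r / M" if "r > 0" for r M :: real using that by simp
    from this[of "sqrt (2 * real m + 1)" "2 * real m + 2"] show ?thesis by simp
  qed
  also have "\<dots> \<le> 1 / sqrt (2 * real (Suc m) + 1)"
  proof -
    have "sqrt (2 * real m + 1) * sqrt (2 * real m + 3) = sqrt ((2 * real m + 1) * (2 * real m + 3))"
      by (simp add: real_sqrt_mult)
    also have "\<dots> \<le> sqrt ((2 * real m + 2)\<^sup>2)"
      by (intro real_sqrt_le_mono) (simp add: power2_eq_square algebra_simps)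
    finally show ?thesis by (simp add: field_simps)
  qed
  finally show ?case .
qed simp

text \<open>The middle coefficient is the largest. For odd \<open>j\<close> it is half the central
  coefficient of \<open>j + 1\<close>, so the two quotients by powers of 2 agree.\<close>

lemma binomial_upper_bound: "real (j choose k) / 2 ^ j \<le> 1 / sqrt (real j + 1)"
proof -
  have "real (j choose k) / 2 ^ j \<le> real (j choose (j div 2)) / 2 ^ j"
    by (intro divide_right_mono) (auto simp: binomial_maximum)
  also have "\<dots> \<le> 1 / sqrt (real j + 1)"
  proof (cases "even j")
    case True
    then obtain m where "j = 2 * m" by auto
    then show ?thesis using central_binomial_upper_bound[of m] by (simp add: power_mult)
  next
    case False
    then obtain m where j: "j = Suc (2 * m)" by (auto elim: oddE)
    have "(Suc (2 * m) choose m) = (Suc (2 * m) choose Suc m)"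
      by (subst binomial_symmetric) auto
    then have "2 * Suc m choose Suc m = 2 * (Suc (2 * m) choose m)"
      by (simp only: mult_Suc_right add_2_eq_Suc binomial_Suc_Suc[of "Suc (2 * m)"])
    then have "real (j choose (j div 2)) / 2 ^ j = real (2 * Suc m choose Suc m) / 4 ^ Suc m"
      by (simp add: j power_mult del: binomial_Suc_Suc)
    also have "\<dots> \<le> 1 / sqrt (2 * real (Suc m) + 1)" by (rule central_binomial_upper_bound)
    also have "\<dots> \<le> 1 / sqrt (real j + 1)" by (intro divide_left_mono) (auto simp: j)
    finally show ?thesis .
  qed
  finally show ?thesis .
qed

section \<open>Uniform distributions on intervals and boxes\<close>

definition uniform_int :: "int \<Rightarrow> nat \<Rightarrow> int \<Rightarrow> real" where
  "uniform_int a m x = (if x \<in> {a..<a + int m} then 1 / real m else 0)"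

lemma sum_conv_power_le_1:
  assumes "finite S" "{z. f z \<noteq> 0} \<subseteq> S" "\<And>z. 0 \<le> f z" "sum f S \<le> 1" "finite Z"
  shows "(\<Sum>z\<in>Z. conv_power f m z) \<le> 1"
  using assms(5)
proof (induction m arbitrary: Z)
  case 0
  then show ?case by simp
next
  case (Suc m)
  have "(\<Sum>z\<in>Z. conv_power f (Suc m) z) = (\<Sum>y\<in>S. f y * (\<Sum>z\<in>Z. conv_power f m (z - y)))"
    unfolding conv_power_Suc_on[OF assms(1,2)] conv_on_def by (subst sum.swap) (simp add: sum_distrib_left)
  also have "\<dots> \<le> (\<Sum>y\<in>S. f y * 1)"
  proof (intro sum_mono mult_left_mono assms(3))
    fix y
    have "(\<Sum>z\<in>Z. conv_power f m (z - y)) = (\<Sum>z\<in>(\<lambda>z. z - y) ` Z. conv_power f m z)"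
      by (subst sum.reindex) (auto simp: inj_on_def)
    also have "\<dots> \<le> 1" using Suc by simp
    finally show "(\<Sum>z\<in>Z. conv_power f m (z - y)) \<le> 1" .
  qed
  finally show ?case using assms(4) by simp
qed

text \<open>
  The uniform distribution on an interval of length \<open>2 m\<close> is the convolution of the uniform
  distributions on an interval of length \<open>m\<close> and on the two points \<open>0\<close> and \<open>m\<close>. Modulo \<open>m\<close> the first
  factor is uniform, and the second factor produces binomial weights.
\<close>

lemma conv_power_uniform_int_le:
  assumes m: "1 \<le> m" and j: "1 \<le> j"
  shows "conv_power (uniform_int a (2 * m)) j x \<le> 1 / (real m * sqrt (real j + 1))"
proof -
  let ?v = "uniform_int a (2 * m)" and ?w = "uniform_int a m"
  let ?V = "{a..<a + int (2 * m)}" and ?W = "{a..<a + int m}"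
  have v: "conv_power ?v (Suc i) y = (\<Sum>t\<in>?W. (conv_power ?v i (y - t) + conv_power ?v i (y - t - int m)) / (2 * real m))" for i y
  proof -
    have "conv_power ?v (Suc i) y = (\<Sum>t\<in>?V. ?v t * conv_power ?v i (y - t))"
      by (subst conv_power_Suc_on[of ?V]) (auto simp: uniform_int_def conv_on_def)
    also have "\<dots> = (\<Sum>t\<in>?V. conv_power ?v i (y - t) / (2 * real m))"
      by (intro sum.cong refl) (simp add: uniform_int_def)
    also have "?V = ?W \<union> (\<lambda>t. t + int m) ` ?W"
      by (auto simp: image_iff)
    also have "(\<Sum>t\<in>?W \<union> (\<lambda>t. t + int m) ` ?W. conv_power ?v i (y - t) / (2 * real m))
        = (\<Sum>t\<in>?W. conv_power ?v i (y - t) / (2 * real m)) + (\<Sum>t\<in>(\<lambda>t. t + int m) ` ?W. conv_power ?v i (y - t) / (2 * real m))"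
      by (intro sum.union_disjoint) auto
    also have "(\<Sum>t\<in>(\<lambda>t. t + int m) ` ?W. conv_power ?v i (y - t) / (2 * real m))
        = (\<Sum>t\<in>?W. conv_power ?v i (y - t - int m) / (2 * real m))"
      by (subst sum.reindex) (auto simp: inj_on_def algebra_simps)
    finally show ?thesis by (simp add: sum.distrib add_divide_distrib)
  qed
  have w: "conv_power ?w (Suc i) y = (\<Sum>t\<in>?W. conv_power ?w i (y - t) / real m)" for i y
  proof -
    have "conv_power ?w (Suc i) y = (\<Sum>t\<in>?W. ?w t * conv_power ?w i (y - t))"
      by (subst conv_power_Suc_on[of ?W]) (auto simp: uniform_int_def conv_on_def)
    also have "\<dots> = (\<Sum>t\<in>?W. conv_power ?w i (y - t) / real m)"
      by (intro sum.cong refl) (simp add: uniform_int_def)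
    finally show ?thesis .
  qed
  have w0: "0 \<le> conv_power ?w i y" for i y
    by (induction i arbitrary: y) (simp, simp add: w sum_nonneg del: conv_power.simps)
  \<comment> \<open>The two-point factor selects the \<open>k\<close> of the \<open>i\<close> steps
    that carry the offset \<open>m\<close>.\<close>
  have expand: "conv_power ?v i y = (\<Sum>k\<le>i. real (i choose k) * (conv_power ?w i (y - int k * int m) / 2 ^ i))" for i y
  proof (induction i arbitrary: y)
    case (Suc i)
    have "conv_power ?v (Suc i) y = (\<Sum>t\<in>?W. \<Sum>k\<le>i. real (i choose k) *
        ((conv_power ?w i (y - t - int k * int m) + conv_power ?w i (y - t - int m - int k * int m)) / 2 ^ i / (2 * real m)))"
      unfolding v Suc.IH
      by (intro sum.cong refl) (simp add: sum.distrib[symmetric] sum_divide_distrib add_divide_distrib distrib_left)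
    also have "\<dots> = (\<Sum>k\<le>i. real (i choose k) * ((conv_power ?w (Suc i) (y - int k * int m)
        + conv_power ?w (Suc i) (y - int (Suc k) * int m)) / 2 ^ Suc i))"
      unfolding w
      by (subst sum.swap) (simp add: sum_distrib_left sum.distrib[symmetric] sum_divide_distrib add_divide_distrib distrib_left algebra_simps)
    also have "\<dots> = (\<Sum>k\<le>Suc i. real (Suc i choose k) * (conv_power ?w (Suc i) (y - int k * int m) / 2 ^ Suc i))"
      by (subst sum_binomial_Suc) (simp add: add_divide_distrib)
    finally show ?case .
  qed simp
  obtain i where i: "j = Suc i" using j by (cases j) auto
  \<comment> \<open>One step of law \<open>?w\<close> is uniform on \<open>m\<close> consecutive
    integers, and the blocks obtained for different \<open>k\<close> are disjoint. The double sum
    therefore runs over distinct points and is at most the total mass 1.\<close>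
  have "(\<Sum>k\<le>j. conv_power ?w j (x - int k * int m)) \<le> 1 / real m"
  proof -
    have "(\<Sum>k\<le>j. conv_power ?w j (x - int k * int m)) = (\<Sum>(k, t)\<in>{..j} \<times> ?W. conv_power ?w i (x - int k * int m - t)) / real m"
      by (simp add: i w sum_divide_distrib sum.cartesian_product case_prod_unfold del: sum.atMost_Suc)
    also have "(\<Sum>(k, t)\<in>{..j} \<times> ?W. conv_power ?w i (x - int k * int m - t))
        = (\<Sum>z\<in>(\<lambda>(k, t). x - int k * int m - t) ` ({..j} \<times> ?W). conv_power ?w i z)"
    proof (subst sum.reindex)
      show "inj_on (\<lambda>(k, t). x - int k * int m - t) ({..j} \<times> ?W)"
      proof (rule inj_onI)
        fix y y' assume "y \<in> {..j} \<times> ?W" "y' \<in> {..j} \<times> ?W"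
          and eqy: "(\<lambda>(k, t). x - int k * int m - t) y = (\<lambda>(k, t). x - int k * int m - t) y'"
        then obtain k t k' t' where y: "y = (k, t)" "y' = (k', t')"
          and t: "a \<le> t" "t < a + int m" "a \<le> t'" "t' < a + int m" by auto
        have eq: "int k * int m + t = int k' * int m + t'" using eqy by (simp add: y)
        have "int k = (int k * int m + (t - a)) div int m" using t m by simp
        also have "\<dots> = (int k' * int m + (t' - a)) div int m" using eq by (simp add: algebra_simps)
        also have "\<dots> = int k'" using t m by simp
        finally show "y = y'" using eq by (simp add: y)
      qed
    qed (simp add: case_prod_unfold)
    also have "\<dots> \<le> 1"
      using m by (intro sum_conv_power_le_1[of ?W]) (auto simp: uniform_int_def)
    finally show ?thesis using m by (simp add: divide_right_mono)
  qed
  then have *: "1 / sqrt (real j + 1) * (\<Sum>k\<le>j. conv_power ?w j (x - int k * int m)) \<le> 1 / sqrt (real j + 1) * (1 / real m)"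
    by (intro mult_left_mono) auto
  have "conv_power ?v j x = (\<Sum>k\<le>j. real (j choose k) / 2 ^ j * conv_power ?w j (x - int k * int m))"
    by (simp add: expand)
  also have "\<dots> \<le> (\<Sum>k\<le>j. 1 / sqrt (real j + 1) * conv_power ?w j (x - int k * int m))"
    by (intro sum_mono mult_right_mono binomial_upper_bound w0)
  also have "\<dots> \<le> 1 / sqrt (real j + 1) * (1 / real m)"
    using * by (simp only: sum_distrib_left)
  finally show ?thesis by (simp add: mult.commute)
qed

lemma finite_vec_box:
  fixes A :: "'n::finite \<Rightarrow> 'a set"
  assumes "\<And>i. finite (A i)"
  shows "finite {x :: 'a ^ 'n. \<forall>i. x $ i \<in> A i}"
    and bij_betw_vec_box: "bij_betw (\<lambda>g. \<chi> i. g i) (PiE UNIV A) {x. \<forall>i. x $ i \<in> A i}"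
proof -
  show bij: "bij_betw (\<lambda>g. \<chi> i. g i) (PiE UNIV A) {x. \<forall>i. x $ i \<in> A i}"
    by (rule bij_betw_byWitness[where f' = vec_nth]) (auto simp: PiE_UNIV_domain)
  have "finite (PiE UNIV A)" using assms by (intro finite_PiE) auto
  then show "finite {x :: 'a ^ 'n. \<forall>i. x $ i \<in> A i}" using bij_betw_finite[OF bij] by simp
qed

lemma sum_prod_vec_box:
  fixes A :: "'n::finite \<Rightarrow> 'a set" and h :: "'n \<Rightarrow> 'a \<Rightarrow> real"
  assumes "\<And>i. finite (A i)"
  shows "(\<Sum>x | \<forall>i. x $ i \<in> A i. \<Prod>i\<in>UNIV. h i (x $ i)) = (\<Prod>i\<in>UNIV. \<Sum>t\<in>A i. h i t)"
  using sum.reindex_bij_betw[OF bij_betw_vec_box[OF assms], of "\<lambda>x. \<Prod>i\<in>UNIV. h i (x $ i)"]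
    prod_sum_PiE[of UNIV A h] assms by simp

text \<open>Sums of products over a box factor, so the coordinates move independently.\<close>

lemma conv_power_prod:
  fixes v :: "'n::finite \<Rightarrow> int \<Rightarrow> real"
  assumes "\<And>i. finite (A i)" "\<And>i. {t. v i t \<noteq> 0} \<subseteq> A i"
  shows "conv_power (\<lambda>x :: int ^ 'n. \<Prod>i\<in>UNIV. v i (x $ i)) j x = (\<Prod>i\<in>UNIV. conv_power (v i) j (x $ i))"
proof (induction j arbitrary: x)
  case 0
  have "(\<Prod>i\<in>UNIV. if x $ i = 0 then 1 else 0 :: real) = (if x = 0 then 1 else 0)"
    by (auto simp: vec_eq_iff)
  then show ?case by simp
next
  case (Suc j)
  let ?B = "{x :: int ^ 'n. \<forall>i. x $ i \<in> A i}"
  have out: "{z. (\<Prod>i\<in>UNIV. v i (z $ i)) \<noteq> 0} \<subseteq> ?B"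
    using assms(2) by auto
  have "conv_power (\<lambda>x :: int ^ 'n. \<Prod>i\<in>UNIV. v i (x $ i)) (Suc j) x
      = (\<Sum>y\<in>?B. \<Prod>i\<in>UNIV. v i (y $ i) * conv_power (v i) j (x $ i - y $ i))"
    by (subst conv_power_Suc_on[OF finite_vec_box(1)[OF assms(1)] out])
       (simp_all add: conv_on_def Suc prod.distrib)
  also have "\<dots> = (\<Prod>i\<in>UNIV. \<Sum>t\<in>A i. v i t * conv_power (v i) j (x $ i - t))"
    by (rule sum_prod_vec_box[OF assms(1), where h = "\<lambda>i t. v i t * conv_power (v i) j (x $ i - t)"])
  also have "\<dots> = (\<Prod>i\<in>UNIV. conv_power (v i) (Suc j) (x $ i))"
    by (simp only: conv_power_Suc_on[OF assms] conv_on_def)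
  finally show ?case .
qed

section \<open>The spread-out model\<close>

lemma m32_telescope:
  assumes "1 \<le> k"
  shows "real (Suc k) powr (- 3 / 2) \<le> 2 / sqrt (real k) - 2 / sqrt (real (Suc k))"
proof -
  define a b where "a = sqrt (real k)" and "b = sqrt (real (Suc k))"
  have ab: "0 < a" "a \<le> b" "b\<^sup>2 = a\<^sup>2 + 1" using assms by (auto simp: a_def b_def)
  then have b: "0 < b" by simp
  have "(b - a) * (b + a) = 1" using ab by (simp add: power2_eq_square algebra_simps)
  moreover have "(b - a) * (b + a) \<le> (b - a) * (2 * b)" using ab by (intro mult_left_mono) auto
  ultimately have "1 \<le> 2 * b * (b - a)" by (simp add: algebra_simps)
  then have "a * 1 \<le> b * (2 * b * (b - a))" using ab b by (intro mult_mono) auto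
  then have "1 / (b\<^sup>2 * b) \<le> 2 / a - 2 / b"
    using ab(1) b by (simp add: divide_simps power2_eq_square algebra_simps)
  moreover have "real (Suc k) powr (- 3 / 2) = 1 / (b\<^sup>2 * b)"
    using powr_m32[of "real (Suc k)"] by (simp add: b_def)
  ultimately show ?thesis by (simp add: a_def b_def)
qed

lemma sum_m32_tail:
  assumes "1 \<le> K"
  shows "(\<Sum>n\<in>{K<..N}. real n powr (- 3 / 2)) \<le> 2 / sqrt (real K)"
proof (cases "K \<le> N")
  case True
  then have "(\<Sum>n\<in>{K<..N}. real n powr (- 3 / 2)) \<le> 2 / sqrt (real K) - 2 / sqrt (real N)"
  proof (induction N rule: dec_induct)
    case (step N)
    have "{K<..Suc N} = insert (Suc N) {K<..N}" using step by auto
    then show ?case using step m32_telescope[of N] assms by simp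
  qed simp
  also have "\<dots> \<le> 2 / sqrt (real K)" by simp
  finally show ?thesis .
qed simp

lemma sum_m32: "(\<Sum>n=1..N. real n powr (- 3 / 2)) \<le> 3"
proof (cases "1 \<le> N")
  case True
  then have "{1..N} = insert 1 {1<..N}" by auto
  then show ?thesis using sum_m32_tail[of 1 N] by simp
qed simp

lemma sum_m12: "(\<Sum>n=1..N. real n * real n powr (- 3 / 2)) \<le> 2 * sqrt (real N)"
proof (induction N)
  case (Suc N)
  define a b where "a = sqrt (real N)" and "b = sqrt (real (Suc N))"
  have ab: "0 \<le> a" "a \<le> b" "b\<^sup>2 = a\<^sup>2 + 1" "0 < b" by (auto simp: a_def b_def)
  have "(b - a) * (b + a) = 1" using ab by (simp add: power2_eq_square algebra_simps)
  moreover have "(b - a) * (b + a) \<le> (b - a) * (2 * b)" using ab by (intro mult_left_mono) auto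
  ultimately have "1 / b \<le> 2 * b - 2 * a" using ab(4) by (simp add: field_simps)
  moreover have "real (Suc N) * real (Suc N) powr (- 3 / 2) = 1 / b"
    using powr_m32[of "real (Suc N)"] by (simp add: b_def)
  ultimately show ?case using Suc by (simp add: a_def b_def)
qed simp

context kernel begin

text \<open>\<open>K\<close> stands for the volume L^d and is also the cutoff of the lengths. With
  \<open>h = 1 / (K * sqrt K)\<close> three errors occur: \<open>2 * A * h\<close> for returns
  beyond \<open>K\<close>, \<open>9 * A\<^sup>2 * h\<close> for paths that meet \<open>S\<close> in
  between, and \<open>48 * exp (6 * A) * A\<^sup>2 * h\<close> for interferences. The assumption
  \<open>3 * A \<le> K\<close> keeps the bound at most 2 and below \<open>p_max\<close>.\<close>

lemma pc2_ge_of_decay: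
  assumes V: "countable V" "{z. f z \<noteq> 0} \<subseteq> V" "0 \<in> V"
      "\<And>x y. x \<in> V \<Longrightarrow> y \<in> V \<Longrightarrow> x + y \<in> V"
    and K: "1 \<le> K" and A: "0 < A" "3 * A \<le> real K"
    and decay: "\<And>n x. 1 \<le> n \<Longrightarrow> conv_power f n x \<le> A / real K * real n powr (- 3 / 2)"
  shows "(\<lambda>k. conv_power f (2 * k) 0) summable_on {2..}"
    and "ereal (1 + ln 2 * (\<Sum>\<^sub>\<infinity>k\<in>{2..}. conv_power f (2 * k) 0)
        - (2 * A + 9 * A\<^sup>2 + 48 * exp (6 * A) * A\<^sup>2) * (1 / (real K * sqrt (real K)))) \<le> pc2 V f"
proof -
  define \<eta> where "\<eta> = 1 / real K"
  define h where "h = \<eta> * sqrt \<eta>"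
  define g where "g n = real n powr (- 3 / 2)" for n :: nat
  have \<eta>: "0 < \<eta>" "\<eta> \<le> 1" using K by (auto simp: \<eta>_def)
  have A\<eta>: "3 * A * \<eta> \<le> 1" using A K by (simp add: \<eta>_def field_simps)
  have sK: "\<eta> * sqrt (real K) = sqrt \<eta>" "sqrt (real K) > 0"
    using K by (simp_all add: \<eta>_def real_sqrt_divide real_div_sqrt field_simps)
  have isK: "1 / sqrt (real K) = sqrt \<eta>" using K by (simp add: \<eta>_def real_sqrt_divide)
  have dec: "conv_power f n x \<le> A * \<eta> * g n" if "1 \<le> n" for n x
    using decay[OF that, of x] by (simp add: \<eta>_def g_def)
  have g0: "0 \<le> g n" for n by (simp add: g_def)
  have r: "return l \<le> A * \<eta> * g l" if "1 \<le> l" for l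
  proof -
    have "return l \<le> A * \<eta> * g (2 * l)" unfolding return_def using that by (intro dec) auto
    also have "g (2 * l) \<le> g l" unfolding g_def using that by (intro powr_mono2') auto
    finally show ?thesis using A \<eta> by (simp add: mult_left_mono)
  qed
  have sum_r: "(\<Sum>l=1..N. return l) \<le> 3 * A * \<eta>" for N
  proof -
    have "(\<Sum>l=1..N. return l) \<le> (\<Sum>l=1..N. A * \<eta> * g l)" by (intro sum_mono r) auto
    also have "\<dots> = A * \<eta> * (\<Sum>l=1..N. g l)" by (simp add: sum_distrib_left)
    also have "\<dots> \<le> A * \<eta> * 3" using A \<eta> sum_m32 by (intro mult_left_mono) (auto simp: g_def)
    finally show ?thesis by simp
  qed
  define \<rho> where "\<rho> = (\<Sum>\<^sub>\<infinity>k\<in>{2..}. conv_power f (2 * k) 0)"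
  have sub: "F \<subseteq> {2..Max (insert 2 F)}" if "finite F" "F \<subseteq> {2..}" for F :: "nat set"
    using that by auto
  have fin_le: "sum return F \<le> 3 * A * \<eta>" if F: "finite F" "F \<subseteq> {2..}" for F
  proof -
    have "sum return F \<le> sum return {1..Max (insert 2 F)}"
      using sub[OF F] by (intro sum_mono2) (auto simp: return_nonneg)
    then show ?thesis using sum_r[of "Max (insert 2 F)"] by simp
  qed
  show summ: "(\<lambda>k. conv_power f (2 * k) 0) summable_on {2..}"
  proof (rule nonneg_bdd_above_summable_on)
    show "bdd_above (sum (\<lambda>k. conv_power f (2 * k) 0) ` {F. F \<subseteq> {2..} \<and> finite F})"
      using fin_le by (intro bdd_aboveI[of _ "3 * A * \<eta>"]) (auto simp: return_def)
  qed (rule conv_power_nonneg)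
  have \<rho>_le: "\<rho> \<le> 3 * A * \<eta>"
    unfolding \<rho>_def using fin_le by (intro infsum_le_finite_sums summ) (auto simp: return_def)
  have \<rho>0: "0 \<le> \<rho>" unfolding \<rho>_def by (intro infsum_nonneg conv_power_nonneg)
  have tail: "\<rho> \<le> (\<Sum>l=2..K. return l) + 2 * A * h"
    unfolding \<rho>_def
  proof (rule infsum_le_finite_sums[OF summ])
    fix F :: "nat set" assume F: "finite F" "F \<subseteq> {2..}"
    let ?N = "Max (insert 2 F)"
    have "sum return F \<le> sum return ({2..K} \<union> {K<..?N})"
      using sub[OF F] by (intro sum_mono2) (auto simp: return_nonneg)
    also have "\<dots> = (\<Sum>l=2..K. return l) + (\<Sum>l\<in>{K<..?N}. return l)"
      by (intro sum.union_disjoint) auto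
    also have "(\<Sum>l\<in>{K<..?N}. return l) \<le> (\<Sum>l\<in>{K<..?N}. A * \<eta> * g l)"
      using K by (intro sum_mono r) auto
    also have "\<dots> = A * \<eta> * (\<Sum>l\<in>{K<..?N}. g l)" by (simp add: sum_distrib_left)
    also have "\<dots> \<le> A * \<eta> * (2 / sqrt (real K))"
      using A \<eta> sum_m32_tail[OF K] by (intro mult_left_mono) (auto simp: g_def)
    also have "\<dots> = 2 * A * h" by (simp add: h_def flip: isK)
    finally show "(\<Sum>k\<in>F. conv_power f (2 * k) 0) \<le> (\<Sum>l=2..K. return l) + 2 * A * h"
      by (simp add: return_def)
  qed
  \<comment> \<open>Every relevant \<open>p\<close> is at most \<open>1 + 3 * A / K\<close>, so
    \<open>p ^ K \<le> exp (3 * A)\<close>.\<close>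
  let ?c = "exp (3 * A)"
  let ?C = "2 * A + 9 * A\<^sup>2 + 48 * exp (6 * A) * A\<^sup>2"
  let ?B = "1 + ln 2 * \<rho> - ?C * h"
  have ln2: "0 < ln (2::real)" "ln (2::real) \<le> 1" using ln_2_less_1 by auto
  have C0: "0 \<le> ?C" using A by (intro add_nonneg_nonneg) auto
  have "ln 2 * \<rho> \<le> 1 * (3 * A * \<eta>)" using ln2 \<rho>_le \<rho>0 by (intro mult_mono) auto
  moreover have h0: "0 \<le> h" using \<eta> by (simp add: h_def)
  then have "0 \<le> ?C * h" using C0 by (intro mult_nonneg_nonneg)
  ultimately have B1: "?B \<le> 1 + 3 * A * \<eta>" by simp
  \<comment> \<open>Pairing \<open>m\<close> with \<open>l - m\<close> embeds the index set into a
    square, so the double sum is at most the square of the sum of all returns;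
    \<open>\<eta>\<^sup>2 \<le> h\<close> because \<open>\<eta> \<le> 1\<close>.\<close>
  have conv: "(\<Sum>l=2..K. \<Sum>m\<in>{0<..<l}. return m * return (l - m)) \<le> 9 * A\<^sup>2 * h"
  proof -
    let ?S = "SIGMA l:{2..K}. {0<..<l}"
    have "(\<Sum>l=2..K. \<Sum>m\<in>{0<..<l}. return m * return (l - m)) = (\<Sum>(l, m)\<in>?S. return m * return (l - m))"
      by (simp add: sum.Sigma)
    also have "\<dots> = (\<Sum>(m, k)\<in>(\<lambda>(l, m). (m, l - m)) ` ?S. return m * return k)"
      by (subst sum.reindex) (auto simp: inj_on_def case_prod_unfold)
    also have "\<dots> \<le> (\<Sum>(m, k)\<in>{1..K} \<times> {1..K}. return m * return k)"
      by (intro sum_mono2) (auto simp: return_nonneg)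
    also have "\<dots> = (\<Sum>m=1..K. return m) * (\<Sum>k=1..K. return k)"
      by (simp add: sum_product sum.cartesian_product)
    also have "\<dots> \<le> (3 * A * \<eta>) * (3 * A * \<eta>)"
      using sum_r[of K] A \<eta> by (intro mult_mono) (auto simp: sum_nonneg return_nonneg)
    also have "\<dots> = 9 * A\<^sup>2 * (\<eta> * \<eta>)" by (simp add: power2_eq_square)
    also have "\<dots> \<le> 9 * A\<^sup>2 * h"
      unfolding h_def using \<eta> by (intro mult_left_mono real_le_rsqrt) (auto simp: power2_eq_square mult_left_le)
    finally show ?thesis .
  qed
  \<comment> \<open>The weight \<open>l + n\<close> splits into \<open>l\<close> times a convergent
    sum and a sum of order \<open>sqrt K\<close>. Summing over \<open>l\<close> then gives
    \<open>3 * 2 + 2 * 3 = 12\<close> times \<open>sqrt K\<close>, and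
    \<open>4 * 12 = 48\<close>.\<close>
  have loss: "(\<Sum>l=2..K. 4 * ?c\<^sup>2 * return l * (\<Sum>n=1..K. real (l + n) * (A * \<eta> * g n)))
      \<le> 48 * exp (6 * A) * A\<^sup>2 * h"
  proof -
    have c2: "?c\<^sup>2 = exp (6 * A)" by (simp flip: exp_of_nat_mult) 
    have inner: "(\<Sum>n=1..K. real (l + n) * (A * \<eta> * g n)) \<le> A * \<eta> * (3 * real l + 2 * sqrt (real K))" for l
    proof -
      have "(\<Sum>n=1..K. real (l + n) * (A * \<eta> * g n)) = A * \<eta> * (real l * (\<Sum>n=1..K. g n) + (\<Sum>n=1..K. real n * g n))"
        by (simp add: sum_distrib_left sum.distrib[symmetric] algebra_simps)
      also have "\<dots> \<le> A * \<eta> * (real l * 3 + 2 * sqrt (real K))"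
        using A \<eta> sum_m32[of K] sum_m12[of K] by (intro mult_left_mono add_mono) (auto simp: g_def)
      finally show ?thesis by (simp add: mult.commute)
    qed
    have "(\<Sum>l=2..K. 4 * ?c\<^sup>2 * return l * (\<Sum>n=1..K. real (l + n) * (A * \<eta> * g n)))
        \<le> (\<Sum>l=2..K. 4 * exp (6 * A) * (A * \<eta> * g l) * (A * \<eta> * (3 * real l + 2 * sqrt (real K))))"
      unfolding c2 using A \<eta> g0
      by (intro sum_mono mult_mono inner r mult_left_mono) (auto intro!: sum_nonneg mult_nonneg_nonneg)
    also have "\<dots> \<le> (\<Sum>l=1..K. 4 * exp (6 * A) * (A * \<eta> * g l) * (A * \<eta> * (3 * real l + 2 * sqrt (real K))))"
      using A \<eta> g0 by (intro sum_mono2) (auto intro!: mult_nonneg_nonneg)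
    also have "\<dots> = 4 * exp (6 * A) * A\<^sup>2 * \<eta>\<^sup>2 * (3 * (\<Sum>l=1..K. real l * g l) + 2 * sqrt (real K) * (\<Sum>l=1..K. g l))"
      by (simp add: sum_distrib_left sum.distrib[symmetric] power2_eq_square algebra_simps)
    also have "\<dots> \<le> 4 * exp (6 * A) * A\<^sup>2 * \<eta>\<^sup>2 * (3 * (2 * sqrt (real K)) + 2 * sqrt (real K) * 3)"
      using sum_m32[of K] sum_m12[of K] by (intro mult_left_mono add_mono) (auto simp: g_def)
    also have "\<dots> = 48 * exp (6 * A) * A\<^sup>2 * (\<eta> * (\<eta> * sqrt (real K)))"
      by (simp add: power2_eq_square)
    finally show ?thesis by (simp only: sK h_def)
  qed
  have "ereal ?B \<le> pc2 V f"
  proof (rule pc2_ge[where K = K and c = ?c and M = "\<lambda>n. A * \<eta> * g n", OF V])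
    show "conv_power f n x \<le> A * \<eta> * g n" if "1 \<le> n" for n x by (rule dec[OF that])
    show "?B ^ K \<le> ?c" if "1 \<le> ?B"
    proof -
      have "?B \<le> exp (3 * A * \<eta>)" using B1 exp_ge_add_one_self[of "3 * A * \<eta>"] by linarith
      then have "?B ^ K \<le> exp (3 * A * \<eta>) ^ K" using that by (intro power_mono) auto
      also have "\<dots> = ?c" using K by (simp add: exp_of_nat_mult[symmetric] \<eta>_def)
      finally show ?thesis .
    qed
    show "?B * f z \<le> 1" for z
    proof -
      have fz: "3 * f z \<le> 1"
        using dec[of 1 z] conv_power_1_on[OF finite_D, of f z] A\<eta> by (simp add: D_def g_def)
      have "?B * f z \<le> 2 * f z" using B1 A\<eta> nonneg by (intro mult_right_mono) auto
      then show ?thesis using fz nonneg[of z] by linarith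
    qed
    have "ln 2 * (2 * A * h + 9 * A\<^sup>2 * h + 48 * exp (6 * A) * A\<^sup>2 * h)
        \<le> 1 * (2 * A * h + 9 * A\<^sup>2 * h + 48 * exp (6 * A) * A\<^sup>2 * h)"
      using ln2 A h0 by (intro mult_right_mono add_nonneg_nonneg mult_nonneg_nonneg) auto
    also have "\<dots> = ?C * h" by (simp add: algebra_simps)
    finally have "ln 2 * \<rho> - ?C * h \<le> ln 2 * (\<rho> - 2 * A * h
        - 9 * A\<^sup>2 * h - 48 * exp (6 * A) * A\<^sup>2 * h)"
      by (simp add: algebra_simps)
    also have "\<dots> \<le> ln 2 * (\<Sum>l=2..K. return l - (\<Sum>m\<in>{0<..<l}. return m * return (l - m))
        - 4 * ?c\<^sup>2 * return l * (\<Sum>n=1..K. real (l + n) * (A * \<eta> * g n)))"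
      using tail conv loss ln2 by (intro mult_left_mono) (simp_all add: sum_subtractf)
    finally show "?B \<le> 1 + ln 2 * (\<Sum>l=2..K. return l - (\<Sum>m\<in>{0<..<l}. return m * return (l - m))
        - 4 * ?c\<^sup>2 * return l * (\<Sum>n=1..K. real (l + n) * (A * \<eta> * g n)))" by simp
  qed
  moreover have "1 / (real K * sqrt (real K)) = h"
    unfolding h_def isK[symmetric] by (simp add: \<eta>_def)
  ultimately show "ereal (1 + ln 2 * (\<Sum>\<^sub>\<infinity>k\<in>{2..}. conv_power f (2 * k) 0)
        - ?C * (1 / (real K * sqrt (real K)))) \<le> pc2 V f"
    by (simp add: \<rho>_def)
qed

end

section \<open>Decay for kernels with a continuous density\<close>

lemma reflections_imp_even:
  fixes F :: "real ^ 'n \<Rightarrow> real"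
  assumes "\<And>i x. F (\<chi> j. if j = i then - (x $ j) else x $ j) = F x"
  shows "F (- x) = F x"
proof -
  have "F (\<chi> j. if j \<in> J then - (x $ j) else x $ j) = F x" if "finite J" for J
    using that
  proof (induction J rule: finite_induct)
    case (insert i J)
    let ?y = "\<chi> j. if j \<in> J then - (x $ j) else x $ j"
    have "(\<chi> j. if j \<in> insert i J then - (x $ j) else x $ j) = (\<chi> j. if j = i then - (?y $ j) else ?y $ j)"
      using insert.hyps by (auto simp: vec_eq_iff)
    then show ?case using assms[of i ?y] insert.IH by simp
  qed simp
  from this[of UNIV] show ?thesis by (simp add: uminus_vec_def)
qed

lemma card_vec_box:
  fixes A :: "'n::finite \<Rightarrow> int set"
  assumes "\<And>i. finite (A i)" "\<And>i. card (A i) = k"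
  shows "card {x. \<forall>i. x $ i \<in> A i} = k ^ CARD('n)"
proof -
  have "card {x. \<forall>i. x $ i \<in> A i} = card (PiE UNIV A)"
    by (rule bij_betw_same_card[OF bij_betw_vec_box[of A, OF assms(1)], symmetric])
  also have "\<dots> = (\<Prod>i\<in>UNIV. card (A i))" by (rule card_PiE) simp
  finally show ?thesis by (simp add: assms(2))
qed

text \<open>Collects the constants of the decay estimate: an upper bound, the size of the support,
  and a cube on which \<open>F\<close> stays above a positive constant. The cube exists by
  continuity, since a function with integral 1 is not identically zero.\<close>

lemma density_bounds:
  fixes F :: "real ^ 'n \<Rightarrow> real"
  assumes F: "\<And>x. 0 \<le> F x" "continuous_on UNIV F" "compact (closure {x. F x \<noteq> 0})" "(F has_integral 1) UNIV"
  shows "\<exists>m R c \<epsilon> x0. 0 < m \<and> (\<forall>x. F x \<le> m) \<and> 0 < R \<and> (\<forall>x i. F x \<noteq> 0 \<longrightarrow> \<bar>x $ i\<bar> \<le> R) \<and>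
    0 < c \<and> 0 < \<epsilon> \<and> (\<forall>x. (\<forall>i. \<bar>x $ i - x0 $ i\<bar> \<le> \<epsilon>) \<longrightarrow> c \<le> F x)"
proof -
  let ?S = "closure {x. F x \<noteq> 0}"
  have "bounded (F ` ?S)"
    using F(2,3) by (intro compact_imp_bounded compact_continuous_image) (auto intro: continuous_on_subset)
  then obtain m0 where m0: "\<And>x. x \<in> ?S \<Longrightarrow> norm (F x) \<le> m0" by (auto simp: bounded_iff)
  define m where "m = max m0 1"
  have m: "F x \<le> m" for x
  proof (cases "F x = 0")
    case False
    then have "x \<in> ?S" using closure_subset[of "{x. F x \<noteq> 0}"] by auto
    then show ?thesis using m0[of x] by (auto simp: m_def)
  qed (simp add: m_def)
  obtain R0 where R0: "\<And>x. x \<in> ?S \<Longrightarrow> norm x \<le> R0"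
    using compact_imp_bounded[OF F(3)] by (auto simp: bounded_iff)
  define R where "R = max R0 1"
  have R: "\<bar>x $ i\<bar> \<le> R" if "F x \<noteq> 0" for x i
  proof -
    have "x \<in> ?S" using that closure_subset[of "{x. F x \<noteq> 0}"] by auto
    then show ?thesis using R0[of x] component_le_norm_cart[of x i] by (auto simp: R_def)
  qed
  have "\<exists>x0. F x0 \<noteq> 0"
  proof (rule ccontr)
    assume "\<not> ?thesis"
    then have "(F has_integral 0) UNIV" by (simp add: has_integral_is_0)
    from has_integral_unique[OF this F(4)] show False by simp
  qed
  then obtain x0 where x0: "F x0 \<noteq> 0" by auto
  then have Fx0: "F x0 > 0" using F(1)[of x0] by simp
  have "isCont F x0" using F(2) by (simp add: continuous_on_eq_continuous_at)
  from this[unfolded continuous_at_eps_delta, rule_format, of "F x0 / 2"] Fx0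
  have "\<exists>d>0. \<forall>x. dist x x0 < d \<longrightarrow> dist (F x) (F x0) < F x0 / 2" by simp
  then obtain \<delta> where \<delta>: "\<delta> > 0" "\<And>x. dist x x0 < \<delta> \<Longrightarrow> dist (F x) (F x0) < F x0 / 2"
    by blast
  \<comment> \<open>The l1 norm bounds the Euclidean norm, so the cube of half-side \<epsilon> lies
    in the ball of radius \<delta>.\<close>
  define \<epsilon> where "\<epsilon> = \<delta> / (2 * real CARD('n))"
  have "F x0 / 2 \<le> F x" if x: "\<And>i. \<bar>x $ i - x0 $ i\<bar> \<le> \<epsilon>" for x
  proof -
    have "norm (x - x0) \<le> (\<Sum>i\<in>UNIV. \<bar>(x - x0) $ i\<bar>)" by (rule norm_le_l1_cart)
    also have "\<dots> \<le> (\<Sum>i\<in>(UNIV :: 'n set). \<epsilon>)" using x by (intro sum_mono) simp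
    also have "\<dots> = \<delta> / 2" by (simp add: \<epsilon>_def)
    also have "\<dots> < \<delta>" using \<delta>(1) by simp
    finally have "dist (F x) (F x0) < F x0 / 2" by (intro \<delta>(2)) (simp add: dist_norm)
    then show ?thesis unfolding dist_real_def by linarith
  qed
  then show ?thesis using m R Fx0 \<delta>(1)
    by (intro exI[of _ m] exI[of _ R] exI[of _ "F x0 / 2"] exI[of _ \<epsilon>] exI[of _ x0])
       (auto simp: m_def R_def \<epsilon>_def)
qed

text \<open>The convolution powers of the kernel are not explicit, but it dominates \<alpha> times
  the uniform law on a box of side comparable to \<open>L\<close>, whose powers are products of
  one-dimensional ones. \<open>conv_power_le_binomial_mean\<close> transfers their decay, and
  \<open>binomial_mean_m32\<close> preserves the exponent.\<close>

lemma spread_kernel_decay: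
  fixes F :: "real ^ 'n \<Rightarrow> real"
  assumes d: "3 \<le> CARD('n)"
    and F: "\<And>x. 0 \<le> F x" "continuous_on UNIV F" "compact (closure {x. F x \<noteq> 0})" "(F has_integral 1) UNIV"
    and reflect: "\<And>i x. F (\<chi> j. if j = i then - (x $ j) else x $ j) = F x"
  shows "\<exists>A>0. \<forall>\<^sub>F L in sequentially. kernel (spread_kernel F L) \<and>
    (\<forall>n\<ge>1. \<forall>x. conv_power (spread_kernel F L) n x \<le> A / real (L ^ CARD('n)) * real n powr (- 3 / 2))"
proof -
  let ?d = "CARD('n)"
  obtain m R c \<epsilon> x0 where bounds: "0 < m \<and> (\<forall>x. F x \<le> m) \<and> 0 < R \<and>
    (\<forall>x i. F x \<noteq> 0 \<longrightarrow> \<bar>x $ i\<bar> \<le> R) \<and> 0 < c \<and> 0 < \<epsilon> \<and> (\<forall>x. (\<forall>i. \<bar>x $ i - x0 $ i\<bar> \<le> \<epsilon>) \<longrightarrow> c \<le> F x)"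
    using density_bounds[OF F] by (elim exE)
  have m: "0 < m" "\<And>x. F x \<le> m" and R: "0 < R" "\<And>x i. F x \<noteq> 0 \<Longrightarrow> \<bar>x $ i\<bar> \<le> R"
    and c: "0 < c" and \<epsilon>: "0 < \<epsilon>" and Fc: "\<And>x. (\<And>i. \<bar>x $ i - x0 $ i\<bar> \<le> \<epsilon>) \<Longrightarrow> c \<le> F x"
    using bounds by auto
  \<comment> \<open>The lower bound on \<open>F\<close> times the box volume, over the upper bound
    on the normalising sum, with \<open>L ^ d\<close> cancelled.\<close>
  define \<alpha> where "\<alpha> = min 1 (c * (\<epsilon> / 2) ^ ?d / (m * (2 * R + 3) ^ ?d))"
  \<comment> \<open>The first summand bounds the kernel itself, for the case without a uniform step;
    the second bounds the powers of the uniform law.\<close>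
  define \<kappa> where "\<kappa> = m / (c * (\<epsilon> / 2) ^ ?d) + (4 / \<epsilon>) ^ ?d"
  define A where "A = \<kappa> * (3 / (2 * \<alpha>\<^sup>2) + 1 / 4)"
  have \<alpha>: "0 < \<alpha>" "\<alpha> \<le> 1" using c \<epsilon> m R by (auto simp: \<alpha>_def)
  have \<kappa>: "0 < \<kappa>" using m c \<epsilon> by (auto simp: \<kappa>_def intro!: add_pos_pos)
  have "0 < A" using \<alpha> \<kappa> by (auto simp: A_def intro!: mult_pos_pos add_pos_pos)
  moreover have "\<forall>\<^sub>F L in sequentially. kernel (spread_kernel F L) \<and>
    (\<forall>n\<ge>1. \<forall>x. conv_power (spread_kernel F L) n x \<le> A / real (L ^ CARD('n)) * real n powr (- 3 / 2))"
    using eventually_ge_at_top[of "max 1 (nat \<lceil>4 / \<epsilon>\<rceil>)"]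
  proof eventually_elim
    case (elim L)
    then have L1: "1 \<le> real L" and "4 / \<epsilon> \<le> real L" by linarith+
    then have L4: "4 \<le> \<epsilon> * real L" using \<epsilon> by (simp add: field_simps)
    \<comment> \<open>The box has the even side \<open>2 * l\<close>, as in
      \<open>conv_power_uniform_int_le\<close>. Since \<open>2 * l \<le> \<epsilon> * L\<close>, its
      points divided by \<open>L\<close> stay between \<open>x0 - \<epsilon>\<close> and
      \<open>x0\<close> in each coordinate; what the ceiling in \<open>a i\<close> adds is offset by
      the open upper end.\<close>
    define l where "l = nat \<lfloor>\<epsilon> * real L / 2\<rfloor>"
    have l: "real l \<le> \<epsilon> * real L / 2" "\<epsilon> * real L / 4 \<le> real l" "1 \<le> l"
      using L4 by (auto simp: l_def) linarith+
    define a where "a i = \<lceil>real L * (x0 $ i - \<epsilon>)\<rceil>" for i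
    define Q where "Q = {z :: int ^ 'n. \<forall>i. z $ i \<in> {a i..<a i + int (2 * l)}}"
    define b where "b = nat \<lceil>R * real L\<rceil>"
    define S where "S = {z :: int ^ 'n. \<forall>i. z $ i \<in> {- int b..int b}}"
    have finS: "finite S" unfolding S_def by (rule finite_vec_box) simp
    have cardS: "card S = (2 * b + 1) ^ ?d"
      unfolding S_def by (rule card_vec_box) (auto simp: nat_eq_iff)
    have cardQ: "card Q = (2 * l) ^ ?d"
      unfolding Q_def by (rule card_vec_box) auto
    have supp: "z \<in> S" if "F (scale_pt L z) \<noteq> 0" for z
      unfolding S_def
    proof safe
      fix i
      have "\<bar>real_of_int (z $ i) / real L\<bar> \<le> R" using R(2)[OF that, of i] by (simp add: scale_pt_def)
      then have "\<bar>real_of_int (z $ i)\<bar> \<le> R * real L" using L1 by (simp add: field_simps abs_divide)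
      also have "\<dots> \<le> real b" unfolding b_def by (rule real_nat_ceiling_ge)
      finally show "z $ i \<in> {- int b..int b}" by auto
    qed
    have FQ: "c \<le> F (scale_pt L z)" if z: "z \<in> Q" for z
    proof (rule Fc)
      fix i
      have "a i \<le> z $ i \<and> z $ i < a i + 2 * int l" using z by (simp add: Q_def)
      then have zi: "a i \<le> z $ i" "z $ i + 1 \<le> a i + 2 * int l" by linarith+
      have "real L * (x0 $ i - \<epsilon>) \<le> real_of_int (a i)" "real_of_int (a i) \<le> real L * (x0 $ i - \<epsilon>) + 1"
        unfolding a_def by linarith+
      moreover have "real_of_int (a i) \<le> real_of_int (z $ i)" using zi(1) by simp
      moreover have "real_of_int (z $ i + 1) \<le> real_of_int (a i + 2 * int l)"
        using zi(2) by (simp only: of_int_le_iff)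
      then have "real_of_int (z $ i) + 1 \<le> real_of_int (a i) + 2 * real l" by simp
      moreover have "real L * (x0 $ i - \<epsilon>) = real L * x0 $ i - \<epsilon> * real L" by (simp add: algebra_simps)
      ultimately have "real L * (x0 $ i - \<epsilon>) \<le> real_of_int (z $ i)" "real_of_int (z $ i) \<le> real L * x0 $ i"
        using l(1) by linarith+
      then have "x0 $ i - \<epsilon> \<le> real_of_int (z $ i) / real L" "real_of_int (z $ i) / real L \<le> x0 $ i"
        using L1 by (simp_all add: pos_le_divide_eq pos_divide_le_eq mult.commute)
      then have "\<bar>real_of_int (z $ i) / real L - x0 $ i\<bar> \<le> \<epsilon>" using \<epsilon> by linarith
      then show "\<bar>scale_pt L z $ i - x0 $ i\<bar> \<le> \<epsilon>" by (simp add: scale_pt_def)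
    qed
    have QS: "Q \<subseteq> S"
    proof
      fix z assume "z \<in> Q"
      from FQ[OF this] c have "F (scale_pt L z) \<noteq> 0" by auto
      then show "z \<in> S" by (rule supp)
    qed
    define Z where "Z = (\<Sum>y\<in>S. F (scale_pt L y))"
    have infZ: "(\<Sum>\<^sub>\<infinity>y. F (scale_pt L y)) = Z"
    proof -
      have "(\<Sum>\<^sub>\<infinity>y. F (scale_pt L y)) = (\<Sum>\<^sub>\<infinity>y\<in>S. F (scale_pt L y))"
        by (rule infsum_cong_neutral) (use supp in auto)
      then show ?thesis using finS by (simp add: Z_def)
    qed
    have l2: "\<epsilon> / 2 * real L \<le> 2 * real l" using l(2) by simp
    have Q_ge: "(\<epsilon> / 2) ^ ?d * real L ^ ?d \<le> real (card Q)"
    proof -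
      have "(\<epsilon> / 2) ^ ?d * real L ^ ?d = (\<epsilon> / 2 * real L) ^ ?d" by (rule power_mult_distrib[symmetric])
      also have "\<dots> \<le> (2 * real l) ^ ?d" using \<epsilon> by (intro power_mono l2) simp
      also have "\<dots> = real (card Q)" by (simp add: cardQ)
      finally show ?thesis .
    qed
    have Z_ge: "c * ((\<epsilon> / 2) ^ ?d * real L ^ ?d) \<le> Z"
    proof -
      have "c * ((\<epsilon> / 2) ^ ?d * real L ^ ?d) \<le> c * real (card Q)" using Q_ge c by (intro mult_left_mono) auto
      also have "\<dots> = (\<Sum>y\<in>Q. c)" by (simp add: mult.commute)
      also have "\<dots> \<le> (\<Sum>y\<in>Q. F (scale_pt L y))" by (intro sum_mono FQ)
      also have "\<dots> \<le> Z" unfolding Z_def using F(1) finS QS by (intro sum_mono2) auto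
      finally show ?thesis .
    qed
    have Ld: "0 < real L ^ ?d" using L1 by simp
    have Z0: "0 < Z" using Z_ge c \<epsilon> Ld by (intro less_le_trans[OF _ Z_ge]) (auto intro!: mult_pos_pos)
    have Z_le: "Z \<le> m * ((2 * R + 3) ^ ?d * real L ^ ?d)"
    proof -
      have "Z \<le> (\<Sum>y\<in>S. m)" unfolding Z_def by (intro sum_mono m)
      also have "\<dots> = m * (2 * real b + 1) ^ ?d" by (simp add: cardS mult.commute add.commute)
      also have "\<dots> \<le> m * ((2 * R + 3) * real L) ^ ?d"
      proof (intro mult_left_mono power_mono)
        have "0 \<le> R * real L" using R L1 by simp
        then have "real b \<le> R * real L + 1" unfolding b_def by linarith
        then show "2 * real b + 1 \<le> (2 * R + 3) * real L" using L1 by (simp add: algebra_simps)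
      qed (use m in auto)
      finally show ?thesis by (simp add: power_mult_distrib)
    qed
    let ?f = "spread_kernel F L"
    have f: "?f z = F (scale_pt L z) / Z" for z by (simp add: spread_kernel_def infZ)
    have fS: "{z. ?f z \<noteq> 0} \<subseteq> S" using supp by (auto simp: f)
    have f1: "sum ?f S = 1" using Z0 by (simp add: f sum_divide_distrib[symmetric] Z_def[symmetric])
    have ker: "kernel ?f"
    proof
      show "0 \<le> ?f z" for z using F(1) Z0 by (simp add: f)
      show "finite {z. ?f z \<noteq> 0}" using fS finS by (rule finite_subset)
      have "(\<Sum>z | ?f z \<noteq> 0. ?f z) = sum ?f S"
        using fS finS by (intro sum.mono_neutral_left) auto
      then show "(\<Sum>z | ?f z \<noteq> 0. ?f z) = 1" by (simp add: f1)
      have "scale_pt L (- z) = - scale_pt L z" for z :: "int ^ 'n" by (simp add: scale_pt_def vec_eq_iff)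
      then show "?f (- z) = ?f z" for z by (simp add: f reflections_imp_even[of F, OF reflect])
    qed
    define u where "u x = (\<Prod>i\<in>UNIV. uniform_int (a i) (2 * l) (x $ i))" for x :: "int ^ 'n"
    have u_in: "u z = 1 / (2 * real l) ^ ?d" if "z \<in> Q" for z
      using that by (simp add: u_def Q_def uniform_int_def power_divide)
    have u_out: "u z = 0" if "z \<notin> Q" for z
      using that by (auto simp: u_def Q_def uniform_int_def)
    have uS: "{z. u z \<noteq> 0} \<subseteq> S" using u_out QS by auto
    have u0: "0 \<le> u z" for z using u_in[of z] u_out[of z] by (cases "z \<in> Q") auto
    have u1: "sum u S = 1"
    proof -
      have "sum u S = sum u Q" using QS finS u_out by (intro sum.mono_neutral_right) auto
      also have "\<dots> = (\<Sum>z\<in>Q. 1 / (2 * real l) ^ ?d)" by (intro sum.cong refl u_in)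
      finally show ?thesis using l(3) by (simp add: cardQ)
    qed
    have \<alpha>u: "\<alpha> * u z \<le> ?f z" for z
    proof (cases "z \<in> Q")
      case True
      have "\<alpha> * Z \<le> c * (\<epsilon> / 2) ^ ?d / (m * (2 * R + 3) ^ ?d) * (m * ((2 * R + 3) ^ ?d * real L ^ ?d))"
        using Z_le Z0 c \<epsilon> m(1) R(1) by (intro mult_mono) (auto simp: \<alpha>_def)
      also have "\<dots> = c * ((\<epsilon> / 2) ^ ?d * real L ^ ?d)"
      proof -
        have "y * E / (M * r) * (M * (r * t)) = y * (E * t)" if "M \<noteq> 0" "r \<noteq> 0" for y E M r t :: real
          using that by simp
        then show ?thesis using m(1) R(1) by simp
      qed
      also have "\<dots> \<le> c * real (card Q)" using Q_ge c by (intro mult_left_mono) auto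
      also have "\<dots> \<le> F (scale_pt L z) * (2 * real l) ^ ?d"
        using FQ[OF True] by (simp add: cardQ mult_right_mono)
      finally have "\<alpha> * Z \<le> F (scale_pt L z) * (2 * real l) ^ ?d" .
      moreover have "y * (1 / w) \<le> x / r" if "y * r \<le> x * w" "0 < w" "0 < r" for x y w r :: real
        using that by (simp add: field_simps)
      ultimately show ?thesis
        using Z0 l(3) unfolding u_in[OF True] f by simp
    next
      case False
      then show ?thesis using F(1) Z0 by (simp add: u_out f)
    qed
    let ?A = "\<lambda>j. \<kappa> / real L ^ ?d * real (Suc j) powr (- 3 / 2)"
    have A0: "?f x \<le> ?A 0" for x
    proof -
      have "?f x \<le> m / Z" using m Z0 by (simp add: f divide_right_mono)
      also have "\<dots> \<le> m / (c * ((\<epsilon> / 2) ^ ?d * real L ^ ?d))"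
        using Z_ge m c \<epsilon> Ld Z0 by (intro divide_left_mono) (auto intro!: mult_pos_pos)
      also have "\<dots> = m / (c * (\<epsilon> / 2) ^ ?d) / real L ^ ?d" by (simp add: mult.assoc)
      also have "\<dots> \<le> \<kappa> / real L ^ ?d" using \<epsilon> Ld by (intro divide_right_mono) (auto simp: \<kappa>_def)
      finally show ?thesis by simp
    qed
    have Aj: "conv_power u j x \<le> ?A j" if j: "1 \<le> j" for j x
    proof -
      have "conv_power u j x = (\<Prod>i\<in>UNIV. conv_power (uniform_int (a i) (2 * l)) j (x $ i))"
        unfolding u_def[abs_def]
        by (rule conv_power_prod[where A = "\<lambda>i. {a i..<a i + int (2 * l)}"]) (auto simp: uniform_int_def)
      also have "\<dots> \<le> (\<Prod>i\<in>(UNIV :: 'n set). 1 / (real l * sqrt (real j + 1)))"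
      proof (intro prod_mono conjI conv_power_uniform_int_le l(3) j)
        fix i
        have "0 \<le> conv_power (uniform_int (a i) (2 * l)) j y" for y
          by (induction j arbitrary: y)
             (simp, subst conv_power_Suc_on[of "{a i..<a i + int (2 * l)}"],
               auto simp: uniform_int_def conv_on_def intro!: sum_nonneg mult_nonneg_nonneg)
        then show "0 \<le> conv_power (uniform_int (a i) (2 * l)) j (x $ i)" .
      qed
      also have "\<dots> = (1 / real l) ^ ?d * (1 / sqrt (real j + 1)) ^ ?d"
        by (simp add: power_divide power_mult_distrib)
      also have "\<dots> \<le> ((4 / \<epsilon>) ^ ?d / real L ^ ?d) * real (Suc j) powr (- 3 / 2)"
      proof (rule mult_mono)
        have "1 / real l \<le> 4 / \<epsilon> / real L"
          using l(2,3) \<epsilon> L1 by (simp add: field_simps)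
        then have "(1 / real l) ^ ?d \<le> (4 / \<epsilon> / real L) ^ ?d" by (intro power_mono) auto
        also have "\<dots> = (4 / \<epsilon>) ^ ?d / real L ^ ?d" by (rule power_divide)
        finally show "(1 / real l) ^ ?d \<le> (4 / \<epsilon>) ^ ?d / real L ^ ?d" .
        \<comment> \<open>The uniform law decays with exponent \<open>d / 2\<close>;
          \<open>3 \<le> d\<close> weakens this to \<open>3 / 2\<close>, for which the series still
          converges.\<close>
        have "(1 / sqrt (real j + 1)) ^ ?d \<le> (1 / sqrt (real j + 1)) ^ 3"
          using d by (intro power_decreasing) auto
        also have "\<dots> = real (Suc j) powr (- 3 / 2)"
          using powr_m32[of "real (Suc j)"] by (simp add: power3_eq_cube power_divide add.commute)
        finally show "(1 / sqrt (real j + 1)) ^ ?d \<le> real (Suc j) powr (- 3 / 2)" .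
      qed (use \<epsilon> in auto)
      also have "\<dots> \<le> ?A j"
        using m c \<epsilon> Ld by (intro mult_right_mono divide_right_mono) (auto simp: \<kappa>_def)
      finally show ?thesis .
    qed
    have "conv_power ?f n x \<le> A / real (L ^ ?d) * real n powr (- 3 / 2)" if n: "1 \<le> n" for n x
    proof -
      obtain k where k: "n = Suc k" using n by (cases n) auto
      have "conv_power ?f n x \<le> binomial_mean \<alpha> k ?A"
        unfolding k using \<alpha>
        by (intro conv_power_le_binomial_mean[where A = ?A, OF finS fS f1 uS u0 u1 _ \<alpha>u A0 Aj]) auto
      also have "\<dots> = \<kappa> / real L ^ ?d * binomial_mean \<alpha> k (\<lambda>j. real (Suc j) powr (- 3 / 2))"
        by (simp add: binomial_mean_def sum_distrib_left mult_ac)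
      also have "\<dots> \<le> \<kappa> / real L ^ ?d * ((3 / (2 * \<alpha>\<^sup>2) + 1 / 4) * real (Suc k) powr (- 3 / 2))"
        using \<kappa> Ld \<alpha> by (intro mult_left_mono binomial_mean_m32) auto
      finally show ?thesis by (simp add: A_def k)
    qed
    with ker show ?case by blast
  qed
  ultimately show ?thesis by blast
qed

text \<open>This is \<open>pc2_ge_of_decay\<close> with \<open>K = L ^ d\<close>, for which
  \<open>1 / (K * sqrt K)\<close> is \<open>L powr (- (3 * d / 2))\<close>; the assumption
  \<open>3 * A \<le> K\<close> holds for all large \<open>L\<close>.\<close>

lemma spread_out_bound:
  fixes F :: "real ^ 'n \<Rightarrow> real"
  assumes d: "3 \<le> CARD('n)"
    and F: "\<And>x. 0 \<le> F x" "continuous_on UNIV F" "compact (closure {x. F x \<noteq> 0})" "(F has_integral 1) UNIV"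
    and reflect: "\<And>i x. F (\<chi> j. if j = i then - (x $ j) else x $ j) = F x"
  shows "\<exists>C. \<forall>\<^sub>F L in sequentially.
    (\<lambda>k. conv_power (spread_kernel F L) (2 * k) 0) summable_on {2..} \<and>
    ereal (1 + ln 2 * (\<Sum>\<^sub>\<infinity>k\<in>{2..}. conv_power (spread_kernel F L) (2 * k) 0)
      - C * real L powr (- (3 * real CARD('n) / 2))) \<le> pc2 (UNIV :: (int ^ 'n) set) (spread_kernel F L)"
proof -
  obtain A where A: "0 < A" and ev: "\<forall>\<^sub>F L in sequentially. kernel (spread_kernel F L) \<and>
    (\<forall>n\<ge>1. \<forall>x. conv_power (spread_kernel F L) n x \<le> A / real (L ^ CARD('n)) * real n powr (- 3 / 2))"
    using spread_kernel_decay[OF d F reflect] by (elim exE conjE)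
  show ?thesis
  proof (rule exI)
    show "\<forall>\<^sub>F L in sequentially.
      (\<lambda>k. conv_power (spread_kernel F L) (2 * k) 0) summable_on {2..} \<and>
      ereal (1 + ln 2 * (\<Sum>\<^sub>\<infinity>k\<in>{2..}. conv_power (spread_kernel F L) (2 * k) 0)
        - (2 * A + 9 * A\<^sup>2 + 48 * exp (6 * A) * A\<^sup>2) * real L powr (- (3 * real CARD('n) / 2)))
        \<le> pc2 (UNIV :: (int ^ 'n) set) (spread_kernel F L)"
      using ev eventually_ge_at_top[of "max 1 (nat \<lceil>3 * A\<rceil>)"]
    proof eventually_elim
      case (elim L)
      then interpret kernel "spread_kernel F L" by simp
      have L: "1 \<le> real L" "3 * A \<le> real L" using elim(2) by linarith+
      have K1: "1 \<le> L ^ CARD('n)" using elim(2) by simp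
      have "real L ^ 1 \<le> real L ^ CARD('n)" using L by (intro power_increasing) auto
      then have K3: "3 * A \<le> real (L ^ CARD('n))"
        using L(2) unfolding of_nat_power power_one_right by linarith
      have dec: "conv_power (spread_kernel F L) n x \<le> A / real (L ^ CARD('n)) * real n powr (- 3 / 2)" if "1 \<le> n" for n x
        using elim(1) that by blast
      have "1 / (real (L ^ CARD('n)) * sqrt (real (L ^ CARD('n)))) = real L powr (- (3 * real CARD('n) / 2))"
      proof -
        have "real L powr (- (3 * real CARD('n) / 2)) = (real L powr real CARD('n)) powr (- 3 / 2)"
          by (simp add: powr_powr mult.commute)
        also have "real L powr real CARD('n) = real (L ^ CARD('n))"
          using L by (simp add: powr_realpow)
        also have "\<dots> powr (- 3 / 2) = 1 / (real (L ^ CARD('n)) * sqrt (real (L ^ CARD('n))))"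
          by (rule powr_m32) simp
        finally show ?thesis ..
      qed
      then show ?case
        using pc2_ge_of_decay[of UNIV "L ^ CARD('n)" A] K1 K3 A dec by simp
    qed
  qed
qed

text \<open>The dimension is \<open>d\<close> in the first part and \<open>CARD('n)\<close> in the
  second. The error o(d^(-2)) appears as an arbitrary positive multiple of d^(-2). Summability is
  asserted explicitly because \<open>infsum\<close> is 0 by default on families that are not
  summable.\<close>

theorem theorem2p8:
  shows "(\<forall>\<epsilon>>0. \<forall>\<^sub>F d in sequentially.
            pc2 (Zd d) (nn_kernel d)
              \<ge> ereal (1 + ln 2 / (2 * (real d)\<^sup>2) - \<epsilon> / (real d)\<^sup>2))
       \<and> (\<forall>F :: real ^ 'n \<Rightarrow> real.
            CARD('n) \<ge> 3 \<longrightarrow>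
            (\<forall>x. F x \<ge> 0) \<longrightarrow>
            continuous_on UNIV F \<longrightarrow>
            compact (closure {x. F x \<noteq> 0}) \<longrightarrow>
            (F has_integral 1) UNIV \<longrightarrow>
            (\<forall>i x. F (\<chi> j. if j = i then - (x $ j) else x $ j) = F x) \<longrightarrow>
            (\<exists>C. \<forall>\<^sub>F L in sequentially.
               (\<lambda>k. conv_power (spread_kernel F L) (2 * k) 0) summable_on {2..} \<and>
               pc2 (UNIV :: (int ^ 'n) set) (spread_kernel F L)
                 \<ge> ereal (1 + ln 2 * (\<Sum>\<^sub>\<infinity>k\<in>{2..}. conv_power (spread_kernel F L) (2 * k) 0)
                            - C * real L powr (- (3 * real CARD('n) / 2)))))"
proof (intro conjI allI impI)
  fix \<epsilon> :: real assume "0 < \<epsilon>"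
  then show "\<forall>\<^sub>F d in sequentially.
      ereal (1 + ln 2 / (2 * (real d)\<^sup>2) - \<epsilon> / (real d)\<^sup>2) \<le> pc2 (Zd d) (nn_kernel d)"
    by (rule eventually_pc2_nn_ge)
next
  fix F :: "real ^ 'n \<Rightarrow> real"
  assume "CARD('n) \<ge> 3" "\<forall>x. F x \<ge> 0" "continuous_on UNIV F" "compact (closure {x. F x \<noteq> 0})"
    "(F has_integral 1) UNIV" "\<forall>i x. F (\<chi> j. if j = i then - (x $ j) else x $ j) = F x"
  then show "\<exists>C. \<forall>\<^sub>F L in sequentially.
      (\<lambda>k. conv_power (spread_kernel F L) (2 * k) 0) summable_on {2..} \<and>
      ereal (1 + ln 2 * (\<Sum>\<^sub>\<infinity>k\<in>{2..}. conv_power (spread_kernel F L) (2 * k) 0)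
        - C * real L powr (- (3 * real CARD('n) / 2))) \<le> pc2 (UNIV :: (int ^ 'n) set) (spread_kernel F L)"
    by (intro spread_out_bound) auto
qed

end
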